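(* Let $N\ge 2$, let $L = D^N - t_1(z)D^{N-1}+\dots+(-1)^{N-1}t_{N-1}(z)D+(-1)^N t_N(z)$, and for $n\ge 1$ let $L^{n/N}=P^n$, where $P=D+(\text{lower order terms in }D)$ is the $N$th root of $L$. Let $H_n=\frac{N}{n}\int \operatorname{Res} L^{n/N}$. Then the equation $\partial_{\tau_n}L=[L,(L^{n/N})_+]$, $n=1,2,\ldots$, can be represented in hamiltonian form as $$\partial_{\tau_n}L=\{L,H_{n+N}\}_1\qquad\text{and}\qquad \partial_{\tau_n}L=\{L,H_n\}_2 .$$ The hamiltonians $H_n$ commute with each other with respect to both Poisson structures: $\{H_n,H_m\}_1=\{H_n,H_m\}_2=0$.
   Context: $q\in\mathbb C^\times$ is generic, and $D$ is the $q$-shift $[D\cdot f](z)=f(zq)$, so $D\,f(z)=f(zq)\,D$ as operators. The $t_i(z)=\sum_{m\in\mathbb Z}t_i[m]z^{-m}$, $i=1,\dots,N$, are formal Laurent series whose coefficients $t_i[m]$ are regarded as coordinate functions on the space of operators $L$; $t_0(z)\equiv1$. Ring $\mathcal R_{q,N}$: start with $\mathcal R^{(0)}_{q,N}=\mathbb C[t_i(zq^j)]_{1\le i\le N,\,j\in\mathbb Z}$, on which $D$ acts. $\mathcal R_{q,N}$ is the smallest ring containing it as a subring on which $1+D+\dots+D^{N-1}$ is invertible (obtained by iteratively adjoining the solutions $f$ of $(1+D+\dots+D^{N-1})f=R$). Fourier coefficients of its elements $R(z)=\sum_m R[m]z^{-m}$ are linear combinations of series $\sum_{m_1+\dots+m_k=M}c(m_1,\dots,m_k)t_{i_1}[m_1]\cdots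 t_{i_k}[m_k]$, with $c$ a rational function of $q^{m_1},\dots,q^{m_k}$ without poles at integers $m_i$; such series are called $q$-local functionals. Write $\int R=R[0]$. $\mathcal P_{q,N}$ is the ring of operators $\sum_{n\le M}R_n(z)D^n$, $R_n\in\mathcal R_{q,N}$ (infinitely many negative powers allowed). For $R=\sum R_nD^n$: $R_+=\sum_{n\ge0}R_nD^n$, $R_-=\sum_{n<0}R_nD^n$, $\operatorname{Res}R=R_0$. The $N$th root $P\in\mathcal P_{q,N}$ of $L$, $P^N=L$, has the form $P=D+\sum_{m\ge0}p_mD^{-m}$. The equation $\partial_{\tau_n}L=[L,(L^{n/N})_+]=-[L,(L^{n/N})_-]$, read coefficientwise, defines $\partial_{\tau_n}t_i$ for $i=1,\dots,N$ (the right side has only powers $D^1,\dots,D^{N-1}$), and so a derivation $\partial_{\tau_n}$ of $\mathcal R_{q,N}$. Poisson brackets on $q$-local functionals are determined by the brackets of the generating series $t_i(z),t_j(w)$. With $\delta(x)=\sum_{m\in\mathbb Z}x^m$: $$\{t_i(z),t_j(w)\}_1=\delta\Big(\tfrac{wq^{N-j}}{z}\Big)t_N(z)\,t_{i+j-N}(w)-\delta\Big(\tfrac{w}{zq^{N-i}}\Big)t_{i+j-N}(z)\,t_N(w)$$ if $i,j\ne N$ and $i+j\ge N$, and $\{t_i(z),t_j(w)\}_1=0$ otherwise; for $i\le j$, $$\{t_i(z),t_j(w)\}_2=\sum_{m\in\mathbb Z}\Big(\tfrac wz\Big)^m\frac{(1-q^{im})(1-q^{m(N-j)})}{1-q^{mN}}t_i(z)t_j(w)+\sum_{r=1}^{\min(i,N-j)}\delta\Big(\tfrac{wq^r}{z}\Big)t_{i-r}(w)t_{j+r}(z)-\sum_{r=1}^{\min(i,N-j)}\delta\Big(\tfrac{w}{zq^{j-i+r}}\Big)t_{i-r}(z)t_{j+r}(w),$$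 where the $m=0$ coefficient in the first sum is understood as its limit, $0$. For a functional $H$, $\{L,H\}$ means $\sum_{k=1}^N(-1)^k\{t_k(z),H\}D^{N-k}$.
   Formalization: As printed, the first-bracket claims fail for nonconstant t_N(z); they are proved with the prefactor t_N replaced by (-1)^N, and for the printed {,}_1 only on t_N(z)=a constant, as {L,H_{n+N}}_1=(-1)^N a ∂_{τ_n}L and {H_n,H_m}_1=0. *)

theory Defs
  imports Complex_Main "HOL-Library.Multiset" "HOL-Library.Groups_Big_Fun"
begin

section \<open>Formal series in the coordinates $t_i[m]$\<close>

text \<open>The pair \<open>(i, m)\<close> stands for the coordinate $t_i[m]$, a multiset of pairs for a monomial.
  An element of \<open>fser\<close> is an arbitrary (possibly infinite) formal linear combination of monomials;
  the $q$-local functionals are particular such series.\<close>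

type_synonym mono = "(nat \<times> int) multiset"

typedef fser = "UNIV :: (mono \<Rightarrow> complex) set"
  morphisms coeff Fser by simp

setup_lifting type_definition_fser

lemma coeff_Fser [simp]: "coeff (Fser f) = f"
  by (simp add: Fser_inverse)

lemma fser_eqI: "(\<And>\<mu>. coeff f \<mu> = coeff g \<mu>) \<Longrightarrow> f = g"
  by (metis coeff_inverse ext)

definition splits :: "mono \<Rightarrow> (mono \<times> mono) set" where
  "splits \<mu> = {(\<alpha>, \<beta>). \<alpha> + \<beta> = \<mu>}"

lemma finite_submultisets: "finite {\<alpha>::'a multiset. \<alpha> \<subseteq># \<mu>}"
proof (rule finite_subset)
  show "{\<alpha>. \<alpha> \<subseteq># \<mu>} \<subseteq> mset ` {xs. set xs \<subseteq> set_mset \<mu> \<and> length xs \<le> size \<mu>}"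
  proof
    fix \<alpha> assume "\<alpha> \<in> {\<alpha>. \<alpha> \<subseteq># \<mu>}"
    moreover obtain xs where "\<alpha> = mset xs" by (metis ex_mset)
    ultimately show "\<alpha> \<in> mset ` {xs. set xs \<subseteq> set_mset \<mu> \<and> length xs \<le> size \<mu>}"
      using set_mset_mono[of \<alpha> \<mu>] size_mset_mono[of \<alpha> \<mu>] by auto
  qed
qed (simp add: finite_lists_length_le)

lemma finite_splits [simp]: "finite (splits \<mu>)"
proof -
  have "splits \<mu> \<subseteq> {\<alpha>. \<alpha> \<subseteq># \<mu>} \<times> {\<alpha>. \<alpha> \<subseteq># \<mu>}"
    by (auto simp: splits_def)
  then show ?thesis
    using finite_submultisets finite_subset by blast
qed

instantiation fser :: comm_ring_1
begin

lift_definition zero_fser :: fser is "\<lambda>_. 0" .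
lift_definition one_fser :: fser is "\<lambda>\<mu>. if \<mu> = {#} then 1 else 0" .
lift_definition plus_fser :: "fser \<Rightarrow> fser \<Rightarrow> fser" is "\<lambda>f g \<mu>. f \<mu> + g \<mu>" .
lift_definition minus_fser :: "fser \<Rightarrow> fser \<Rightarrow> fser" is "\<lambda>f g \<mu>. f \<mu> - g \<mu>" .
lift_definition uminus_fser :: "fser \<Rightarrow> fser" is "\<lambda>f \<mu>. - f \<mu>" .
lift_definition times_fser :: "fser \<Rightarrow> fser \<Rightarrow> fser" is
  "\<lambda>f g \<mu>. \<Sum>(\<alpha>, \<beta>)\<in>splits \<mu>. f \<alpha> * g \<beta>" .

instance
proof
  fix a b c :: fser
  show "a * b * c = a * (b * c)"
  proof (transfer, rule ext)
    fix f g h :: "mono \<Rightarrow> complex" and \<mu>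
    have "(\<Sum>(\<alpha>, \<beta>)\<in>splits \<mu>. (\<Sum>(\<alpha>, \<beta>)\<in>splits \<alpha>. f \<alpha> * g \<beta>) * h \<beta>)
        = (\<Sum>((\<alpha>, \<beta>), (\<gamma>, \<delta>))\<in>(SIGMA p:splits \<mu>. splits (fst p)). f \<gamma> * g \<delta> * h \<beta>)"
      by (subst sum.Sigma[symmetric]) (auto simp: sum_distrib_right case_prod_unfold)
    also have "\<dots> = (\<Sum>((\<alpha>, \<beta>), (\<gamma>, \<delta>))\<in>(SIGMA p:splits \<mu>. splits (snd p)). f \<alpha> * (g \<gamma> * h \<delta>))"
      by (rule sum.reindex_bij_witness[where
            i = "\<lambda>((\<alpha>, \<beta>), (\<gamma>, \<delta>)). ((\<alpha> + \<gamma>, \<delta>), (\<alpha>, \<gamma>))" and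
            j = "\<lambda>((\<alpha>, \<beta>), (\<gamma>, \<delta>)). ((\<gamma>, \<delta> + \<beta>), (\<delta>, \<beta>))"])
         (auto simp: splits_def add.assoc)
    also have "\<dots> = (\<Sum>(\<alpha>, \<beta>)\<in>splits \<mu>. f \<alpha> * (\<Sum>(\<alpha>, \<beta>)\<in>splits \<beta>. g \<alpha> * h \<beta>))"
      by (subst sum.Sigma[symmetric]) (auto simp: sum_distrib_left case_prod_unfold)
    finally show "(\<Sum>(\<alpha>, \<beta>)\<in>splits \<mu>. (\<Sum>(\<alpha>, \<beta>)\<in>splits \<alpha>. f \<alpha> * g \<beta>) * h \<beta>)
        = (\<Sum>(\<alpha>, \<beta>)\<in>splits \<mu>. f \<alpha> * (\<Sum>(\<alpha>, \<beta>)\<in>splits \<beta>. g \<alpha> * h \<beta>))" .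
  qed
  show "a * b = b * a"
  proof (transfer, rule ext)
    fix f g :: "mono \<Rightarrow> complex" and \<mu>
    show "(\<Sum>(\<alpha>, \<beta>)\<in>splits \<mu>. f \<alpha> * g \<beta>) = (\<Sum>(\<alpha>, \<beta>)\<in>splits \<mu>. g \<alpha> * f \<beta>)"
      by (rule sum.reindex_bij_witness[where i = prod.swap and j = prod.swap])
         (auto simp: splits_def add.commute)
  qed
  show "1 * a = a"
  proof (transfer, rule ext)
    fix f :: "mono \<Rightarrow> complex" and \<mu>
    have "(\<Sum>(\<alpha>, \<beta>)\<in>splits \<mu>. (if \<alpha> = {#} then 1 else 0) * f \<beta>)
        = (\<Sum>(\<alpha>, \<beta>)\<in>{({#} :: mono, \<mu>)}. (if \<alpha> = {#} then 1 else 0) * f \<beta>)"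
      by (rule sum.mono_neutral_right[OF finite_splits]) (auto simp: splits_def split: if_splits)
    then show "(\<Sum>(\<alpha>, \<beta>)\<in>splits \<mu>. (if \<alpha> = {#} then 1 else 0) * f \<beta>) = f \<mu>"
      by simp
  qed
  show "(a + b) * c = a * c + b * c"
    by (transfer, rule ext) (simp add: algebra_simps sum.distrib case_prod_unfold)
  show "(0::fser) \<noteq> 1"
    by transfer (metis zero_neq_one)
qed (transfer; auto simp: algebra_simps fun_eq_iff)+

end

lemma coeff_zero [simp]: "coeff 0 \<mu> = 0" by transfer simp
lemma coeff_one: "coeff 1 \<mu> = (if \<mu> = {#} then 1 else 0)" by transfer simp
lemma coeff_plus [simp]: "coeff (f + g) \<mu> = coeff f \<mu> + coeff g \<mu>" by transfer simp
lemma coeff_minus [simp]: "coeff (f - g) \<mu> = coeff f \<mu> - coeff g \<mu>" by transfer simp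
lemma coeff_uminus [simp]: "coeff (- f) \<mu> = - coeff f \<mu>" by transfer simp
lemma coeff_times: "coeff (f * g) \<mu> = (\<Sum>(\<alpha>, \<beta>)\<in>splits \<mu>. coeff f \<alpha> * coeff g \<beta>)"
  by transfer simp

definition fconst :: "complex \<Rightarrow> fser" where
  "fconst c = Fser (\<lambda>\<mu>. if \<mu> = {#} then c else 0)"

definition coord :: "nat \<Rightarrow> int \<Rightarrow> fser" where
  "coord i m = Fser (\<lambda>\<mu>. if \<mu> = {#(i, m)#} then 1 else 0)"

definition fderiv :: "nat \<Rightarrow> int \<Rightarrow> fser \<Rightarrow> fser" where
  "fderiv i m f = Fser (\<lambda>\<mu>. of_nat (count \<mu> (i, m) + 1) * coeff f (add_mset (i, m) \<mu>))"

text \<open>Infinite sums of series are taken coefficientwise. All those below are locally finite,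
  i.e. each monomial gets only finitely many contributions, because $t_i[m]$ has weight $m$ and
  the summands are homogeneous.\<close>

definition formal_sum :: "('i \<Rightarrow> fser) \<Rightarrow> fser" where
  "formal_sum f = Fser (\<lambda>\<mu>. Sum_any (\<lambda>i. coeff (f i) \<mu>))"

definition wt :: "mono \<Rightarrow> int" where
  "wt \<mu> = (\<Sum>p\<in>#\<mu>. snd p)"

lemma wt_add [simp]: "wt (\<alpha> + \<beta>) = wt \<alpha> + wt \<beta>"
  by (simp add: wt_def)

lemma wt_empty [simp]: "wt {#} = 0"
  by (simp add: wt_def)

lemma wt_single [simp]: "wt {#p#} = snd p"
  by (simp add: wt_def)

definition homogeneous :: "int \<Rightarrow> fser \<Rightarrow> bool" where
  "homogeneous m f \<longleftrightarrow> (\<forall>\<mu>. coeff f \<mu> \<noteq> 0 \<longrightarrow> wt \<mu> = m)"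


section \<open>Laurent series $R(z) = \sum_m R[m] z^{-m}$\<close>

text \<open>The coefficient of $z^{-m}$ is required to be homogeneous of weight $m$, as it is for all
  elements of the ring generated by the $t_i(zq^j)$; this makes products well defined.\<close>

typedef qfield = "{R :: int \<Rightarrow> fser. \<forall>m. homogeneous m (R m)}"
  morphisms fourier Qfield
  by (rule exI[of _ "\<lambda>_. 0"]) (simp add: homogeneous_def)

setup_lifting type_definition_qfield

lemma homogeneous_fourier: "homogeneous m (fourier R m)"
  using fourier by blast

lemma homogeneous_0 [simp]: "homogeneous m 0"
  by (simp add: homogeneous_def)

lemma homogeneous_add: "homogeneous m f \<Longrightarrow> homogeneous m g \<Longrightarrow> homogeneous m (f + g)"
  by (auto simp: homogeneous_def) (metis add_0)

lemma homogeneous_diff: "homogeneous m f \<Longrightarrow> homogeneous m g \<Longrightarrow> homogeneous m (f - g)"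
  by (auto simp: homogeneous_def) (metis diff_0_right)

lemma homogeneous_uminus: "homogeneous m f \<Longrightarrow> homogeneous m (- f)"
  by (auto simp: homogeneous_def)

lemma coeff_times_nonzero:
  assumes "coeff (f * g) \<mu> \<noteq> 0"
  shows "\<exists>\<alpha> \<beta>. \<mu> = \<alpha> + \<beta> \<and> coeff f \<alpha> \<noteq> 0 \<and> coeff g \<beta> \<noteq> 0"
proof -
  from assms obtain p where "p \<in> splits \<mu>" "(case p of (\<alpha>, \<beta>) \<Rightarrow> coeff f \<alpha> * coeff g \<beta>) \<noteq> 0"
    unfolding coeff_times by (rule sum.not_neutral_contains_not_neutral)
  then show ?thesis by (cases p) (auto simp: splits_def)
qed

lemma homogeneous_times: "homogeneous m f \<Longrightarrow> homogeneous n g \<Longrightarrow> homogeneous (m + n) (f * g)"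
  unfolding homogeneous_def by (metis coeff_times_nonzero wt_add)

lemma homogeneous_formal_sum:
  assumes "\<And>i. homogeneous m (f i)"
  shows "homogeneous m (formal_sum f)"
proof -
  have "coeff (formal_sum f) \<mu> = 0" if "wt \<mu> \<noteq> m" for \<mu>
  proof -
    have "(\<lambda>i. coeff (f i) \<mu>) = (\<lambda>i. 0)"
      using assms that by (auto simp: homogeneous_def)
    from fun_cong[OF this] show ?thesis by (simp add: formal_sum_def)
  qed
  then show ?thesis by (auto simp: homogeneous_def)
qed

text \<open>\<open>total\<close> sets $z = 1$. By homogeneity nothing is lost; it is used only to obtain the ring laws.\<close>

definition total :: "qfield \<Rightarrow> fser" where
  "total R = Fser (\<lambda>\<mu>. coeff (fourier R (wt \<mu>)) \<mu>)"

lemma fourier_total: "coeff (fourier R m) \<mu> = (if wt \<mu> = m then coeff (total R) \<mu> else 0)"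
  using homogeneous_fourier[of m R] by (auto simp: total_def homogeneous_def)

lemma total_inject: "total R = total S \<Longrightarrow> R = S"
  by (metis (no_types, lifting) ext fourier_inject fourier_total fser_eqI)

instantiation qfield :: comm_ring_1
begin

lift_definition zero_qfield :: qfield is "\<lambda>_. 0" by simp
lift_definition one_qfield :: qfield is "\<lambda>m. if m = 0 then 1 else 0"
  by (auto simp: homogeneous_def coeff_one split: if_splits)
lift_definition plus_qfield :: "qfield \<Rightarrow> qfield \<Rightarrow> qfield" is "\<lambda>R S m. R m + S m"
  by (simp add: homogeneous_add)
lift_definition minus_qfield :: "qfield \<Rightarrow> qfield \<Rightarrow> qfield" is "\<lambda>R S m. R m - S m"
  by (simp add: homogeneous_diff)
lift_definition uminus_qfield :: "qfield \<Rightarrow> qfield" is "\<lambda>R m. - R m"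
  by (simp add: homogeneous_uminus)
lift_definition times_qfield :: "qfield \<Rightarrow> qfield \<Rightarrow> qfield" is
  "\<lambda>R S n. formal_sum (\<lambda>m. R m * S (n - m))"
  by (rule homogeneous_formal_sum)
     (metis homogeneous_times add.commute diff_add_cancel)

lemma total_0: "total 0 = 0"
  by (rule fser_eqI) (simp add: total_def zero_qfield.rep_eq)

lemma total_1: "total 1 = 1"
  by (rule fser_eqI) (simp add: total_def one_qfield.rep_eq coeff_one)

lemma total_plus: "total (R + S) = total R + total S"
  by (rule fser_eqI) (simp add: total_def plus_qfield.rep_eq)

lemma total_minus: "total (R - S) = total R - total S"
  by (rule fser_eqI) (simp add: total_def minus_qfield.rep_eq)

lemma total_uminus: "total (- R) = - total R"
  by (rule fser_eqI) (simp add: total_def uminus_qfield.rep_eq)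

lemma total_times: "total (R * S) = total R * total S"
proof (rule fser_eqI)
  fix \<mu>
  let ?g = "\<lambda>m (\<alpha>, \<beta>). if wt \<alpha> = m then coeff (total R) \<alpha> * coeff (total S) \<beta> else 0"
  have eq: "coeff (fourier R m * fourier S (wt \<mu> - m)) \<mu> = (\<Sum>p\<in>splits \<mu>. ?g m p)" for m
    unfolding coeff_times
    by (rule sum.cong) (auto simp: fourier_total splits_def)
  have "coeff (total (R * S)) \<mu> = Sum_any (\<lambda>m. \<Sum>p\<in>splits \<mu>. ?g m p)"
    by (simp add: total_def times_qfield.rep_eq formal_sum_def eq)
  also have "\<dots> = (\<Sum>m\<in>wt ` fst ` splits \<mu>. \<Sum>p\<in>splits \<mu>. ?g m p)"
  proof (rule Sum_any.expand_superset)
    show "{m. (\<Sum>p\<in>splits \<mu>. ?g m p) \<noteq> 0} \<subseteq> wt ` fst ` splits \<mu>"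
    proof (rule subsetI, rule ccontr)
      fix m assume "m \<in> {m. (\<Sum>p\<in>splits \<mu>. ?g m p) \<noteq> 0}" and m: "m \<notin> wt ` fst ` splits \<mu>"
      moreover have "(\<Sum>p\<in>splits \<mu>. ?g m p) = 0"
        using m by (intro sum.neutral) force
      ultimately show False by simp
    qed
  qed simp
  also have "\<dots> = (\<Sum>p\<in>splits \<mu>. \<Sum>m\<in>wt ` fst ` splits \<mu>. ?g m p)"
    by (rule sum.swap)
  also have "\<dots> = (\<Sum>(\<alpha>, \<beta>)\<in>splits \<mu>. coeff (total R) \<alpha> * coeff (total S) \<beta>)"
    by (intro sum.cong) (force simp: case_prod_unfold image_image)+
  finally show "coeff (total (R * S)) \<mu> = coeff (total R * total S) \<mu>"
    by (simp add: coeff_times)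
qed

instance
  by standard
     (auto intro!: total_inject simp: total_0 total_1 total_plus total_minus total_uminus total_times
       algebra_simps dest!: arg_cong[where f = total])

end

definition const_field :: "complex \<Rightarrow> qfield" where
  "const_field c = Qfield (\<lambda>m. if m = 0 then fconst c else 0)"

definition tgen :: "nat \<Rightarrow> qfield" where
  "tgen i = (if i = 0 then 1 else Qfield (coord i))"

definition qshift :: "complex \<Rightarrow> int \<Rightarrow> qfield \<Rightarrow> qfield" where
  "qshift q j R = Qfield (\<lambda>m. fconst (q powi (- (j * m))) * fourier R m)"

definition integral0 :: "qfield \<Rightarrow> fser" where
  "integral0 R = fourier R 0"

text \<open>The smallest ring of such series that contains $\mathbb{C}[t_i(zq^j)]$ and on which
  $1 + D + \dots + D^{N-1}$ is invertible. Solutions of $(1 + D + \dots + D^{N-1}) f = R$ are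
  unique for $q$ not a root of unity.\<close>

inductive_set Rring :: "complex \<Rightarrow> nat \<Rightarrow> qfield set" for q :: complex and N :: nat where
  const: "const_field c \<in> Rring q N"
| gen: "1 \<le> i \<Longrightarrow> i \<le> N \<Longrightarrow> qshift q j (tgen i) \<in> Rring q N"
| add: "f \<in> Rring q N \<Longrightarrow> g \<in> Rring q N \<Longrightarrow> f + g \<in> Rring q N"
| mult: "f \<in> Rring q N \<Longrightarrow> g \<in> Rring q N \<Longrightarrow> f * g \<in> Rring q N"
| shift: "f \<in> Rring q N \<Longrightarrow> qshift q j f \<in> Rring q N"
| adjoin: "(\<Sum>j<N. qshift q (int j) f) \<in> Rring q N \<Longrightarrow> f \<in> Rring q N"


section \<open>$q$-pseudodifference operators\<close>

text \<open>\<open>A\<close> stands for $\sum_n A_n(z) D^n$, where \<open>A n = 0\<close> for all large \<open>n\<close>.\<close>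

type_synonym qop = "int \<Rightarrow> qfield"

definition Pring :: "complex \<Rightarrow> nat \<Rightarrow> qop set" where
  "Pring q N = {A. (\<exists>M. \<forall>n>M. A n = 0) \<and> (\<forall>n. A n \<in> Rring q N)}"

definition op_one :: qop where
  "op_one n = (if n = 0 then 1 else 0)"

definition op_mult :: "complex \<Rightarrow> qop \<Rightarrow> qop \<Rightarrow> qop" where
  "op_mult q A B n = Sum_any (\<lambda>a. A a * qshift q a (B (n - a)))"

definition op_power :: "complex \<Rightarrow> qop \<Rightarrow> nat \<Rightarrow> qop" where
  "op_power q A n = (op_mult q A ^^ n) op_one"

definition op_comm :: "complex \<Rightarrow> qop \<Rightarrow> qop \<Rightarrow> qop" where
  "op_comm q A B n = op_mult q A B n - op_mult q B A n"

definition op_plus_part :: "qop \<Rightarrow> qop" where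
  "op_plus_part A n = (if n \<ge> 0 then A n else 0)"

definition op_Res :: "qop \<Rightarrow> qfield" where
  "op_Res A = A 0"

definition lax_L :: "nat \<Rightarrow> qop" where
  "lax_L N n = (\<Sum>k=0..N. if n = int (N - k) then (-1) ^ k * tgen k else 0)"

definition lax_root :: "complex \<Rightarrow> nat \<Rightarrow> qop" where
  "lax_root q N = (THE P. P \<in> Pring q N \<and> P 1 = 1 \<and> (\<forall>n>1. P n = 0) \<and> op_power q P N = lax_L N)"

definition lax_frac_power :: "complex \<Rightarrow> nat \<Rightarrow> nat \<Rightarrow> qop" where
  "lax_frac_power q N n = op_power q (lax_root q N) n"

definition hamiltonian :: "complex \<Rightarrow> nat \<Rightarrow> nat \<Rightarrow> fser" where
  "hamiltonian q N n =
     fconst (of_nat N / of_nat n) * integral0 (op_Res (lax_frac_power q N n))"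


section \<open>The flows\<close>

definition flow_t :: "complex \<Rightarrow> nat \<Rightarrow> nat \<Rightarrow> nat \<Rightarrow> qfield" where
  "flow_t q N n i =
     (-1) ^ i * op_comm q (lax_L N) (op_plus_part (lax_frac_power q N n)) (int N - int i)"

text \<open>The derivation with $\partial_{\tau_n} t_i(z)$ as above, acting by the chain rule.\<close>

definition flow_fser :: "complex \<Rightarrow> nat \<Rightarrow> nat \<Rightarrow> fser \<Rightarrow> fser" where
  "flow_fser q N n f =
     (\<Sum>i=1..N. formal_sum (\<lambda>m. fderiv i m f * fourier (flow_t q N n i) m))"

definition flow :: "complex \<Rightarrow> nat \<Rightarrow> nat \<Rightarrow> qfield \<Rightarrow> qfield" where
  "flow q N n R = Qfield (\<lambda>m. flow_fser q N n (fourier R m))"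

definition flow_L :: "complex \<Rightarrow> nat \<Rightarrow> nat \<Rightarrow> qop" where
  "flow_L q N n k = flow q N n (lax_L N k)"


section \<open>Poisson brackets\<close>

text \<open>\<open>kernel c R S m n\<close> is the coefficient of $z^{-m} w^{-n}$ in $\sum_k c_k (w/z)^k R(z) S(w)$;
  for \<open>c = delta_coef a\<close> the kernel is $\delta(aw/z)$.\<close>

definition kernel :: "(int \<Rightarrow> complex) \<Rightarrow> qfield \<Rightarrow> qfield \<Rightarrow> int \<Rightarrow> int \<Rightarrow> fser" where
  "kernel c R S m n = formal_sum (\<lambda>k. fconst (c k) * (fourier R (m - k) * fourier S (n + k)))"

definition delta_coef :: "complex \<Rightarrow> int \<Rightarrow> complex" where
  "delta_coef a k = a powi k"

text \<open>A family \<open>b\<close> with \<open>b i j m n\<close> $= \{t_i[m], t_j[n]\}$ encodes the brackets of the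
  generating series $\{t_i(z), t_j(w)\}$.\<close>

type_synonym gen_bracket = "nat \<Rightarrow> nat \<Rightarrow> int \<Rightarrow> int \<Rightarrow> fser"

text \<open>The bracket
  $\delta(wq^{N-j}/z)\,u(z)\,t_{i+j-N}(w) - \delta(w/(zq^{N-i}))\,t_{i+j-N}(z)\,u(w)$.\<close>

definition bracket1_with :: "complex \<Rightarrow> nat \<Rightarrow> qfield \<Rightarrow> gen_bracket" where
  "bracket1_with q N u i j m n =
     (if i \<noteq> N \<and> j \<noteq> N \<and> i + j \<ge> N
      then kernel (delta_coef (q ^ (N - j))) u (tgen (i + j - N)) m n
         - kernel (delta_coef (1 / q ^ (N - i))) (tgen (i + j - N)) u m n
      else 0)"

definition bracket1 :: "complex \<Rightarrow> nat \<Rightarrow> gen_bracket" where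
  "bracket1 q N = bracket1_with q N (tgen N)"

text \<open>For the grading $\deg t_i = i$, $H_n$ has degree $n$, $\partial_{\tau_n}$ raises degrees by
  $n$, and \<open>bracket1\<close> preserves degrees. Hence $\{\cdot, H_{n+N}\}_1$ raises degrees by $n + N$ and
  can agree with $\partial_{\tau_n}$ only where $t_N(z)$ is a constant $a$; there it equals
  $(-1)^N a\,\partial_{\tau_n}$. On the space of all $L$ the prefactor $t_N$ must be replaced by
  $(-1)^N$, which gives the derivative of \<open>bracket2\<close> in the direction $L \mapsto L + \lambda$ and
  agrees with \<open>bracket1\<close> on the level set $t_N(z) \equiv (-1)^N$.\<close>

definition bracket1_corr :: "complex \<Rightarrow> nat \<Rightarrow> gen_bracket" where
  "bracket1_corr q N = bracket1_with q N ((-1) ^ N)"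

definition bracket2_le :: "complex \<Rightarrow> nat \<Rightarrow> gen_bracket" where
  "bracket2_le q N i j m n =
     kernel (\<lambda>k. if k = 0 then 0
                 else (1 - q powi (int i * k)) * (1 - q powi (k * int (N - j))) / (1 - q powi (k * int N)))
            (tgen i) (tgen j) m n
     + (\<Sum>r=1..min i (N - j). kernel (delta_coef (q ^ r)) (tgen (j + r)) (tgen (i - r)) m n)
     - (\<Sum>r=1..min i (N - j). kernel (delta_coef (1 / q ^ (j - i + r))) (tgen (i - r)) (tgen (j + r)) m n)"

definition bracket2 :: "complex \<Rightarrow> nat \<Rightarrow> gen_bracket" where
  "bracket2 q N i j m n =
     (if i \<le> j then bracket2_le q N i j m n else - bracket2_le q N j i n m)"

text \<open>Extension to functionals by the Leibniz rule. The sum over modes is locally finite when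
  \<open>F\<close> and \<open>G\<close> are homogeneous.\<close>

definition pbracket :: "nat \<Rightarrow> gen_bracket \<Rightarrow> fser \<Rightarrow> fser \<Rightarrow> fser" where
  "pbracket N b F G =
     (\<Sum>i=1..N. \<Sum>j=1..N. formal_sum (\<lambda>(m, n). fderiv i m F * fderiv j n G * b i j m n))"

definition field_bracket :: "nat \<Rightarrow> gen_bracket \<Rightarrow> nat \<Rightarrow> fser \<Rightarrow> qfield" where
  "field_bracket N b k H = Qfield (\<lambda>m. pbracket N b (coord k m) H)"

definition L_bracket :: "nat \<Rightarrow> gen_bracket \<Rightarrow> fser \<Rightarrow> qop" where
  "L_bracket N b H n =
     (\<Sum>k=1..N. if n = int (N - k) then (-1) ^ k * field_bracket N b k H else 0)"

text \<open>Restriction of a functional to the level set $t_N(z) \equiv a$, i.e. substitution of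
  $t_N[m] = a\,\delta_{m,0}$.\<close>

definition restrict_tN :: "nat \<Rightarrow> complex \<Rightarrow> fser \<Rightarrow> fser" where
  "restrict_tN N a f = Fser (\<lambda>\<mu>.
     if \<exists>m. (N, m) \<in># \<mu> then 0
     else Sum_any (\<lambda>k. a ^ k * coeff f (\<mu> + replicate_mset k (N, 0))))"

end

theory Submission
  imports Defs
begin

text \<open>Write $L = \sum_i s_i D^{N-i}$ with $s_i = (-1)^i t_i$. The residue trace $\int \operatorname{Res}$ is
  cyclic, so $dH_n = \int \operatorname{Res}(Z\, dL)$ with $Z = P^n L^{-1}$, which commutes with $L$; hence
  $\delta H_n / \delta s_i = D^{N-i}(Z_{i-N})$. Inserting this into the brackets, the first (with prefactor
  $(-1)^N$) becomes the linear bracket $[L, Z_+] = -[L, Z_-]$, and the second becomes the quadratic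
  bracket $L (Z_- L)_+ - (L Z_-)_+ L = [L, (L Z)_+]$ up to terms with the symbol
  $(1 - q^{km})(1 - q^{m(N-j)}) / (1 - q^{mN})$; these are the missing terms with $j = 0$, because
  $\operatorname{Res}(L Z) = \operatorname{Res}(Z L)$. As $Z$ for $H_{n+N}$ is $P^n$, both give
  $\partial_{\tau_n} L$. The derivative of $H_m$ along a flow $[L, A_+]$ with $[L, A] = 0$ is
  $\int \operatorname{Res}(Z [L, A_+]) = \int \operatorname{Res}([Z, L] A_+) = 0$. Finally, substituting $t_N(z) = a$
  is a ring homomorphism on series of bounded degree, and it replaces the prefactor $t_N$ by $a$.\<close>


section \<open>Formal series\<close>

text \<open>The factor N/n is what makes \<open>Z\<close> come out without a constant. Writing Tr
  for the residue trace, dH_n = N Tr(P^(n-1) dP), while d(P^N) contributes N cyclically equal terms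
  and Z P^(N-1) = P^(n-1). The obstacle in the quadratic case is that s_0 = 1 is no coordinate: the
  commutator contains the component Y_0 of Z, and H_n has no variational derivative in that
  direction. Comparing Res(L Z) with Res(Z L) at weight w, with x = q^w, says that the terms (1 -
  x^(N-j)) s_j Y_j sum to 0. Solving for Y_0 divides by 1 - x^N; this is the origin of the
  denominator in the bracket. A second asymmetry: the bracket is prescribed for i \<le> j and
  extended by skew symmetry, while the commutator formula treats all i, j alike. The two symbols
  differ by q^((i-j)w) - 1, which restores two boundary terms. Infinite sums are controlled
  throughout by weights. Genericity of q enters through the nonvanishing of 1 + x + ... + x^(N-1)
  and, for w nonzero, of 1 - x^N.\<close>

lemma splits_iff [simp]: "(\<alpha>, \<beta>) \<in> splits \<mu> \<longleftrightarrow> \<alpha> + \<beta> = \<mu>"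
  by (simp add: splits_def)

lemma coeff_fconst: "coeff (fconst c) \<mu> = (if \<mu> = {#} then c else 0)"
  by (simp add: fconst_def)

lemma coeff_fconst_times [simp]: "coeff (fconst c * f) \<mu> = c * coeff f \<mu>"
proof -
  have "(\<Sum>(\<alpha>, \<beta>)\<in>splits \<mu>. coeff (fconst c) \<alpha> * coeff f \<beta>)
      = (\<Sum>(\<alpha>, \<beta>)\<in>{({#}, \<mu>)}. coeff (fconst c) \<alpha> * coeff f \<beta>)"
    by (rule sum.mono_neutral_right) (auto simp: coeff_fconst split: if_splits)
  then show ?thesis by (simp add: coeff_times coeff_fconst)
qed

lemma coeff_sum: "coeff (sum f S) \<mu> = (\<Sum>i\<in>S. coeff (f i) \<mu>)"
  by (induction S rule: infinite_finite_induct) auto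

lemma coeff_times_nonzeroE:
  assumes "coeff (f * g) \<mu> \<noteq> 0"
  obtains \<alpha> \<beta> where "(\<alpha>, \<beta>) \<in> splits \<mu>" "coeff f \<alpha> \<noteq> 0" "coeff g \<beta> \<noteq> 0"
  using coeff_times_nonzero[OF assms] by (auto simp: splits_iff)

section \<open>Locally finite sums\<close>

lemma coeff_formal_sum: "coeff (formal_sum f) \<mu> = Sum_any (\<lambda>i. coeff (f i) \<mu>)"
  by (simp add: formal_sum_def)

text \<open>\<open>Sum_any\<close> is 0 whenever infinitely many terms are nonzero, so this is the
  condition under which \<open>formal_sum\<close> behaves like a sum.\<close>

definition locally_finite :: "('i \<Rightarrow> fser) \<Rightarrow> bool" where
  "locally_finite f \<longleftrightarrow> (\<forall>\<mu>. finite {i. coeff (f i) \<mu> \<noteq> 0})"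

lemma locally_finite_add:
  assumes "locally_finite f" "locally_finite g"
  shows "locally_finite (\<lambda>i. f i + g i)"
  unfolding locally_finite_def
proof
  fix \<mu>
  have "{i. coeff (f i + g i) \<mu> \<noteq> 0} \<subseteq> {i. coeff (f i) \<mu> \<noteq> 0} \<union> {i. coeff (g i) \<mu> \<noteq> 0}"
    by auto
  with assms show "finite {i. coeff (f i + g i) \<mu> \<noteq> 0}"
    unfolding locally_finite_def by (meson finite_UnI finite_subset)
qed

lemma formal_sum_add:
  assumes "locally_finite f" "locally_finite g"
  shows "formal_sum (\<lambda>i. f i + g i) = formal_sum f + formal_sum g"
  using assms by (intro fser_eqI) (simp add: coeff_formal_sum locally_finite_def Sum_any.distrib)

lemma locally_finite_times:
  assumes "locally_finite g"
  shows "locally_finite (\<lambda>i. f * g i)"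
  unfolding locally_finite_def
proof
  fix \<mu>
  have "{i. coeff (f * g i) \<mu> \<noteq> 0} \<subseteq> (\<Union>p\<in>splits \<mu>. {i. coeff (g i) (snd p) \<noteq> 0})"
    by (auto elim!: coeff_times_nonzeroE)
  moreover have "finite \<dots>"
    using assms by (auto simp: locally_finite_def)
  ultimately show "finite {i. coeff (f * g i) \<mu> \<noteq> 0}"
    by (rule finite_subset)
qed

text \<open>A monomial has finitely many splittings, and each second part meets finitely many
  \<open>g i\<close>. One finite index set \<open>I\<close> therefore serves all splittings at once,
  and the two sums can be exchanged.\<close>

lemma formal_sum_times:
  assumes "locally_finite g"
  shows "formal_sum (\<lambda>i. f * g i) = f * formal_sum g"
proof (rule fser_eqI)
  fix \<mu>
  define I where "I = (\<Union>p\<in>splits \<mu>. {i. coeff (g i) (snd p) \<noteq> 0})"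
  have fin: "finite I"
    using assms by (auto simp: locally_finite_def I_def)
  have sub: "{i. coeff (f * g i) \<mu> \<noteq> 0} \<subseteq> I"
    unfolding I_def by (auto elim!: coeff_times_nonzeroE)
  have "coeff (formal_sum (\<lambda>i. f * g i)) \<mu>
      = (\<Sum>i\<in>I. \<Sum>p\<in>splits \<mu>. coeff f (fst p) * coeff (g i) (snd p))"
    unfolding coeff_formal_sum Sum_any.expand_superset[OF fin sub]
    by (simp add: coeff_times case_prod_unfold)
  also have "\<dots> = (\<Sum>p\<in>splits \<mu>. \<Sum>i\<in>I. coeff f (fst p) * coeff (g i) (snd p))"
    by (rule sum.swap)
  also have "\<dots> = (\<Sum>p\<in>splits \<mu>. coeff f (fst p) * coeff (formal_sum g) (snd p))"
  proof (rule sum.cong[OF refl])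
    fix p assume "p \<in> splits \<mu>"
    then have "{i. coeff (g i) (snd p) \<noteq> 0} \<subseteq> I" by (auto simp: I_def)
    then show "(\<Sum>i\<in>I. coeff f (fst p) * coeff (g i) (snd p))
        = coeff f (fst p) * coeff (formal_sum g) (snd p)"
      by (simp add: coeff_formal_sum Sum_any.expand_superset[OF fin] sum_distrib_left)
  qed
  finally show "coeff (formal_sum (\<lambda>i. f * g i)) \<mu> = coeff (f * formal_sum g) \<mu>"
    by (simp add: coeff_times case_prod_unfold)
qed

lemma formal_sum_bij:
  assumes "bij \<pi>"
  shows "formal_sum f = formal_sum (f \<circ> \<pi>)"
  by (rule fser_eqI) (simp add: coeff_formal_sum, rule Sum_any.reindex_cong[OF assms], auto)

lemma formal_sum_pairs:
  assumes "locally_finite f"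
  shows "formal_sum f = formal_sum (\<lambda>m. formal_sum (\<lambda>n. f (m, n)))"
    and "formal_sum f = formal_sum (\<lambda>n. formal_sum (\<lambda>m. f (m, n)))"
proof -
  have *: "coeff (formal_sum f) \<mu> = coeff (formal_sum (\<lambda>m. formal_sum (\<lambda>n. f (m, n)))) \<mu>
     \<and> coeff (formal_sum f) \<mu> = coeff (formal_sum (\<lambda>n. formal_sum (\<lambda>m. f (m, n)))) \<mu>" for \<mu>
  proof -
    define S where "S = {p. coeff (f p) \<mu> \<noteq> 0}"
    have fin: "finite (fst ` S \<times> snd ` S)"
      using assms by (auto simp: S_def locally_finite_def)
    have sub: "{m. \<exists>n. coeff (f (m, n)) \<mu> \<noteq> 0} \<times> {n. \<exists>m. coeff (f (m, n)) \<mu> \<noteq> 0}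
        \<subseteq> fst ` S \<times> snd ` S"
      by (auto simp: S_def) force+
    show ?thesis
      unfolding coeff_formal_sum
      using Sum_any.cartesian_product[OF fin sub] Sum_any.swap[OF fin sub] by simp
  qed
  show "formal_sum f = formal_sum (\<lambda>m. formal_sum (\<lambda>n. f (m, n)))"
    and "formal_sum f = formal_sum (\<lambda>n. formal_sum (\<lambda>m. f (m, n)))"
    using * by (auto intro: fser_eqI)
qed

lemma formal_sum_single:
  assumes "\<And>i. i \<noteq> i0 \<Longrightarrow> f i = 0"
  shows "formal_sum f = f i0"
proof (rule fser_eqI)
  fix \<mu>
  have "Sum_any (\<lambda>i. coeff (f i) \<mu>) = (\<Sum>i\<in>{i0}. coeff (f i) \<mu>)"
    by (rule Sum_any.expand_superset) (use assms in force)+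
  then show "coeff (formal_sum f) \<mu> = coeff (f i0) \<mu>"
    by (simp add: coeff_formal_sum)
qed

lemma formal_sum_sum:
  assumes "\<And>j. j \<in> J \<Longrightarrow> locally_finite (\<lambda>i. f i j)"
  shows "formal_sum (\<lambda>i. \<Sum>j\<in>J. f i j) = (\<Sum>j\<in>J. formal_sum (\<lambda>i. f i j))"
    and "locally_finite (\<lambda>i. \<Sum>j\<in>J. f i j)"
proof -
  have "formal_sum (\<lambda>i. \<Sum>j\<in>J. f i j) = (\<Sum>j\<in>J. formal_sum (\<lambda>i. f i j))
     \<and> locally_finite (\<lambda>i. \<Sum>j\<in>J. f i j)"
    using assms
  proof (induction J rule: infinite_finite_induct)
    case (insert j J)
    then have "locally_finite (\<lambda>i. f i j + (\<Sum>j\<in>J. f i j))"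
      by (intro locally_finite_add) auto
    with insert show ?case by (simp add: formal_sum_add)
  qed (auto simp: locally_finite_def intro: fser_eqI simp: coeff_formal_sum)
  then show "formal_sum (\<lambda>i. \<Sum>j\<in>J. f i j) = (\<Sum>j\<in>J. formal_sum (\<lambda>i. f i j))"
    "locally_finite (\<lambda>i. \<Sum>j\<in>J. f i j)" by auto
qed

text \<open>In a monomial of the triple product, the weights of the parts taken from
  \<open>f i\<close> and \<open>g i\<close> give \<open>w i\<close>, hence \<open>i\<close> by
  injectivity; the family \<open>h\<close> may be arbitrary.\<close>

lemma locally_finite_homogeneous2:
  assumes "inj w" "\<And>i. homogeneous (fst (w i)) (f i)" "\<And>i. homogeneous (snd (w i)) (g i)"
  shows "locally_finite (\<lambda>i. f i * g i * h i)"
  unfolding locally_finite_def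
proof
  fix \<mu>
  have "{i. coeff (f i * g i * h i) \<mu> \<noteq> 0}
      \<subseteq> w -` (\<Union>p\<in>splits \<mu>. (\<lambda>r. (wt (fst r), wt (snd r))) ` splits (fst p))"
  proof
    fix i assume "i \<in> {i. coeff (f i * g i * h i) \<mu> \<noteq> 0}"
    then obtain \<alpha> \<beta> where 1: "(\<alpha>, \<beta>) \<in> splits \<mu>" "coeff (f i * g i) \<alpha> \<noteq> 0"
      by (auto elim: coeff_times_nonzeroE)
    then obtain \<gamma> \<delta> where 2: "(\<gamma>, \<delta>) \<in> splits \<alpha>" "coeff (f i) \<gamma> \<noteq> 0" "coeff (g i) \<delta> \<noteq> 0"
      by (auto elim: coeff_times_nonzeroE)
    then have "w i = (wt \<gamma>, wt \<delta>)"
      using assms(2,3)[of i] by (auto simp: homogeneous_def intro: prod_eqI)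
    moreover have "(\<gamma>, \<delta>) \<in> splits (fst (\<alpha>, \<beta>))"
      using 2 by simp
    ultimately show "i \<in> w -` (\<Union>p\<in>splits \<mu>. (\<lambda>r. (wt (fst r), wt (snd r))) ` splits (fst p))"
      using 1(1) by (metis (mono_tags, lifting) UN_I fst_conv image_eqI snd_conv vimageI2)
  qed
  moreover have "finite \<dots>"
    using assms(1) by (intro finite_vimageI) auto
  ultimately show "finite {i. coeff (f i * g i * h i) \<mu> \<noteq> 0}"
    by (rule finite_subset)
qed

section \<open>Partial derivatives in the coordinates\<close>

lemma coeff_fderiv: "coeff (fderiv i m f) \<mu> = of_nat (count \<mu> (i, m) + 1) * coeff f (add_mset (i, m) \<mu>)"
  by (simp add: fderiv_def)

lemma fderiv_add: "fderiv i m (f + g) = fderiv i m f + fderiv i m g"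
  by (rule fser_eqI) (simp add: coeff_fderiv algebra_simps)

text \<open>Multiplicities add: each copy of \<open>(i, m)\<close> in a product monomial lies in one
  of the two parts. \<open>left\<close> and \<open>right\<close> take one copy out of the part that
  carries the count.\<close>

lemma fderiv_times: "fderiv i m (f * g) = fderiv i m f * g + f * fderiv i m g"
proof (rule fser_eqI)
  fix \<mu>
  define p where "p = (i, m)"
  have left: "(\<Sum>(\<alpha>, \<beta>)\<in>splits (add_mset p \<mu>). of_nat (count \<alpha> p) * F \<alpha> * G \<beta>)
      = (\<Sum>(\<alpha>, \<beta>)\<in>splits \<mu>. of_nat (count \<alpha> p + 1) * F (add_mset p \<alpha>) * G \<beta>)"
    for F G :: "mono \<Rightarrow> complex"
  proof -
    have "(\<Sum>(\<alpha>, \<beta>)\<in>splits (add_mset p \<mu>). of_nat (count \<alpha> p) * F \<alpha> * G \<beta>)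
        = (\<Sum>(\<alpha>, \<beta>)\<in>{(\<alpha>, \<beta>)\<in>splits (add_mset p \<mu>). p \<in># \<alpha>}. of_nat (count \<alpha> p) * F \<alpha> * G \<beta>)"
      by (rule sum.mono_neutral_right) (auto simp: not_in_iff)
    also have "\<dots> = (\<Sum>(\<alpha>, \<beta>)\<in>splits \<mu>. of_nat (count \<alpha> p + 1) * F (add_mset p \<alpha>) * G \<beta>)"
      by (rule sum.reindex_bij_witness[where i = "\<lambda>(\<alpha>, \<beta>). (add_mset p \<alpha>, \<beta>)"
            and j = "\<lambda>(\<alpha>, \<beta>). (\<alpha> - {#p#}, \<beta>)"])
         (auto simp: splits_iff dest!: multi_member_split)
    finally show ?thesis .
  qed
  have right: "(\<Sum>(\<alpha>, \<beta>)\<in>splits (add_mset p \<mu>). of_nat (count \<beta> p) * F \<alpha> * G \<beta>)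
      = (\<Sum>(\<alpha>, \<beta>)\<in>splits \<mu>. of_nat (count \<beta> p + 1) * F \<alpha> * G (add_mset p \<beta>))"
    for F G :: "mono \<Rightarrow> complex"
  proof -
    have swap: "(\<Sum>(\<alpha>, \<beta>)\<in>splits \<nu>. h \<alpha> \<beta>) = (\<Sum>(\<alpha>, \<beta>)\<in>splits \<nu>. h \<beta> \<alpha>)"
      for \<nu> and h :: "mono \<Rightarrow> mono \<Rightarrow> complex"
      by (rule sum.reindex_bij_witness[where i = prod.swap and j = prod.swap])
         (auto simp: splits_iff add.commute)
    show ?thesis
      using left[of G F] by (subst (1 2) swap) (simp add: mult_ac)
  qed
  have "coeff (fderiv i m (f * g)) \<mu>
      = (\<Sum>(\<alpha>, \<beta>)\<in>splits (add_mset p \<mu>). of_nat (count (add_mset p \<mu>) p) * coeff f \<alpha> * coeff g \<beta>)"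
    by (simp add: coeff_fderiv coeff_times sum_distrib_left case_prod_unfold p_def mult_ac)
  also have "\<dots> = (\<Sum>(\<alpha>, \<beta>)\<in>splits (add_mset p \<mu>). of_nat (count \<alpha> p) * coeff f \<alpha> * coeff g \<beta>
        + of_nat (count \<beta> p) * coeff f \<alpha> * coeff g \<beta>)"
  proof (rule sum.cong[OF refl], clarify)
    fix \<alpha> \<beta> assume "(\<alpha>, \<beta>) \<in> splits (add_mset p \<mu>)"
    then have "count (add_mset p \<mu>) p = count \<alpha> p + count \<beta> p"
      by (metis count_union splits_iff)
    then show "of_nat (count (add_mset p \<mu>) p) * coeff f \<alpha> * coeff g \<beta> =
       of_nat (count \<alpha> p) * coeff f \<alpha> * coeff g \<beta> + of_nat (count \<beta> p) * coeff f \<alpha> * coeff g \<beta>"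
      by (simp only: of_nat_add distrib_right)
  qed
  also have "\<dots> = coeff (fderiv i m f * g + f * fderiv i m g) \<mu>"
    using left[of "coeff f" "coeff g"] right[of "coeff f" "coeff g"]
    unfolding coeff_plus coeff_times
    by (simp add: sum.distrib case_prod_unfold coeff_fderiv p_def mult_ac)
  finally show "coeff (fderiv i m (f * g)) \<mu> = coeff (fderiv i m f * g + f * fderiv i m g) \<mu>" .
qed

lemma homogeneous_fderiv: "homogeneous w f \<Longrightarrow> homogeneous (w - m) (fderiv i m f)"
  unfolding homogeneous_def coeff_fderiv by (auto simp: wt_def)

lemma fderiv_coord: "fderiv i m (coord j n) = (if i = j \<and> m = n then 1 else 0)"
  by (rule fser_eqI) (auto simp: coeff_fderiv coord_def coeff_one)

lemma homogeneous_coord: "homogeneous m (coord i m)"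
  by (auto simp: homogeneous_def coord_def)

lemma homogeneous_fconst_times: "homogeneous m f \<Longrightarrow> homogeneous m (fconst c * f)"
  by (auto simp: homogeneous_def)

lemma homogeneous_sum: "(\<And>i. i \<in> S \<Longrightarrow> homogeneous m (f i)) \<Longrightarrow> homogeneous m (sum f S)"
  by (induction S rule: infinite_finite_induct) (auto intro: homogeneous_add)

text \<open>Multiplication by a variable only shifts coefficients to other monomials. This allows a
  test value to be stripped off again.\<close>

lemma coord_times_cancel:
  assumes "f * coord i m = g * coord i m"
  shows "f = g"
proof (rule fser_eqI)
  fix \<mu>
  have *: "coeff (h * coord i m) (add_mset (i, m) \<mu>) = coeff h \<mu>" for h
  proof -
    have "coeff (h * coord i m) (add_mset (i, m) \<mu>)
        = (\<Sum>(\<alpha>, \<beta>)\<in>{(\<mu>, {#(i, m)#})}. coeff h \<alpha> * coeff (coord i m) \<beta>)"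
      unfolding coeff_times
      by (rule sum.mono_neutral_right) (auto simp: coord_def split: if_splits)
    then show ?thesis by (simp add: coord_def)
  qed
  show "coeff f \<mu> = coeff g \<mu>"
    using arg_cong[OF assms, of "\<lambda>h. coeff h (add_mset (i, m) \<mu>)"] by (simp add: *)
qed


section \<open>Laurent series and derivations\<close>

lemma locally_finite_homogeneous1:
  assumes "inj w" "\<And>i. homogeneous (w i) (f i)"
  shows "locally_finite (\<lambda>i. g i * f i)"
  unfolding locally_finite_def
proof
  fix \<mu>
  have "{i. coeff (g i * f i) \<mu> \<noteq> 0} \<subseteq> w -` (wt ` snd ` splits \<mu>)"
  proof
    fix i assume "i \<in> {i. coeff (g i * f i) \<mu> \<noteq> 0}"
    then obtain \<alpha> \<beta> where "(\<alpha>, \<beta>) \<in> splits \<mu>" "coeff (f i) \<beta> \<noteq> 0"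
      by (auto elim: coeff_times_nonzeroE)
    moreover from this have "w i = wt (snd (\<alpha>, \<beta>))"
      using assms(2)[of i] by (simp add: homogeneous_def)
    ultimately show "i \<in> w -` (wt ` snd ` splits \<mu>)"
      by blast
  qed
  moreover have "finite \<dots>"
    using assms(1) by (intro finite_vimageI) auto
  ultimately show "finite {i. coeff (g i * f i) \<mu> \<noteq> 0}"
    by (rule finite_subset)
qed

text \<open>A monomial occurs only in the mode given by its weight, so a field has a single
  coefficient function. Identities between fields, also those with shifts, are then checked per
  monomial.\<close>

definition cf :: "qfield \<Rightarrow> mono \<Rightarrow> complex" where
  "cf R \<mu> = coeff (total R) \<mu>"

lemma cf_eqI: "(\<And>\<mu>. cf R \<mu> = cf S \<mu>) \<Longrightarrow> R = S"
  by (intro total_inject fser_eqI) (simp add: cf_def)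

lemma fourier_Qfield: "(\<And>m. homogeneous m (R m)) \<Longrightarrow> fourier (Qfield R) m = R m"
  by (simp add: Qfield_inverse)

lemma cf_Qfield: "(\<And>m. homogeneous m (R m)) \<Longrightarrow> cf (Qfield R) \<mu> = coeff (R (wt \<mu>)) \<mu>"
  by (simp add: cf_def total_def fourier_Qfield)

lemma coeff_fourier: "coeff (fourier R m) \<mu> = (if wt \<mu> = m then cf R \<mu> else 0)"
  by (simp add: fourier_total cf_def)

lemma fourier_eqI: "(\<And>m. fourier R m = fourier S m) \<Longrightarrow> R = S"
  by (metis ext fourier_inject)

lemma cf_0 [simp]: "cf 0 \<mu> = 0"
  and cf_1: "cf 1 \<mu> = (if \<mu> = {#} then 1 else 0)"
  and cf_add [simp]: "cf (R + S) \<mu> = cf R \<mu> + cf S \<mu>"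
  and cf_diff [simp]: "cf (R - S) \<mu> = cf R \<mu> - cf S \<mu>"
  and cf_uminus [simp]: "cf (- R) \<mu> = - cf R \<mu>"
  and cf_times: "cf (R * S) \<mu> = (\<Sum>(\<alpha>, \<beta>)\<in>splits \<mu>. cf R \<alpha> * cf S \<beta>)"
  by (simp_all add: cf_def total_0 total_1 coeff_one total_plus total_minus total_uminus total_times
      coeff_times)

lemma cf_sum [simp]: "cf (sum f S) \<mu> = (\<Sum>i\<in>S. cf (f i) \<mu>)"
  by (induction S rule: infinite_finite_induct) auto

lemma fourier_0 [simp]: "fourier 0 m = 0"
  and fourier_add: "fourier (R + S) m = fourier R m + fourier S m"
  and fourier_uminus: "fourier (- R) m = - fourier R m"
  by (auto intro!: fser_eqI simp: coeff_fourier)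

lemma fourier_sum: "fourier (sum f S) m = (\<Sum>i\<in>S. fourier (f i) m)"
  by (auto intro!: fser_eqI simp: coeff_fourier coeff_sum)

lemma fourier_times: "fourier (R * S) n = formal_sum (\<lambda>m. fourier R m * fourier S (n - m))"
  by (simp add: times_qfield.rep_eq)

lemma cf_neg_one_power_times [simp]: "cf ((-1) ^ k * R) \<mu> = (-1) ^ k * cf R \<mu>"
  by (cases "even k") auto

text \<open>Shifts, contractions with delta kernels, the symbol of the quadratic bracket and the
  inverse of 1 + D + ... + D^(N-1) all have this form.\<close>

definition multiplier :: "(int \<Rightarrow> complex) \<Rightarrow> qfield \<Rightarrow> qfield" where
  "multiplier c R = Qfield (\<lambda>m. fconst (c m) * fourier R m)"

lemma fourier_multiplier: "fourier (multiplier c R) m = fconst (c m) * fourier R m"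
  unfolding multiplier_def
  by (rule fourier_Qfield) (rule homogeneous_fconst_times[OF homogeneous_fourier])

lemma cf_multiplier [simp]: "cf (multiplier c R) \<mu> = c (wt \<mu>) * cf R \<mu>"
  unfolding multiplier_def
  by (subst cf_Qfield) (auto intro: homogeneous_fconst_times homogeneous_fourier simp: coeff_fourier)

lemma qshift_eq_multiplier: "qshift q j = multiplier (\<lambda>m. q powi (- (j * m)))"
  by (rule ext) (simp add: qshift_def multiplier_def)

lemma cf_qshift [simp]: "cf (qshift q j R) \<mu> = q powi (- (j * wt \<mu>)) * cf R \<mu>"
  by (simp add: qshift_eq_multiplier)

lemma cf_const_field: "cf (const_field c) \<mu> = (if \<mu> = {#} then c else 0)"
  unfolding const_field_def
  by (subst cf_Qfield) (auto simp: homogeneous_def coeff_fconst split: if_splits)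

lemma cf_const_field_times [simp]: "cf (const_field c * R) \<mu> = c * cf R \<mu>"
proof -
  have "total (const_field c) = fconst c"
    by (rule fser_eqI) (simp add: cf_const_field coeff_fconst flip: cf_def)
  then show ?thesis by (simp add: cf_def total_times)
qed

lemma tgen_0 [simp]: "tgen 0 = 1"
  by (simp add: tgen_def)

lemma fourier_tgen: "i \<ge> 1 \<Longrightarrow> fourier (tgen i) m = coord i m"
  by (simp add: tgen_def fourier_Qfield homogeneous_coord)

lemma cf_tgen: "i \<ge> 1 \<Longrightarrow> cf (tgen i) \<mu> = (if \<mu> = {#(i, wt \<mu>)#} then 1 else 0)"
  by (auto simp: tgen_def cf_Qfield[of "coord i", OF homogeneous_coord] coord_def)

lemma integral0_add: "integral0 (R + S) = integral0 R + integral0 S"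
  by (simp add: integral0_def fourier_add)

lemma integral0_sum: "integral0 (sum f S) = (\<Sum>i\<in>S. integral0 (f i))"
  by (simp add: integral0_def fourier_sum)

lemma integral0_qshift [simp]: "integral0 (qshift q j R) = integral0 R"
  by (rule fser_eqI) (simp add: integral0_def coeff_fourier)

lemma qshift_0_right [simp]: "qshift q j 0 = 0"
  and qshift_1 [simp]: "qshift q j 1 = 1"
  and qshift_add: "qshift q j (R + S) = qshift q j R + qshift q j S"
  and qshift_sum: "qshift q j (sum f A) = (\<Sum>i\<in>A. qshift q j (f i))"
  and qshift_neg_one_power_times: "qshift q j ((-1) ^ k * R) = (-1) ^ k * qshift q j R"
  and qshift_0 [simp]: "qshift q 0 R = R"
  by (auto intro!: cf_eqI simp: cf_1 distrib_left right_diff_distrib sum_distrib_left)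

lemma qshift_times:
  assumes "q \<noteq> 0"
  shows "qshift q j (R * S) = qshift q j R * qshift q j S"
proof (rule cf_eqI)
  fix \<mu>
  have "q powi (- (j * wt \<mu>)) * (cf R \<alpha> * cf S \<beta>)
      = (q powi (- (j * wt \<alpha>)) * cf R \<alpha>) * (q powi (- (j * wt \<beta>)) * cf S \<beta>)"
    if "\<alpha> + \<beta> = \<mu>" for \<alpha> \<beta>
  proof -
    have "- (j * wt \<mu>) = - (j * wt \<alpha>) + - (j * wt \<beta>)"
      using that by (auto simp: algebra_simps)
    then have "q powi (- (j * wt \<mu>)) = q powi (- (j * wt \<alpha>)) * q powi (- (j * wt \<beta>))"
      using assms by (metis power_int_add)
    then show ?thesis by simp
  qed
  then show "cf (qshift q j (R * S)) \<mu> = cf (qshift q j R * qshift q j S) \<mu>"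
    by (auto simp: cf_times sum_distrib_left intro!: sum.cong)
qed

lemma qshift_qshift:
  assumes "q \<noteq> 0"
  shows "qshift q i (qshift q j R) = qshift q (i + j) R"
  using assms by (intro cf_eqI) (simp add: distrib_right power_int_add power_int_diff power_int_minus
      divide_inverse)

text \<open>The evolutionary derivation that sends t_i(z) to \<open>v i\<close>. The fields are
  arbitrary because variational derivatives are read off with test fields that belong to no
  flow.\<close>

definition vder_fser :: "nat \<Rightarrow> (nat \<Rightarrow> qfield) \<Rightarrow> fser \<Rightarrow> fser" where
  "vder_fser N v f = (\<Sum>i=1..N. formal_sum (\<lambda>m. fderiv i m f * fourier (v i) m))"

definition vder :: "nat \<Rightarrow> (nat \<Rightarrow> qfield) \<Rightarrow> qfield \<Rightarrow> qfield" where
  "vder N v R = Qfield (\<lambda>m. vder_fser N v (fourier R m))"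

lemma flow_fser_eq_vder_fser: "flow_fser q N n = vder_fser N (flow_t q N n)"
  by (rule ext) (simp add: flow_fser_def vder_fser_def)

lemma flow_eq_vder: "flow q N n = vder N (flow_t q N n)"
  by (rule ext) (simp add: flow_def vder_def flow_fser_eq_vder_fser)

lemma locally_finite_vder: "locally_finite (\<lambda>m. g m * fourier R m)"
  by (rule locally_finite_homogeneous1[where w = id]) (simp_all add: homogeneous_fourier)

lemma vder_fser_add: "vder_fser N v (f + g) = vder_fser N v f + vder_fser N v g"
  unfolding vder_fser_def fderiv_add distrib_right
  by (simp add: formal_sum_add locally_finite_vder sum.distrib)

lemma vder_fser_times: "vder_fser N v (f * g) = vder_fser N v f * g + f * vder_fser N v g"
proof -
  have "fderiv i m (f * g) * fourier (v i) m
      = g * (fderiv i m f * fourier (v i) m) + f * (fderiv i m g * fourier (v i) m)" for i m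
    by (simp add: fderiv_times algebra_simps)
  then show ?thesis
    unfolding vder_fser_def
    by (simp add: formal_sum_add formal_sum_times locally_finite_times locally_finite_vder
        sum.distrib sum_distrib_left mult.commute[of _ g])
qed

lemma fderiv_fconst: "fderiv i m (fconst c) = 0"
  by (rule fser_eqI) (simp add: coeff_fderiv coeff_fconst)

lemma formal_sum_0 [simp]: "formal_sum (\<lambda>i. 0) = 0"
  by (rule fser_eqI) (simp add: coeff_formal_sum)

lemma vder_fser_fconst: "vder_fser N v (fconst c) = 0"
  by (simp add: vder_fser_def fderiv_fconst)

lemma vder_fser_fconst_times: "vder_fser N v (fconst c * f) = fconst c * vder_fser N v f"
  by (simp add: vder_fser_times vder_fser_fconst)

lemma vder_fser_coord:
  assumes "1 \<le> i" "i \<le> N"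
  shows "vder_fser N v (coord i m) = fourier (v i) m"
proof -
  have "formal_sum (\<lambda>n. fderiv j n (coord i m) * fourier (v j) n)
      = (if j = i then fourier (v i) m else 0)" for j
  proof -
    have "formal_sum (\<lambda>n. fderiv j n (coord i m) * fourier (v j) n)
        = fderiv j m (coord i m) * fourier (v j) m"
      by (rule formal_sum_single) (simp add: fderiv_coord)
    then show ?thesis by (simp add: fderiv_coord)
  qed
  with assms show ?thesis by (simp add: vder_fser_def)
qed

lemma homogeneous_vder_fser:
  assumes "homogeneous w f"
  shows "homogeneous w (vder_fser N v f)"
  unfolding vder_fser_def
  by (intro homogeneous_sum homogeneous_formal_sum)
    (metis assms homogeneous_fderiv homogeneous_fourier homogeneous_times diff_add_cancel)

lemma fourier_vder: "fourier (vder N v R) m = vder_fser N v (fourier R m)"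
  unfolding vder_def by (rule fourier_Qfield) (rule homogeneous_vder_fser[OF homogeneous_fourier])

text \<open>\<open>fderiv i m\<close> lowers the weight by \<open>m\<close> and mode
  \<open>m\<close> of \<open>v i\<close> restores it, so setting z = 1 mixes no modes and the
  Leibniz rule passes from series to fields.\<close>

lemma total_vder: "total (vder N v R) = vder_fser N v (total R)"
proof (rule fser_eqI)
  fix \<mu>
  have "coeff (fderiv i m (fourier R (wt \<mu>)) * fourier (v i) m) \<mu>
      = coeff (fderiv i m (total R) * fourier (v i) m) \<mu>" for i m
    unfolding coeff_times
    by (rule sum.cong) (auto simp: coeff_fourier coeff_fderiv wt_def cf_def)
  then show "coeff (total (vder N v R)) \<mu> = coeff (vder_fser N v (total R)) \<mu>"
    by (simp add: total_def[of "vder N v R"] fourier_vder)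
       (simp add: vder_fser_def coeff_sum coeff_formal_sum)
qed

lemma vder_times: "vder N v (R * S) = vder N v R * S + R * vder N v S"
  by (rule total_inject) (simp add: total_vder total_times total_plus vder_fser_times)

lemma vder_add: "vder N v (R + S) = vder N v R + vder N v S"
  by (rule total_inject) (simp add: total_vder total_plus vder_fser_add)

lemma vder_0 [simp]: "vder N v 0 = 0"
  using vder_add[of N v 0 0] by simp

lemma vder_1 [simp]: "vder N v 1 = 0"
  using vder_times[of N v 1 1] by simp

lemma vder_uminus: "vder N v (- R) = - vder N v R"
  using vder_add[of N v R "- R"] by (simp add: minus_unique)

lemma vder_neg_one_power_times: "vder N v ((-1) ^ k * R) = (-1) ^ k * vder N v R"
  by (cases "even k") (auto simp: vder_uminus)

lemma vder_sum: "vder N v (sum f S) = (\<Sum>i\<in>S. vder N v (f i))"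
  by (induction S rule: infinite_finite_induct) (auto simp: vder_add)

lemma vder_qshift: "vder N v (qshift q j R) = qshift q j (vder N v R)"
  by (rule fourier_eqI) (simp add: fourier_vder qshift_eq_multiplier fourier_multiplier
      vder_fser_fconst_times)

lemma vder_tgen: "i \<le> N \<Longrightarrow> vder N v (tgen i) = (if i = 0 then 0 else v i)"
  by (cases "i = 0") (auto intro!: fourier_eqI simp: fourier_vder fourier_tgen vder_fser_coord)

lemma integral0_vder: "integral0 (vder N v R) = vder_fser N v (integral0 R)"
  by (simp add: integral0_def fourier_vder)

text \<open>The variational derivative of \<open>F\<close> with respect to t_i(z). The mode is
  negated because the integral of a product pairs the modes \<open>m\<close> and \<open>- m\<close>;
  for \<open>F\<close> of weight 0 this gives mode \<open>m\<close> the weight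
  \<open>m\<close>.\<close>

definition gradient :: "nat \<Rightarrow> fser \<Rightarrow> qfield" where
  "gradient i F = Qfield (\<lambda>m. fderiv i (- m) F)"

lemma fourier_gradient: "homogeneous 0 F \<Longrightarrow> fourier (gradient i F) m = fderiv i (- m) F"
  unfolding gradient_def
  by (rule fourier_Qfield) (use homogeneous_fderiv[of 0 F "- _" i] in simp)

lemma formal_sum_reflect: "formal_sum f = formal_sum (\<lambda>m::int. f (- m))"
  using formal_sum_bij[of uminus f] by (simp add: comp_def bij_uminus)

lemma vder_fser_gradient:
  assumes "homogeneous 0 F"
  shows "vder_fser N v F = integral0 (\<Sum>i=1..N. gradient i F * v i)"
  unfolding vder_fser_def integral0_sum
  by (intro sum.cong refl)
    (simp add: integral0_def fourier_times fourier_gradient[OF assms],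
     subst formal_sum_reflect, simp)

text \<open>Test fields concentrated in one component and one mode isolate each Fourier coefficient
  of the candidate \<open>Y i\<close>.\<close>

lemma gradient_eqI:
  assumes "homogeneous 0 F" "1 \<le> i" "i \<le> N"
    and "\<And>v. vder_fser N v F = integral0 (\<Sum>i=1..N. Y i * v i)"
  shows "gradient i F = Y i"
proof (rule fourier_eqI)
  fix m
  \<comment> \<open>A field admits in mode \<open>n\<close> only series of weight \<open>n\<close>,
    so the constant 1 is no test value off mode 0. A variable of weight \<open>- m\<close> takes its
    place and is cancelled at the end.\<close>
  define e where "e = Qfield (\<lambda>n. if n = - m then coord 0 n else 0)"
  have e: "fourier e n = (if n = - m then coord 0 n else 0)" for n
    unfolding e_def by (rule fourier_Qfield) (auto simp: homogeneous_coord)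
  define v where "v = (\<lambda>j. if j = i then e else 0)"
  have *: "integral0 (\<Sum>j=1..N. G j * v j) = fourier (G i) m * coord 0 (- m)" for G
  proof -
    have "(\<Sum>j=1..N. G j * v j) = (\<Sum>j\<in>{i}. G j * v j)"
      using assms(2,3) by (intro sum.mono_neutral_right) (auto simp: v_def)
    then have "integral0 (\<Sum>j=1..N. G j * v j) = formal_sum (\<lambda>n. fourier (G i) n * fourier e (- n))"
      by (simp add: v_def integral0_def fourier_times)
    also have "\<dots> = fourier (G i) m * fourier e (- m)"
      by (rule formal_sum_single) (simp add: e)
    finally show ?thesis by (simp add: e)
  qed
  have "fourier (gradient i F) m * coord 0 (- m) = fourier (Y i) m * coord 0 (- m)"
    using vder_fser_gradient[OF assms(1), of N v] assms(4)[of v] unfolding * by simp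
  then show "fourier (gradient i F) m = fourier (Y i) m"
    by (rule coord_times_cancel)
qed


section \<open>Pseudodifference operators\<close>

definition order_le :: "int \<Rightarrow> qop \<Rightarrow> bool" where
  "order_le M A \<longleftrightarrow> (\<forall>n>M. A n = 0)"

text \<open>Coefficients are unrestricted here: the algebra needs only bounded order, which keeps
  the sum in \<open>op_mult\<close> finite. Membership in \<open>Rring\<close> is established
  separately for the root.\<close>

definition qops :: "qop set" where
  "qops = {A. \<exists>M. order_le M A}"

lemma qopsI: "order_le M A \<Longrightarrow> A \<in> qops"
  by (auto simp: qops_def)

lemma qopsE:
  assumes "A \<in> qops"
  obtains M where "order_le M A"
  using assms by (auto simp: qops_def)

lemma order_le_op_one: "order_le 0 op_one"
  by (simp add: order_le_def op_one_def)

lemma op_one_qops [simp]: "op_one \<in> qops"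
  using order_le_op_one by (rule qopsI)

lemma qops_add [simp]: "A \<in> qops \<Longrightarrow> B \<in> qops \<Longrightarrow> (\<lambda>n. A n + B n) \<in> qops"
proof (elim qopsE)
  fix M M' assume "order_le M A" "order_le M' B"
  then show ?thesis by (intro qopsI[of "max M M'"]) (simp add: order_le_def)
qed

lemma qops_vder [simp]: "A \<in> qops \<Longrightarrow> (\<lambda>n. vder N v (A n)) \<in> qops"
  by (auto simp: qops_def order_le_def) (metis vder_0)

definition op_minus_part :: "qop \<Rightarrow> qop" where
  "op_minus_part A n = (if n < 0 then A n else 0)"

lemma op_plus_minus_part: "(\<lambda>n. op_plus_part A n + op_minus_part A n) = A"
  by (auto simp: op_plus_part_def op_minus_part_def)

lemma order_le_op_minus_part: "order_le (-1) (op_minus_part A)"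
  by (auto simp: order_le_def op_minus_part_def)

lemma op_minus_part_qops [simp]: "op_minus_part A \<in> qops"
  using order_le_op_minus_part by (rule qopsI)

lemma order_le_op_plus_part: "order_le M A \<Longrightarrow> order_le M (op_plus_part A)"
  by (auto simp: order_le_def op_plus_part_def)

lemma op_plus_part_qops [simp]: "A \<in> qops \<Longrightarrow> op_plus_part A \<in> qops"
  by (meson order_le_op_plus_part qopsE qopsI)

definition op_trace :: "qop \<Rightarrow> fser" where
  "op_trace A = integral0 (A 0)"

lemma op_trace_add: "op_trace (\<lambda>n. A n + B n) = op_trace A + op_trace B"
  by (simp add: op_trace_def integral0_add)

lemma op_trace_vder: "op_trace (\<lambda>n. vder N v (A n)) = vder_fser N v (op_trace A)"
  by (simp add: op_trace_def integral0_vder)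

text \<open>Inverses and roots are found coefficient by coefficient from the top order down.
  \<open>F f n\<close> uses only values of \<open>f\<close> above \<open>n\<close>, and the distance
  to \<open>M\<close> is the termination measure.\<close>

lemma downward_recursion:
  fixes F :: "(int \<Rightarrow> 'a) \<Rightarrow> int \<Rightarrow> 'a" and b :: "int \<Rightarrow> 'a"
  assumes F: "\<And>f g n. (\<And>k. k > n \<Longrightarrow> f k = g k) \<Longrightarrow> F f n = F g n"
  obtains f where "\<And>n. n > M \<Longrightarrow> f n = b n" "\<And>n. n \<le> M \<Longrightarrow> f n = F f n"
proof -
  define R where "R = {(k, n). n < k \<and> k \<le> M}"
  \<comment> \<open>\<open>R\<close> relates only indices up to \<open>M\<close>, so for the
    recursion to be admissible \<open>F\<close> must receive the values above \<open>M\<close> from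
    \<open>b\<close>.\<close>
  define G where "G = (\<lambda>f n. if n > M then b n else F (\<lambda>k. if k > M then b k else f k) n)"
  have G_eq: "G f n = (if n > M then b n else F (\<lambda>k. if k > M then b k else f k) n)" for f n
    by (simp add: G_def)
  have "R \<subseteq> measure (\<lambda>k. nat (M + 1 - k))"
    by (auto simp: R_def)
  then have "wf R"
    by (rule wf_subset[OF wf_measure])
  moreover have "adm_wf R G"
    unfolding adm_wf_def G_def R_def by (auto intro!: F)
  ultimately have unfold: "wfrec R G = G (wfrec R G)"
    by (rule wfrec_fixpoint)
  have 1: "wfrec R G n = b n" if "n > M" for n
    using that by (subst unfold) (simp add: G_eq)
  then have "(\<lambda>k. if k > M then b k else wfrec R G k) = wfrec R G"
    by auto
  moreover have "wfrec R G n = F (\<lambda>k. if k > M then b k else wfrec R G k) n" if "n \<le> M" for n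
    using fun_cong[OF unfold, of n] that by (simp add: G_eq)
  ultimately have "wfrec R G n = F (wfrec R G) n" if "n \<le> M" for n
    using that by metis
  with 1 show ?thesis by (rule that)
qed

section \<open>The algebra of pseudodifference operators: products, trace, powers, inverses\<close>

locale q_shift =
  fixes q :: complex
  assumes q_nonzero: "q \<noteq> 0"
begin

abbreviation D :: "int \<Rightarrow> qfield \<Rightarrow> qfield" where
  "D \<equiv> qshift q"

abbreviation op_star :: "qop \<Rightarrow> qop \<Rightarrow> qop" (infixl "\<star>" 70) where
  "A \<star> B \<equiv> op_mult q A B"

lemmas D_times = qshift_times[OF q_nonzero]
lemmas D_D [simp] = qshift_qshift[OF q_nonzero]

lemma op_mult_eq:
  assumes "order_le M A" "order_le M' B" "finite S" "{n - M'..M} \<subseteq> S"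
  shows "(A \<star> B) n = (\<Sum>a\<in>S. A a * D a (B (n - a)))"
  unfolding op_mult_def
proof (rule Sum_any.expand_superset[OF assms(3)])
  show "{a. A a * D a (B (n - a)) \<noteq> 0} \<subseteq> S"
  proof (rule subsetI, rule ccontr)
    fix a assume "a \<in> {a. A a * D a (B (n - a)) \<noteq> 0}" "a \<notin> S"
    moreover from this have "a \<notin> {n - M'..M}"
      using assms(4) by blast
    then have "a > M \<or> n - a > M'"
      by auto
    ultimately show False using assms(1,2) by (auto simp: order_le_def)
  qed
qed

lemma order_le_op_mult:
  assumes "order_le M A" "order_le M' B"
  shows "order_le (M + M') (A \<star> B)"
  unfolding order_le_def using op_mult_eq[OF assms, of "{}"] by simp

lemma op_mult_qops [simp]: "A \<in> qops \<Longrightarrow> B \<in> qops \<Longrightarrow> A \<star> B \<in> qops"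
  by (meson order_le_op_mult qopsE qopsI)

lemma op_mult_assoc:
  assumes "A \<in> qops" "B \<in> qops" "C \<in> qops"
  shows "A \<star> B \<star> C = A \<star> (B \<star> C)"
proof
  fix n
  obtain M1 M2 M3 where M: "order_le M1 A" "order_le M2 B" "order_le M3 C"
    using assms by (metis qopsE)
  have "(A \<star> B \<star> C) n
      = (\<Sum>a\<in>{n - M3..M1 + M2}. (\<Sum>b\<in>{a - M2..M1}. A b * D b (B (a - b))) * D a (C (n - a)))"
    by (subst op_mult_eq[OF order_le_op_mult[OF M(1,2)] M(3) _ subset_refl], simp)
       (simp add: op_mult_eq[OF M(1,2) _ subset_refl])
  also have "\<dots> = (\<Sum>(a, b)\<in>(SIGMA a:{n - M3..M1 + M2}. {a - M2..M1}).
      A b * D b (B (a - b)) * D a (C (n - a)))"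
    by (simp add: sum_distrib_right sum.Sigma)
  also have "\<dots> = (\<Sum>(b, c)\<in>(SIGMA b:{n - (M2 + M3)..M1}. {n - b - M3..M2}).
      A b * D b (B c * D c (C (n - b - c))))"
    by (rule sum.reindex_bij_witness[where j = "\<lambda>(a, b). (b, a - b)" and i = "\<lambda>(b, c). (b + c, b)"])
       (auto simp: D_times algebra_simps)
  also have "\<dots> = (\<Sum>b\<in>{n - (M2 + M3)..M1}.
      A b * D b (\<Sum>c\<in>{n - b - M3..M2}. B c * D c (C (n - b - c))))"
    by (simp add: sum.Sigma[symmetric] sum_distrib_left qshift_sum)
  also have "\<dots> = (A \<star> (B \<star> C)) n"
    by (subst op_mult_eq[OF M(1) order_le_op_mult[OF M(2,3)] _ subset_refl], simp)
       (simp add: op_mult_eq[OF M(2,3) _ subset_refl])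
  finally show "(A \<star> B \<star> C) n = (A \<star> (B \<star> C)) n" .
qed

lemma op_mult_add_right:
  assumes "A \<in> qops" "B \<in> qops" "C \<in> qops"
  shows "A \<star> (\<lambda>n. B n + C n) = (\<lambda>n. (A \<star> B) n + (A \<star> C) n)"
proof
  fix n
  obtain M1 M2 M3 M4 where M: "order_le M1 A" "order_le M2 B" "order_le M3 C"
      "order_le M4 (\<lambda>n. B n + C n)"
    using assms by (metis qopsE qops_add)
  let ?S = "{n - M2..M1} \<union> {n - M3..M1} \<union> {n - M4..M1}"
  have "(A \<star> (\<lambda>n. B n + C n)) n = (\<Sum>a\<in>?S. A a * D a (B (n - a) + C (n - a)))"
    by (rule op_mult_eq[OF M(1,4)]) auto
  moreover have "(A \<star> B) n = (\<Sum>a\<in>?S. A a * D a (B (n - a)))"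
    by (rule op_mult_eq[OF M(1,2)]) auto
  moreover have "(A \<star> C) n = (\<Sum>a\<in>?S. A a * D a (C (n - a)))"
    by (rule op_mult_eq[OF M(1,3)]) auto
  ultimately show "(A \<star> (\<lambda>n. B n + C n)) n = (A \<star> B) n + (A \<star> C) n"
    by (simp add: qshift_add distrib_left sum.distrib)
qed

lemma op_mult_add_left:
  assumes "A \<in> qops" "B \<in> qops" "C \<in> qops"
  shows "(\<lambda>n. B n + C n) \<star> A = (\<lambda>n. (B \<star> A) n + (C \<star> A) n)"
proof
  fix n
  obtain M1 M2 M3 M4 where M: "order_le M1 A" "order_le M2 B" "order_le M3 C"
      "order_le M4 (\<lambda>n. B n + C n)"
    using assms by (metis qopsE qops_add)
  let ?S = "{n - M1..M2} \<union> {n - M1..M3} \<union> {n - M1..M4}"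
  have "((\<lambda>n. B n + C n) \<star> A) n = (\<Sum>a\<in>?S. (B a + C a) * D a (A (n - a)))"
    by (rule op_mult_eq[OF M(4,1)]) auto
  moreover have "(B \<star> A) n = (\<Sum>a\<in>?S. B a * D a (A (n - a)))"
    by (rule op_mult_eq[OF M(2,1)]) auto
  moreover have "(C \<star> A) n = (\<Sum>a\<in>?S. C a * D a (A (n - a)))"
    by (rule op_mult_eq[OF M(3,1)]) auto
  ultimately show "((\<lambda>n. B n + C n) \<star> A) n = (B \<star> A) n + (C \<star> A) n"
    by (simp add: distrib_right sum.distrib)
qed

lemma op_mult_one_left [simp]: "op_one \<star> A = A"
proof
  fix n
  have "(op_one \<star> A) n = (\<Sum>a\<in>{0}. op_one a * D a (A (n - a)))"
    unfolding op_mult_def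
    by (rule Sum_any.expand_superset) (auto simp: op_one_def split: if_splits)
  then show "(op_one \<star> A) n = A n" by (simp add: op_one_def)
qed

lemma op_mult_one_right [simp]: "A \<star> op_one = A"
proof
  fix n
  have "(A \<star> op_one) n = (\<Sum>a\<in>{n}. A a * D a (op_one (n - a)))"
    unfolding op_mult_def
    by (rule Sum_any.expand_superset) (auto simp: op_one_def split: if_splits)
  then show "(A \<star> op_one) n = A n" by (simp add: op_one_def)
qed

text \<open>The terms \<open>A a * D a (B (- a))\<close> and \<open>B (- a) * D (- a) (A a)\<close>
  are shifts of each other, and the integral is invariant under shifts.\<close>

lemma op_trace_mult_commute:
  assumes "A \<in> qops" "B \<in> qops"
  shows "op_trace (A \<star> B) = op_trace (B \<star> A)"
proof -
  obtain M1 M2 where M: "order_le M1 A" "order_le M2 B"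
    using assms by (metis qopsE)
  have "(A \<star> B) 0 = (\<Sum>a\<in>{- M2..M1}. A a * D a (B (- a)))"
    by (subst op_mult_eq[OF M, of "{- M2..M1}"]) auto
  then have "op_trace (A \<star> B) = (\<Sum>a\<in>{- M2..M1}. integral0 (A a * D a (B (- a))))"
    by (simp add: op_trace_def integral0_sum)
  also have "\<dots> = (\<Sum>a\<in>{- M2..M1}. integral0 (B (- a) * D (- a) (A a)))"
  proof (rule sum.cong[OF refl])
    fix a
    have "B (- a) * D (- a) (A a) = D (- a) (A a * D a (B (- a)))"
      by (simp add: D_times mult.commute)
    then show "integral0 (A a * D a (B (- a))) = integral0 (B (- a) * D (- a) (A a))"
      by simp
  qed
  also have "\<dots> = (\<Sum>a\<in>{- M1..M2}. integral0 (B a * D a (A (- a))))"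
    by (rule sum.reindex_bij_witness[where i = uminus and j = uminus]) auto
  also have "\<dots> = op_trace (B \<star> A)"
    unfolding op_trace_def integral0_sum[symmetric]
    by (subst op_mult_eq[OF M(2,1), of "{- M1..M2}"]) auto
  finally show ?thesis .
qed

lemma vder_op_mult:
  assumes "A \<in> qops" "B \<in> qops"
  shows "(\<lambda>n. vder N v ((A \<star> B) n))
    = (\<lambda>n. ((\<lambda>n. vder N v (A n)) \<star> B) n + (A \<star> (\<lambda>n. vder N v (B n))) n)"
proof
  fix n
  obtain M1 M2 where M: "order_le M1 A" "order_le M2 B"
    using assms by (metis qopsE)
  then have M': "order_le M1 (\<lambda>n. vder N v (A n))" "order_le M2 (\<lambda>n. vder N v (B n))"
    by (auto simp: order_le_def)
  show "vder N v ((A \<star> B) n)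
      = ((\<lambda>n. vder N v (A n)) \<star> B) n + (A \<star> (\<lambda>n. vder N v (B n))) n"
    by (simp add: op_mult_eq[OF M _ subset_refl] op_mult_eq[OF M'(1) M(2) _ subset_refl]
        op_mult_eq[OF M(1) M'(2) _ subset_refl] vder_sum vder_times vder_qshift sum.distrib)
qed

abbreviation op_pow :: "qop \<Rightarrow> nat \<Rightarrow> qop" (infixr "\<up>" 80) where
  "A \<up> n \<equiv> op_power q A n"

lemma op_power_0 [simp]: "A \<up> 0 = op_one"
  and op_power_Suc: "A \<up> Suc n = A \<star> A \<up> n"
  by (simp_all add: op_power_def)

lemma op_power_qops [simp]: "A \<in> qops \<Longrightarrow> A \<up> n \<in> qops"
  by (induction n) (simp_all add: op_power_Suc)

lemma op_power_add: "A \<in> qops \<Longrightarrow> A \<up> (m + n) = A \<up> m \<star> A \<up> n"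
  by (induction m) (simp_all add: op_power_Suc op_mult_assoc)

lemma op_power_commute:
  assumes "A \<in> qops" "B \<in> qops" "A \<star> B = B \<star> A"
  shows "A \<up> n \<star> B = B \<star> A \<up> n"
proof (induction n)
  case (Suc n)
  have "A \<up> Suc n \<star> B = A \<star> (A \<up> n \<star> B)"
    using assms(1,2) by (simp add: op_power_Suc op_mult_assoc)
  also have "\<dots> = A \<star> B \<star> A \<up> n"
    using assms(1,2) by (simp add: Suc op_mult_assoc)
  also have "\<dots> = B \<star> A \<up> Suc n"
    using assms(1,2) by (simp add: assms(3) op_power_Suc op_mult_assoc)
  finally show ?case .
qed simp

text \<open>The Leibniz rule puts dP at each of the \<open>Suc n\<close> positions of the power;
  cyclicity and the commutation of \<open>B\<close> with \<open>P\<close> bring all these terms to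
  one form. \<open>B\<close> is general because the induction moves a factor \<open>P\<close> into
  it.\<close>

lemma trace_vder_op_power:
  assumes "P \<in> qops" "B \<in> qops" "B \<star> P = P \<star> B"
  shows "op_trace (B \<star> (\<lambda>k. vder N v ((P \<up> Suc n) k)))
    = of_nat (Suc n) * op_trace (B \<star> P \<up> n \<star> (\<lambda>k. vder N v (P k)))"
  using assms(2,3)
proof (induction n arbitrary: B)
  case 0
  then show ?case by (simp add: op_power_Suc)
next
  case (Suc n)
  let ?d = "\<lambda>A k. vder N v (A k)"
  note [simp] = assms(1) Suc.prems(1)
  have comm: "B \<star> P \<up> k = P \<up> k \<star> B" for k
    using op_power_commute[of P B k] Suc.prems by simp
  have BP: "B \<star> P \<star> P = P \<star> (B \<star> P)"
    using Suc.prems by (metis op_mult_assoc assms(1))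
  have "op_trace (B \<star> ?d (P \<up> Suc (Suc n)))
      = op_trace (B \<star> (?d P \<star> P \<up> Suc n)) + op_trace (B \<star> (P \<star> ?d (P \<up> Suc n)))"
    by (subst op_power_Suc)
       (simp add: vder_op_mult op_mult_add_right op_trace_add)
  moreover have "op_trace (B \<star> (?d P \<star> P \<up> Suc n)) = op_trace (B \<star> P \<up> Suc n \<star> ?d P)"
  proof -
    have "op_trace (B \<star> (?d P \<star> P \<up> Suc n)) = op_trace ((B \<star> ?d P) \<star> P \<up> Suc n)"
      by (simp add: op_mult_assoc)
    also have "\<dots> = op_trace (P \<up> Suc n \<star> (B \<star> ?d P))"
      by (rule op_trace_mult_commute) simp_all
    finally show ?thesis by (simp add: comm op_mult_assoc)
  qed
  moreover have "op_trace (B \<star> (P \<star> ?d (P \<up> Suc n)))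
      = of_nat (Suc n) * op_trace (B \<star> P \<up> Suc n \<star> ?d P)"
    using Suc.IH[of "B \<star> P", OF _ BP] by (simp add: op_mult_assoc op_power_Suc)
  ultimately show ?case by (simp add: algebra_simps)
qed

text \<open>At order \<open>n + d\<close> the product \<open>A \<star> B\<close> consists of
  \<open>D d (B n)\<close> and terms with \<open>B k\<close> for \<open>k > n\<close>, so
  \<open>B n\<close> can be solved for. That \<open>B\<close> is monic again is recorded in order to
  repeat the construction.\<close>

lemma monic_right_inverse:
  assumes "order_le d A" "A d = 1"
  obtains B where "order_le (- d) B" "B (- d) = 1" "A \<star> B = op_one"
proof -
  \<comment> \<open>Only entries above order \<open>n\<close> are kept, so the formula for
    \<open>B n\<close> refers to values already found.\<close>
  define trunc where "trunc = (\<lambda>(f :: qop) n k. if n < k \<and> k \<le> - d then f k else 0)"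
  define F where "F = (\<lambda>f n. D (- d) (op_one (n + d) - (A \<star> trunc f n) (n + d)))"
  have "F f n = F g n" if "\<And>k. k > n \<Longrightarrow> f k = g k" for f g n
  proof -
    have "trunc f n = trunc g n" using that by (auto simp: trunc_def)
    then show ?thesis by (simp add: F_def)
  qed
  then obtain B where B: "\<And>n. n > - d \<Longrightarrow> B n = 0" "\<And>n. n \<le> - d \<Longrightarrow> B n = F B n"
    using downward_recursion[of F "- d" "\<lambda>_. 0"] by metis
  have ord: "order_le (- d) B" "order_le (- d) (trunc B n)" for n
    using B(1) by (auto simp: order_le_def trunc_def)
  have AB: "A \<star> B = op_one"
  proof
    fix m
    show "(A \<star> B) m = op_one m"
    proof (cases "m > 0")
      case True
      then show ?thesis
        using order_le_op_mult[OF assms(1) ord(1)] by (simp add: order_le_def op_one_def)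
    next
      case False
      define n where "n = m - d"
      have n: "n \<le> - d" using False by (simp add: n_def)
      have eq: "{n + d + d..d} = insert d {n + d + d..<d}"
        using n by auto
      have "(A \<star> X) (n + d) = D d (X n) + (\<Sum>a\<in>{n + d + d..<d}. A a * D a (X (n + d - a)))"
        if "order_le (- d) X" for X
      proof -
        have "(A \<star> X) (n + d) = (\<Sum>a\<in>insert d {n + d + d..<d}. A a * D a (X (n + d - a)))"
          by (rule op_mult_eq[OF assms(1) that]) (auto simp flip: eq)
        then show ?thesis by (simp add: assms(2))
      qed
      moreover have "(\<Sum>a\<in>{n + d + d..<d}. A a * D a (B (n + d - a)))
          = (\<Sum>a\<in>{n + d + d..<d}. A a * D a (trunc B n (n + d - a)))"
        by (rule sum.cong) (auto simp: trunc_def)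
      moreover have "trunc B n n = 0"
        by (simp add: trunc_def)
      ultimately have "(A \<star> B) (n + d) = D d (B n) + (A \<star> trunc B n) (n + d)"
        using ord by simp
      also have "D d (B n) = op_one (n + d) - (A \<star> trunc B n) (n + d)"
        using B(2)[OF n] by (simp add: F_def)
      finally show ?thesis by (simp add: n_def)
    qed
  qed
  have "(A \<star> B) 0 = (\<Sum>a\<in>{d}. A a * D a (B (0 - a)))"
    by (rule op_mult_eq[OF assms(1) ord(1)]) auto
  then have "D d (B (- d)) = 1"
    by (simp add: AB op_one_def assms(2))
  then have "D (- d) (D d (B (- d))) = D (- d) 1" by simp
  then have "B (- d) = 1" by simp
  with ord AB show ?thesis by (intro that) auto
qed

text \<open>The right inverse \<open>B\<close> is monic and has a right inverse \<open>C\<close>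
  itself; associativity gives \<open>C = A\<close>.\<close>

lemma monic_inverse:
  assumes "order_le d A" "A d = 1"
  obtains B where "order_le (- d) B" "A \<star> B = op_one" "B \<star> A = op_one"
proof -
  obtain B where B: "order_le (- d) B" "B (- d) = 1" "A \<star> B = op_one"
    using monic_right_inverse[OF assms] .
  obtain C where C: "order_le (- (- d)) C" "B \<star> C = op_one"
    using monic_right_inverse[OF B(1,2)] .
  have "A = A \<star> (B \<star> C)" by (simp add: C(2))
  also have "\<dots> = A \<star> B \<star> C"
    using assms B C by (intro op_mult_assoc[symmetric]) (auto intro: qopsI)
  also have "\<dots> = C" by (simp add: B(3))
  finally show ?thesis using that B C by blast
qed

end


section \<open>The root of $L$ and the differentials of the Hamiltonians\<close>

text \<open>The grading with t_i of degree i, independent of the weight \<open>wt\<close> that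
  controls the modes. Bounds on it make the substitution for t_N a finite sum.\<close>

definition deg :: "mono \<Rightarrow> nat" where
  "deg \<mu> = (\<Sum>p\<in>#\<mu>. fst p)"

lemma deg_simps [simp]: "deg {#} = 0" "deg (\<alpha> + \<beta>) = deg \<alpha> + deg \<beta>" "deg (add_mset p \<mu>) = fst p + deg \<mu>"
  by (simp_all add: deg_def)

definition deg_le :: "int \<Rightarrow> qfield \<Rightarrow> bool" where
  "deg_le d R \<longleftrightarrow> (\<forall>\<mu>. cf R \<mu> \<noteq> 0 \<longrightarrow> int (deg \<mu>) \<le> d)"

lemma deg_le_0 [simp]: "deg_le d 0"
  by (simp add: deg_le_def)

lemma deg_le_1: "0 \<le> d \<Longrightarrow> deg_le d 1"
  by (auto simp: deg_le_def cf_1)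

lemma deg_le_diff: "deg_le d R \<Longrightarrow> deg_le d S \<Longrightarrow> deg_le d (R - S)"
  by (auto simp: deg_le_def) (metis diff_zero)

lemma deg_le_sum: "(\<And>i. i \<in> S \<Longrightarrow> deg_le d (f i)) \<Longrightarrow> deg_le d (sum f S)"
proof (induction S rule: infinite_finite_induct)
  case (insert i S)
  then show ?case by (auto simp: deg_le_def) (metis add_0)
qed auto

lemma deg_le_times: "deg_le d R \<Longrightarrow> deg_le e S \<Longrightarrow> deg_le (d + e) (R * S)"
  unfolding deg_le_def
proof (intro allI impI)
  fix \<mu>
  assume *: "\<forall>\<mu>. cf R \<mu> \<noteq> 0 \<longrightarrow> int (deg \<mu>) \<le> d" "\<forall>\<mu>. cf S \<mu> \<noteq> 0 \<longrightarrow> int (deg \<mu>) \<le> e"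
    "cf (R * S) \<mu> \<noteq> 0"
  then obtain \<alpha> \<beta> where "\<mu> = \<alpha> + \<beta>" "cf R \<alpha> \<noteq> 0" "cf S \<beta> \<noteq> 0"
    using coeff_times_nonzero[of "total R" "total S" \<mu>] by (auto simp: cf_def total_times)
  with * show "int (deg \<mu>) \<le> d + e" by fastforce
qed

lemma deg_le_qshift: "deg_le d R \<Longrightarrow> deg_le d (qshift q j R)"
  by (auto simp: deg_le_def)

lemma deg_le_neg_one_power_times: "deg_le d R \<Longrightarrow> deg_le d ((-1) ^ k * R)"
  by (auto simp: deg_le_def)

lemma deg_le_tgen: "deg_le (int i) (tgen i)"
proof (cases "i = 0")
  case False
  then show ?thesis
    by (auto simp: deg_le_def cf_tgen split: if_splits) (metis deg_simps(1,3) fst_conv add_0_right order_refl)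
qed (simp add: deg_le_1)

text \<open>With D counted as degree 1, this bounds the total degree: \<open>L\<close> has degree
  \<open>N\<close>, its root degree 1.\<close>

definition op_deg_le :: "int \<Rightarrow> qop \<Rightarrow> bool" where
  "op_deg_le e A \<longleftrightarrow> (\<forall>n. deg_le (e - n) (A n))"

lemma op_deg_le_one: "op_deg_le 0 op_one"
  by (auto simp: op_deg_le_def op_one_def deg_le_1)

context q_shift
begin

lemma op_deg_le_mult:
  assumes "A \<in> qops" "B \<in> qops" "op_deg_le d A" "op_deg_le e B"
  shows "op_deg_le (d + e) (A \<star> B)"
  unfolding op_deg_le_def
proof
  fix n
  obtain M1 M2 where M: "order_le M1 A" "order_le M2 B"
    using assms(1,2) by (metis qopsE)
  have "deg_le (d + e - n) (A a * D a (B (n - a)))" for a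
  proof -
    have "deg_le (d - a + (e - (n - a))) (A a * D a (B (n - a)))"
      using assms(3,4) by (intro deg_le_times deg_le_qshift) (auto simp: op_deg_le_def)
    then show ?thesis by (simp add: algebra_simps)
  qed
  then show "deg_le (d + e - n) ((A \<star> B) n)"
    by (simp add: op_mult_eq[OF M _ subset_refl] deg_le_sum)
qed

lemma op_deg_le_power:
  assumes "A \<in> qops" "op_deg_le 1 A"
  shows "op_deg_le (int n) (A \<up> n)"
proof (induction n)
  case (Suc n)
  then show ?case
    using op_deg_le_mult[of A "A \<up> n" 1 "int n"] assms by (simp add: op_power_Suc)
qed (simp add: op_deg_le_one)

text \<open>The operator 1 + D + ... + D^(k-1): the linear response of a \<open>k\<close>th power to
  a change of one coefficient.\<close>

definition qgeom :: "nat \<Rightarrow> qfield \<Rightarrow> qfield" where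
  "qgeom k R = (\<Sum>j<k. D (int j) R)"

lemma qgeom_Suc: "qgeom (Suc k) R = R + D 1 (qgeom k R)"
  unfolding qgeom_def by (subst sum.lessThan_Suc_shift) (simp add: qshift_sum add.commute)

lemma cf_qgeom: "cf (qgeom k R) \<mu> = (\<Sum>j<k. (q powi (- wt \<mu>)) ^ j) * cf R \<mu>"
proof -
  have "q powi (- (int j * w)) = (q powi (- w)) ^ j" for j w
    using power_int_mult[of q "- w" "int j"] by (simp add: mult.commute)
  then show ?thesis
    by (simp add: qgeom_def sum_distrib_right)
qed

lemma op_power_monic:
  assumes "order_le 1 P" "P 1 = 1"
  shows "order_le (int k) (P \<up> k)" "(P \<up> k) (int k) = 1"
proof -
  have *: "order_le (int k) (P \<up> k) \<and> (P \<up> k) (int k) = 1"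
  proof (induction k)
    case (Suc k)
    have "order_le (int (Suc k)) (P \<up> Suc k)"
      using order_le_op_mult[of 1 P "int k" "P \<up> k"] assms Suc by (simp add: op_power_Suc)
    moreover have "(P \<up> Suc k) (int (Suc k)) = (\<Sum>a\<in>{1}. P a * D a ((P \<up> k) (int (Suc k) - a)))"
      unfolding op_power_Suc by (rule op_mult_eq) (use assms Suc in auto)
    ultimately show ?case using assms(2) Suc by simp
  qed (auto simp: op_one_def order_le_def)
  then show "order_le (int k) (P \<up> k)" "(P \<up> k) (int k) = 1" by auto
qed

text \<open>Linearisation of the \<open>k\<close>th power at the first order where two operators
  differ: a change at order \<open>n\<close> first shows at \<open>n + k - 1\<close>, and there
  through \<open>qgeom k\<close>. Existence and uniqueness of the root both rest on it.\<close>

lemma op_power_agree: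
  assumes P: "order_le 1 P" "P 1 = 1" and Q: "order_le 1 Q" "Q 1 = 1"
    and n: "n \<le> 0" and PQ: "\<And>k. k > n \<Longrightarrow> P k = Q k"
  shows "(\<forall>m > n + int k - 1. (P \<up> k) m = (Q \<up> k) m)
    \<and> (P \<up> k) (n + int k - 1) = (Q \<up> k) (n + int k - 1) + qgeom k (P n - Q n)"
proof (induction k)
  case 0
  show ?case by (simp add: qgeom_def)
next
  case (Suc k)
  note ord = op_power_monic[OF P, of k] op_power_monic[OF Q, of k]
  have "(P \<up> Suc k) m = (Q \<up> Suc k) m" if m: "m > n + int k" for m
  proof -
    have "(P \<up> Suc k) m = (\<Sum>a\<in>{m - int k..1}. P a * D a ((P \<up> k) (m - a)))"
      unfolding op_power_Suc by (rule op_mult_eq[OF P(1) ord(1)]) auto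
    also have "\<dots> = (\<Sum>a\<in>{m - int k..1}. Q a * D a ((Q \<up> k) (m - a)))"
      using m Suc PQ by (intro sum.cong) auto
    also have "\<dots> = (Q \<up> Suc k) m"
      unfolding op_power_Suc by (rule op_mult_eq[OF Q(1) ord(3), symmetric]) auto
    finally show ?thesis .
  qed
  moreover have "(P \<up> Suc k) (n + int k) = (Q \<up> Suc k) (n + int k) + qgeom (Suc k) (P n - Q n)"
  proof -
    \<comment> \<open>Index \<open>n\<close> carries the change of the new factor, index 1 the
      shifted change of the old power, and the indices in \<open>?S\<close> meet only coefficients
      that agree. The hypothesis \<open>n \<le> 0\<close> keeps \<open>n\<close> and 1
      apart.\<close>
    let ?S = "{n + 1..0}"
    have S: "{n + int k - int k..1} = insert n (insert 1 ?S)" "n \<notin> insert 1 ?S" "1 \<notin> ?S"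
      using n by auto
    have split: "(X \<star> Y) (n + int k) = X n * D n (Y (int k)) + (X 1 * D 1 (Y (n + int k - 1))
        + (\<Sum>a\<in>?S. X a * D a (Y (n + int k - a))))"
      if "order_le 1 X" "order_le (int k) Y" for X Y
    proof -
      have "(X \<star> Y) (n + int k) = (\<Sum>a\<in>insert n (insert 1 ?S). X a * D a (Y (n + int k - a)))"
        by (rule op_mult_eq[OF that]) (simp, simp only: S(1) subset_refl)
      also have "\<dots> = X n * D n (Y (n + int k - n)) + (X 1 * D 1 (Y (n + int k - 1))
          + (\<Sum>a\<in>?S. X a * D a (Y (n + int k - a))))"
        using S(2,3) by (simp only: sum.insert finite_insert finite_atLeastAtMost_int not_False_eq_True)
      finally show ?thesis by simp
    qed
    have "(\<Sum>a\<in>?S. P a * D a ((P \<up> k) (n + int k - a))) = (\<Sum>a\<in>?S. Q a * D a ((Q \<up> k) (n + int k - a)))"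
      using Suc PQ by (intro sum.cong) auto
    then show ?thesis
      unfolding op_power_Suc qgeom_Suc
      using Suc by (simp add: split[OF P(1) ord(1)] split[OF Q(1) ord(3)] ord(2,4) P(2) Q(2) qshift_add)
  qed
  ultimately show ?case by (simp add: add_diff_eq)
qed

end

section \<open>Closure properties of the coefficient ring; the coefficients of
  \<open>L\<close>\<close>

lemma Rring_0: "0 \<in> Rring q N"
proof -
  have "(0::qfield) = const_field 0" by (rule cf_eqI) (simp add: cf_const_field)
  then show ?thesis by (metis Rring.const)
qed

lemma Rring_1: "1 \<in> Rring q N"
proof -
  have "(1::qfield) = const_field 1" by (rule cf_eqI) (simp add: cf_const_field cf_1)
  then show ?thesis by (metis Rring.const)
qed

lemma Rring_uminus: "R \<in> Rring q N \<Longrightarrow> - R \<in> Rring q N"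
proof -
  assume "R \<in> Rring q N"
  moreover have "- R = const_field (-1) * R" by (rule cf_eqI) simp
  ultimately show ?thesis by (simp add: Rring.const Rring.mult)
qed

lemma Rring_diff: "R \<in> Rring q N \<Longrightarrow> S \<in> Rring q N \<Longrightarrow> R - S \<in> Rring q N"
  using Rring.add[of R q N "- S"] by (simp add: Rring_uminus)

lemma Rring_sum: "(\<And>i. i \<in> S \<Longrightarrow> f i \<in> Rring q N) \<Longrightarrow> sum f S \<in> Rring q N"
  by (induction S rule: infinite_finite_induct) (auto intro: Rring_0 Rring.add)

lemma lax_L_at:
  assumes "i \<le> N"
  shows "lax_L N (int N - int i) = (-1) ^ i * tgen i"
proof -
  have "lax_L N (int N - int i) = (\<Sum>k=0..N. if i = k then (-1) ^ k * tgen k else 0)"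
    unfolding lax_L_def using assms by (intro sum.cong) (auto simp: of_nat_diff)
  then show ?thesis using assms by simp
qed

lemma lax_L_outside: "n < 0 \<or> n > int N \<Longrightarrow> lax_L N n = 0"
  unfolding lax_L_def by (intro sum.neutral) auto

lemma lax_L_cases:
  obtains i where "i \<le> N" "n = int N - int i" | "n < 0 \<or> n > int N" "lax_L N n = 0"
proof (cases "n < 0 \<or> n > int N")
  case False
  then show ?thesis by (intro that(1)[of "nat (int N - n)"]) auto
qed (use lax_L_outside that(2) in blast)

lemma order_le_lax_L: "order_le (int N) (lax_L N)"
  by (simp add: order_le_def lax_L_outside)

lemma lax_L_top: "lax_L N (int N) = 1"
  using lax_L_at[of 0 N] by simp

lemma lax_L_qops [simp]: "lax_L N \<in> qops"
  using order_le_lax_L by (rule qopsI)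

lemma op_deg_le_lax_L: "op_deg_le (int N) (lax_L N)"
  unfolding op_deg_le_def
proof
  fix n
  show "deg_le (int N - n) (lax_L N n)"
    by (cases rule: lax_L_cases[of N n])
       (auto simp: lax_L_at deg_le_tgen deg_le_neg_one_power_times)
qed

lemma lax_L_Rring: "lax_L N n \<in> Rring q N"
proof (cases rule: lax_L_cases[of N n])
  case (1 i)
  have "tgen i \<in> Rring q N"
    using Rring.gen[of i N q 0] 1 by (cases "i = 0") (auto simp: Rring_1)
  with 1 show ?thesis by (cases "even i") (auto simp: lax_L_at Rring_uminus)
qed (simp add: Rring_0)

section \<open>Existence, uniqueness and coefficients of the root for generic q\<close>

locale lax = q_shift +
  fixes N :: nat
  assumes q_generic: "k \<ge> 1 \<Longrightarrow> q ^ k \<noteq> 1" and N_ge: "N \<ge> 2"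
begin

lemma powi_ne_1: "w \<noteq> 0 \<Longrightarrow> q powi w \<noteq> 1"
proof -
  assume "w \<noteq> 0"
  then consider n where "n \<ge> 1" "w = int n" | n where "n \<ge> 1" "w = - int n"
    by (metis One_nat_def Suc_leI int_cases2 of_nat_0 neg_equal_0_iff_equal not_gr_zero)
  then show ?thesis
    by cases (simp_all add: power_int_minus q_generic)
qed

text \<open>The symbol of 1 + D + ... + D^(N-1) at weight \<open>w\<close>: it is \<open>N\<close>
  at weight 0 and otherwise (x^N - 1) / (x - 1) with x = q^(-w), where neither x nor x^N is 1. Hence
  that operator is bijective on all fields.\<close>

lemma geom_ne_0: "(\<Sum>j<N. (q powi (- w)) ^ j) \<noteq> 0"
proof (cases "w = 0")
  case True
  then show ?thesis using N_ge by simp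
next
  case False
  then have "q powi (- w) \<noteq> 1" "q powi (- w * int N) \<noteq> 1"
    using N_ge by (intro powi_ne_1; simp)+
  then show ?thesis
    by (simp add: geometric_sum power_int_mult del: mult_minus_left)
qed

lemma qgeom_inj: "qgeom N R = 0 \<Longrightarrow> R = 0"
  using geom_ne_0 by (intro cf_eqI) (metis cf_0 cf_qgeom mult_eq_0_iff)

lemma qgeom_surj: obtains S where "qgeom N S = R"
proof
  show "qgeom N (multiplier (\<lambda>w. inverse (\<Sum>j<N. (q powi (- w)) ^ j)) R) = R"
    using geom_ne_0 by (intro cf_eqI) (simp add: cf_qgeom)
qed

lemma deg_le_qgeomD: "deg_le d (qgeom N R) \<Longrightarrow> deg_le d R"
  using geom_ne_0 by (simp add: deg_le_def cf_qgeom)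

lemma Rring_op_power:
  assumes "order_le 1 A" "A 1 = 1" "\<And>n. A n \<in> Rring q N"
  shows "(A \<up> k) n \<in> Rring q N"
proof (induction k arbitrary: n)
  case 0
  then show ?case by (simp add: op_one_def Rring_0 Rring_1)
next
  case (Suc k)
  show ?case
    unfolding op_power_Suc op_mult_eq[OF assms(1) op_power_monic(1)[OF assms(1,2)] _ subset_refl, simplified]
    by (auto intro!: Rring_sum Rring.mult Rring.shift assms Suc)
qed

text \<open>The part of the root known before its coefficient at \<open>n\<close> is determined. The
  leading 1 is always included, so that \<open>op_power_agree\<close> applies.\<close>

definition root_trunc :: "qop \<Rightarrow> int \<Rightarrow> qop" where
  "root_trunc A n k = (if k = 1 then 1 else if n < k \<and> k \<le> 0 then A k else 0)"

lemma order_le_root_trunc: "order_le 1 (root_trunc A n)" "root_trunc A n 1 = 1"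
  by (auto simp: order_le_def root_trunc_def)

text \<open>By the linearisation, matching \<open>L\<close> at order \<open>n + N - 1\<close>
  amounts to one equation with \<open>qgeom N\<close> for \<open>P n\<close>. The equation is kept
  in the conclusion because ring membership and degrees are derived from it.\<close>

lemma root_exists:
  obtains P where "order_le 1 P" "P 1 = 1" "P \<up> N = lax_L N"
    "\<And>n. n \<le> 0 \<Longrightarrow> qgeom N (P n)
      = lax_L N (n + int N - 1) - (root_trunc P n \<up> N) (n + int N - 1)"
proof -
  define F where "F = (\<lambda>f n. SOME R. qgeom N R
    = lax_L N (n + int N - 1) - (root_trunc f n \<up> N) (n + int N - 1))"
  have "F f n = F g n" if "\<And>k. k > n \<Longrightarrow> f k = g k" for f g n
  proof -
    have "root_trunc f n = root_trunc g n" using that by (auto simp: root_trunc_def)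
    then show ?thesis by (simp add: F_def)
  qed
  then obtain P where P: "\<And>n. n > 0 \<Longrightarrow> P n = (if n = 1 then 1 else 0)" "\<And>n. n \<le> 0 \<Longrightarrow> P n = F P n"
    using downward_recursion[of F 0 "\<lambda>n. if n = 1 then 1 else 0"] by metis
  have ord: "order_le 1 P" "P 1 = 1"
    using P(1) by (auto simp: order_le_def)
  have eq: "qgeom N (P n) = lax_L N (n + int N - 1) - (root_trunc P n \<up> N) (n + int N - 1)"
    if "n \<le> 0" for n
    unfolding P(2)[OF that] unfolding F_def by (rule someI_ex) (metis qgeom_surj)
  have "P \<up> N = lax_L N"
  proof
    fix m
    show "(P \<up> N) m = lax_L N m"
    proof (cases "m < int N")
      case True
      define n where "n = m - int N + 1"
      have n: "n \<le> 0" "m = n + int N - 1" using True by (auto simp: n_def)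
      have "P k = root_trunc P n k" if "k > n" for k
        using that P(1) by (auto simp: root_trunc_def)
      with op_power_agree[OF ord order_le_root_trunc n(1), of P n N]
      have "(P \<up> N) m = (root_trunc P n \<up> N) m + qgeom N (P n - root_trunc P n n)"
        using n(2) by simp
      with eq[OF n(1)] n(1) show ?thesis
        by (simp add: n(2) root_trunc_def)
    next
      case False
      then consider "m = int N" | "m > int N" by linarith
      then show ?thesis
        using op_power_monic[OF ord, of N] by cases (auto simp: lax_L_top lax_L_outside order_le_def)
    qed
  qed
  then show ?thesis by (rule that[OF ord _ eq])
qed

text \<open>At the highest order where two roots could differ, equality of the powers makes
  \<open>qgeom N\<close> of the difference vanish.\<close>

lemma root_unique:
  assumes P: "order_le 1 P" "P 1 = 1" and Q: "order_le 1 Q" "Q 1 = 1" and eq: "P \<up> N = Q \<up> N"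
  shows "P = Q"
proof -
  have "P n = Q n" if "n \<ge> 1 - int k" for n k
    using that
  proof (induction k arbitrary: n)
    case 0
    then show ?case using assms by (cases "n = 1") (auto simp: order_le_def)
  next
    case (Suc k)
    show ?case
    proof (cases "n \<ge> 1 - int k")
      case True
      then show ?thesis by (rule Suc.IH)
    next
      case False
      then have "n \<le> 0" "\<And>m. m > n \<Longrightarrow> P m = Q m"
        using Suc by auto
      from op_power_agree[OF P Q this, of N] have "qgeom N (P n - Q n) = 0"
        by (simp add: eq)
      then show ?thesis using qgeom_inj by fastforce
    qed
  qed
  then have "P n = Q n" for n
    by (metis diff_le_eq nat_le_iff le_refl add.commute)
  then show ?thesis by auto
qed

text \<open>The right side of the recursion involves only higher coefficients, so it lies in
  \<open>Rring\<close>, and \<open>Rring.adjoin\<close> passes to \<open>P n\<close>. The degree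
  bound passes too, since \<open>qgeom N\<close> multiplies each monomial by a nonzero
  constant.\<close>

lemma root_coefficients:
  assumes P: "order_le 1 P" "P 1 = 1"
    and eq: "\<And>n. n \<le> 0 \<Longrightarrow> qgeom N (P n)
      = lax_L N (n + int N - 1) - (root_trunc P n \<up> N) (n + int N - 1)"
  shows "P n \<in> Rring q N \<and> deg_le (1 - n) (P n)"
proof -
  have "P n \<in> Rring q N \<and> deg_le (1 - n) (P n)" if "n \<ge> 1 - int k" for n k
    using that
  proof (induction k arbitrary: n)
    case 0
    then show ?case
      using P by (cases "n = 1") (auto simp: order_le_def Rring_0 Rring_1 deg_le_1)
  next
    case (Suc k)
    show ?case
    proof (cases "n \<ge> 1 - int k")
      case True
      then show ?thesis by (rule Suc.IH)
    next
      case False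
      then have n: "n \<le> 0" and IH: "\<And>m. m > n \<Longrightarrow> P m \<in> Rring q N \<and> deg_le (1 - m) (P m)"
        using Suc by auto
      let ?Q = "root_trunc P n"
      have "?Q m \<in> Rring q N" "deg_le (1 - m) (?Q m)" for m
        using IH[of m] by (auto simp: root_trunc_def Rring_0 Rring_1 deg_le_1)
      then have "(?Q \<up> N) m \<in> Rring q N" "deg_le (int N - m) ((?Q \<up> N) m)" for m
        using Rring_op_power[OF order_le_root_trunc] op_deg_le_power[of ?Q N]
          order_le_root_trunc(1)[of P n] by (auto simp: op_deg_le_def intro: qopsI)
      moreover have "deg_le (int N - m) (lax_L N m)" for m
        using op_deg_le_lax_L[of N] by (simp add: op_deg_le_def)
      ultimately have "qgeom N (P n) \<in> Rring q N" "deg_le (int N - (n + int N - 1)) (qgeom N (P n))"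
        unfolding eq[OF n] by (simp_all only: Rring_diff lax_L_Rring deg_le_diff)
      then show ?thesis
        by (auto simp: qgeom_def intro: Rring.adjoin dest!: deg_le_qgeomD[unfolded qgeom_def])
    qed
  qed
  from this[of "nat (1 - n)" n] show ?thesis by simp
qed

abbreviation L :: qop where "L \<equiv> lax_L N"
abbreviation P :: qop where "P \<equiv> lax_root q N"

lemma lax_root: "order_le 1 P" "P 1 = 1" "P \<up> N = L" "op_deg_le 1 P"
proof -
  obtain R where R: "order_le 1 R" "R 1 = 1" "R \<up> N = L" "\<And>n. n \<le> 0 \<Longrightarrow> qgeom N (R n)
      = lax_L N (n + int N - 1) - (root_trunc R n \<up> N) (n + int N - 1)"
    by (rule root_exists) (rule that)
  have c: "R n \<in> Rring q N" "deg_le (1 - n) (R n)" for n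
    using root_coefficients[OF R(1,2,4)] by auto
  have "P = R"
    unfolding lax_root_def
  proof (rule the_equality)
    show "R \<in> Pring q N \<and> R 1 = 1 \<and> (\<forall>n>1. R n = 0) \<and> R \<up> N = L"
      using R c by (auto simp: Pring_def order_le_def)
  next
    fix S assume "S \<in> Pring q N \<and> S 1 = 1 \<and> (\<forall>n>1. S n = 0) \<and> S \<up> N = L"
    then show "S = R"
      by (auto simp: order_le_def R(3) intro: root_unique[of S R, OF _ _ R(1,2)])
  qed
  with R c show "order_le 1 P" "P 1 = 1" "P \<up> N = L" "op_deg_le 1 P"
    by (auto simp: op_deg_le_def)
qed

lemma P_qops [simp]: "P \<in> qops"
  using lax_root(1) by (rule qopsI)

section \<open>The inverse of \<open>L\<close> and the variational derivatives of the
  Hamiltonians\<close>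

definition lax_inverse :: qop where
  "lax_inverse = (SOME B. order_le (- int N) B \<and> L \<star> B = op_one \<and> B \<star> L = op_one)"

lemma lax_inverse: "L \<star> lax_inverse = op_one" "lax_inverse \<star> L = op_one"
    "lax_inverse \<in> qops"
proof -
  have "\<exists>B. order_le (- int N) B \<and> L \<star> B = op_one \<and> B \<star> L = op_one"
    using monic_inverse[OF order_le_lax_L lax_L_top] by metis
  from someI_ex[OF this] show "L \<star> lax_inverse = op_one" "lax_inverse \<star> L = op_one"
    "lax_inverse \<in> qops" unfolding lax_inverse_def by (auto intro: qopsI)
qed

text \<open>\<open>Z n\<close> is the operator with $dH_n = \int \operatorname{Res}(Z\, dL)$.\<close>

definition Z :: "nat \<Rightarrow> qop" where
  "Z n = P \<up> n \<star> lax_inverse"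

lemma Z_qops [simp]: "Z n \<in> qops"
  by (simp add: Z_def lax_inverse)

lemma P_L_commute: "P \<star> L = L \<star> P"
  using op_power_commute[of P P N] by (simp add: lax_root)

lemma P_power_L_commute: "P \<up> n \<star> L = L \<star> P \<up> n"
  by (rule op_power_commute) (simp_all add: P_L_commute)

lemma Z_L: "Z n \<star> L = P \<up> n"
  by (simp add: Z_def op_mult_assoc lax_inverse)

lemma L_Z: "L \<star> Z n = P \<up> n"
proof -
  have "L \<star> Z n = (L \<star> P \<up> n) \<star> lax_inverse"
    by (simp add: Z_def op_mult_assoc lax_inverse)
  also have "\<dots> = P \<up> n \<star> (L \<star> lax_inverse)"
    unfolding P_power_L_commute[symmetric] by (simp add: op_mult_assoc lax_inverse(3))
  finally show ?thesis by (simp add: lax_inverse)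
qed

lemma Z_add_N: "Z (n + N) = P \<up> n"
  by (simp add: Z_def op_power_add lax_root op_mult_assoc lax_inverse)

lemma P_Z_commute: "Z n \<star> P = P \<star> Z n"
proof -
  let ?K = lax_inverse
  have "?K \<star> P = ?K \<star> P \<star> (L \<star> ?K)"
    by (simp add: lax_inverse)
  also have "\<dots> = ?K \<star> (P \<star> L) \<star> ?K"
    by (simp only: op_mult_assoc lax_inverse(3) P_qops lax_L_qops op_mult_qops)
  also have "\<dots> = (?K \<star> L) \<star> P \<star> ?K"
    unfolding P_L_commute by (simp add: lax_inverse(3) op_mult_assoc)
  also have "\<dots> = P \<star> ?K"
    by (simp add: lax_inverse)
  finally have K: "?K \<star> P = P \<star> ?K" .
  have "Z n \<star> P = P \<up> n \<star> P \<star> ?K"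
    by (simp add: Z_def op_mult_assoc lax_inverse(3) K)
  also have "P \<up> n \<star> P = P \<star> P \<up> n"
    by (rule op_power_commute) simp_all
  also have "P \<star> P \<up> n \<star> ?K = P \<star> Z n"
    by (simp add: Z_def op_mult_assoc lax_inverse(3))
  finally show ?thesis .
qed

lemma of_nat_fser: "of_nat n = fconst (of_nat n)"
  by (induction n) (auto intro!: fser_eqI simp: coeff_fconst coeff_one)

lemma fconst_mult: "fconst a * fconst b = fconst (a * b)"
  by (rule fser_eqI) (simp, simp add: coeff_fconst)

lemma hamiltonian_eq: "hamiltonian q N n = fconst (of_nat N / of_nat n) * op_trace (P \<up> n)"
  by (simp add: hamiltonian_def op_Res_def lax_frac_power_def op_trace_def)

lemma homogeneous_hamiltonian: "homogeneous 0 (hamiltonian q N n)"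
  unfolding hamiltonian_def integral0_def
  by (rule homogeneous_fconst_times[OF homogeneous_fourier])

lemma vder_hamiltonian:
  assumes "n \<ge> 1"
  shows "vder_fser N v (hamiltonian q N n) = op_trace (Z n \<star> (\<lambda>k. vder N v (L k)))"
proof -
  let ?T = "op_trace (P \<up> (n - 1) \<star> (\<lambda>k. vder N v (P k)))"
  have n: "Suc (n - 1) = n" and N: "Suc (N - 1) = N"
    using assms N_ge by auto
  have "vder_fser N v (op_trace (P \<up> n)) = of_nat n * ?T"
    using trace_vder_op_power[of P op_one N v "n - 1", unfolded n] by (simp add: op_trace_vder)
  then have "vder_fser N v (hamiltonian q N n) = of_nat N * ?T"
    using assms by (simp add: hamiltonian_eq vder_fser_fconst_times of_nat_fser
        mult.assoc[symmetric] fconst_mult)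
  moreover have "op_trace (Z n \<star> (\<lambda>k. vder N v (L k)))
      = of_nat N * op_trace (Z n \<star> P \<up> (N - 1) \<star> (\<lambda>k. vder N v (P k)))"
    using trace_vder_op_power[of P "Z n" N v "N - 1", unfolded N lax_root] by (simp add: P_Z_commute)
  moreover have "Z n \<star> P \<up> (N - 1) = P \<up> (n - 1)"
  proof -
    have "Z n \<star> P \<up> (N - 1) = P \<up> (N - 1) \<star> Z n"
      by (rule op_power_commute[symmetric]) (simp_all add: P_Z_commute)
    also have "\<dots> = P \<up> (N - 1 + n) \<star> lax_inverse"
      by (simp add: Z_def op_power_add op_mult_assoc lax_inverse)
    also have "N - 1 + n = n - 1 + N" using assms N_ge by simp
    finally show ?thesis by (simp add: Z_add_N flip: Z_def)
  qed
  ultimately show ?thesis by simp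
qed

lemma vder_L_at: "i \<le> N \<Longrightarrow> vder N v (L (int N - int i)) = (if i = 0 then 0 else (-1) ^ i * v i)"
  by (simp add: lax_L_at vder_neg_one_power_times vder_tgen)

lemma reindex_to_N: "(\<Sum>a\<in>{0..int N}. f a) = (\<Sum>i\<le>N. f (int N - int i))"
  by (rule sum.reindex_bij_witness[where j = "\<lambda>a. nat (int N - a)" and i = "\<lambda>i. int N - int i"]) auto

text \<open>Cyclicity moves dL to the left, where its coefficients stand unshifted. The term with
  \<open>i = 0\<close> drops because the leading coefficient of \<open>L\<close> is
  constant.\<close>

lemma trace_Z_vder_L:
  assumes "W \<in> qops"
  shows "op_trace (W \<star> (\<lambda>k. vder N v (L k)))
    = integral0 (\<Sum>i=1..N. ((-1) ^ i * D (int N - int i) (W (int i - int N))) * v i)"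
proof -
  let ?dL = "\<lambda>k. vder N v (L k)"
  obtain M where M: "order_le M W" using assms by (rule qopsE)
  have dL: "order_le (int N) ?dL"
    by (auto simp: order_le_def lax_L_outside)
  have dLq: "?dL \<in> qops" by simp
  have "(?dL \<star> W) 0 = (\<Sum>a\<in>{min 0 (- M)..int N}. ?dL a * D a (W (0 - a)))"
    by (rule op_mult_eq[OF dL M]) auto
  also have "\<dots> = (\<Sum>a\<in>{0..int N}. ?dL a * D a (W (0 - a)))"
    by (rule sum.mono_neutral_right) (auto simp: lax_L_outside)
  also have "\<dots> = (\<Sum>i\<le>N. ?dL (int N - int i) * D (int N - int i) (W (int i - int N)))"
    by (simp add: reindex_to_N)
  also have "\<dots> = (\<Sum>i=1..N. ?dL (int N - int i) * D (int N - int i) (W (int i - int N)))"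
    by (rule sum.mono_neutral_right) (auto simp: vder_L_at[of 0, simplified] lax_L_top Suc_le_eq)
  also have "\<dots> = (\<Sum>i=1..N. ((-1) ^ i * D (int N - int i) (W (int i - int N))) * v i)"
    by (rule sum.cong) (auto simp: vder_L_at)
  finally show ?thesis
    using op_trace_mult_commute[OF assms dLq] by (simp add: op_trace_def)
qed

lemma gradient_hamiltonian:
  assumes "n \<ge> 1" "1 \<le> i" "i \<le> N"
  shows "gradient i (hamiltonian q N n) = (-1) ^ i * D (int N - int i) (Z n (int i - int N))"
  by (rule gradient_eqI[OF homogeneous_hamiltonian assms(2,3)])
     (simp add: vder_hamiltonian[OF assms(1)] trace_Z_vder_L)

end


section \<open>Contraction of the brackets with a differential\<close>

text \<open>\<open>\<beta> m n\<close> is meant as the coefficient of z^(-m) w^(-n) of a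
  distribution in two variables. Contraction with a derivative of weight \<open>- n\<close> then
  leaves weight \<open>m\<close>, as required of mode \<open>m\<close> of a field.\<close>

definition bihomogeneous :: "(int \<Rightarrow> int \<Rightarrow> fser) \<Rightarrow> bool" where
  "bihomogeneous \<beta> \<longleftrightarrow> (\<forall>m n. homogeneous (m + n) (\<beta> m n))"

text \<open>\<open>contract j G \<beta>\<close> is $\oint_w \beta(z, w)\, \delta G / \delta t_j(w)$.\<close>

definition contract :: "nat \<Rightarrow> fser \<Rightarrow> (int \<Rightarrow> int \<Rightarrow> fser) \<Rightarrow> qfield" where
  "contract j G \<beta> = Qfield (\<lambda>m. formal_sum (\<lambda>n. fderiv j n G * \<beta> m n))"

lemma fourier_contract:
  assumes "homogeneous 0 G" "bihomogeneous \<beta>"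
  shows "fourier (contract j G \<beta>) m = formal_sum (\<lambda>n. fderiv j n G * \<beta> m n)"
  unfolding contract_def
proof (rule fourier_Qfield, rule homogeneous_formal_sum)
  fix m n
  have "homogeneous (0 - n + (m + n)) (fderiv j n G * \<beta> m n)"
    using assms by (intro homogeneous_times homogeneous_fderiv) (auto simp: bihomogeneous_def)
  then show "homogeneous m (fderiv j n G * \<beta> m n)" by simp
qed

lemma locally_finite_contract:
  assumes "homogeneous 0 G"
  shows "locally_finite (\<lambda>n. fderiv j n G * \<beta> m n)"
  using locally_finite_homogeneous1[of uminus "\<lambda>n. fderiv j n G" "\<beta> m"]
    homogeneous_fderiv[OF assms, of _ j]
  by (simp add: mult.commute)

lemma bihomogeneous_add: "bihomogeneous \<beta> \<Longrightarrow> bihomogeneous \<gamma> \<Longrightarrow> bihomogeneous (\<lambda>m n. \<beta> m n + \<gamma> m n)"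
  and bihomogeneous_diff: "bihomogeneous \<beta> \<Longrightarrow> bihomogeneous \<gamma> \<Longrightarrow> bihomogeneous (\<lambda>m n. \<beta> m n - \<gamma> m n)"
  and bihomogeneous_uminus: "bihomogeneous \<beta> \<Longrightarrow> bihomogeneous (\<lambda>m n. - \<beta> m n)"
  and bihomogeneous_sum: "(\<And>r. r \<in> S \<Longrightarrow> bihomogeneous (\<delta> r)) \<Longrightarrow> bihomogeneous (\<lambda>m n. \<Sum>r\<in>S. \<delta> r m n)"
  and bihomogeneous_0: "bihomogeneous (\<lambda>m n. 0)"
  by (auto simp: bihomogeneous_def
      intro: homogeneous_add homogeneous_diff homogeneous_uminus homogeneous_sum)

lemma bihomogeneous_flip: "bihomogeneous \<beta> \<Longrightarrow> bihomogeneous (\<lambda>m n. \<beta> n m)"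
  unfolding bihomogeneous_def by (metis add.commute)

context
  fixes G :: fser and j :: nat
  assumes G: "homogeneous 0 G"
begin

lemma contract_add:
  assumes "bihomogeneous \<beta>" "bihomogeneous \<gamma>"
  shows "contract j G (\<lambda>m n. \<beta> m n + \<gamma> m n) = contract j G \<beta> + contract j G \<gamma>"
  by (rule fourier_eqI) (simp add: fourier_contract G assms bihomogeneous_add fourier_add
      distrib_left formal_sum_add locally_finite_contract)

lemma contract_uminus:
  assumes "bihomogeneous \<beta>"
  shows "contract j G (\<lambda>m n. - \<beta> m n) = - contract j G \<beta>"
proof (rule fourier_eqI)
  fix m
  have "formal_sum (\<lambda>n. - 1 * (fderiv j n G * \<beta> m n)) = - 1 * formal_sum (\<lambda>n. fderiv j n G * \<beta> m n)"
    by (rule formal_sum_times) (rule locally_finite_contract[OF G])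
  then show "fourier (contract j G (\<lambda>m n. - \<beta> m n)) m = fourier (- contract j G \<beta>) m"
    by (simp add: fourier_contract G assms bihomogeneous_uminus fourier_uminus)
qed

lemma contract_diff:
  assumes "bihomogeneous \<beta>" "bihomogeneous \<gamma>"
  shows "contract j G (\<lambda>m n. \<beta> m n - \<gamma> m n) = contract j G \<beta> - contract j G \<gamma>"
  using contract_add[OF assms(1) bihomogeneous_uminus[OF assms(2)]] contract_uminus[OF assms(2)]
  by simp

lemma contract_0: "contract j G (\<lambda>m n. 0) = 0"
  by (rule fourier_eqI) (simp add: fourier_contract G bihomogeneous_0)

lemma contract_sum:
  assumes "\<And>r. r \<in> S \<Longrightarrow> bihomogeneous (\<delta> r)"
  shows "contract j G (\<lambda>m n. \<Sum>r\<in>S. \<delta> r m n) = (\<Sum>r\<in>S. contract j G (\<delta> r))"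
  by (rule fourier_eqI) (simp add: fourier_contract G assms bihomogeneous_sum fourier_sum
      sum_distrib_left formal_sum_sum locally_finite_contract)

end

section \<open>Contraction of a kernel is a Fourier multiplier\<close>

lemma bihomogeneous_kernel: "bihomogeneous (kernel c R S)"
  unfolding bihomogeneous_def kernel_def
proof (intro allI homogeneous_formal_sum homogeneous_fconst_times)
  fix m n k
  have "homogeneous (m - k + (n + k)) (fourier R (m - k) * fourier S (n + k))"
    by (intro homogeneous_times homogeneous_fourier)
  then show "homogeneous (m + n) (fourier R (m - k) * fourier S (n + k))" by simp
qed

lemma locally_finite_kernel: "locally_finite (\<lambda>k. fconst (c k) * (fourier R (m - k) * fourier S (n + k)))"
proof -
  have "locally_finite (\<lambda>k. (fconst (c k) * fourier R (m - k)) * fourier S (n + k))"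
    by (rule locally_finite_homogeneous1[where w = "\<lambda>k. n + k"])
       (auto simp: homogeneous_fourier inj_def)
  then show ?thesis by (simp add: mult.assoc)
qed

lemma formal_sum_reindex: "bij \<pi> \<Longrightarrow> formal_sum (\<lambda>i. f (\<pi> i)) = formal_sum f"
  using formal_sum_bij[of \<pi> f] by (simp add: comp_def)

lemma bij_int_affine: "bij (\<lambda>n::int. n + a)" "bij (\<lambda>n::int. a - n)"
  by (rule bij_betw_byWitness[where f' = "\<lambda>n. n - a"], auto)
     (rule bij_betw_byWitness[where f' = "\<lambda>n. a - n"], auto)

text \<open>With X the gradient, integrating (w/z)^k S(w) X(w) over w picks out mode
  \<open>k\<close> of \<open>S * X\<close>. So the kernel coefficients act as a multiplier on that
  product, while \<open>R\<close> stays outside.\<close>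

lemma contract_kernel:
  assumes G: "homogeneous 0 G"
  shows "contract j G (kernel c R S) = R * multiplier c (S * gradient j G)"
proof (rule fourier_eqI)
  fix m
  define X where "X = gradient j G"
  have X: "fderiv j n G = fourier X (- n)" for n
    using fourier_gradient[OF G, of j "- n"] by (simp add: X_def)
  define f where "f = (\<lambda>(n, k). fourier X (- n) * (fconst (c k) * (fourier R (m - k) * fourier S (n + k))))"
  have "locally_finite (\<lambda>p. fourier X (- fst p) * fourier R (m - snd p)
      * (fconst (c (snd p)) * fourier S (fst p + snd p)))"
    by (rule locally_finite_homogeneous2[where w = "\<lambda>p. (- fst p, m - snd p)"])
       (auto simp: inj_def homogeneous_fourier)
  then have lf: "locally_finite f"
    by (simp add: f_def case_prod_unfold mult_ac)
  have "fourier (contract j G (kernel c R S)) m = formal_sum (\<lambda>n. formal_sum (\<lambda>k. f (n, k)))"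
    by (simp add: fourier_contract[OF G bihomogeneous_kernel] kernel_def X f_def
        formal_sum_times locally_finite_kernel)
  also have "\<dots> = formal_sum (\<lambda>k. formal_sum (\<lambda>n. f (n, k)))"
    using formal_sum_pairs[OF lf] by simp
  also have "\<dots> = formal_sum (\<lambda>k. fourier R (m - k) * fourier (multiplier c (S * X)) k)"
  proof (rule arg_cong[where f = formal_sum], rule ext)
    fix k
    have lfk: "locally_finite (\<lambda>n. fourier S (n + k) * fourier X (- n))"
      by (rule locally_finite_homogeneous1[where w = uminus]) (auto simp: homogeneous_fourier)
    have "formal_sum (\<lambda>n. fourier S (n + k) * fourier X (- n)) = fourier (S * X) k"
      using formal_sum_reindex[OF bij_int_affine(1)[of k], of "\<lambda>n. fourier S n * fourier X (k - n)"]
      by (simp add: fourier_times)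
    then have "fourier R (m - k) * fourier (multiplier c (S * X)) k
        = formal_sum (\<lambda>n. (fconst (c k) * fourier R (m - k)) * (fourier S (n + k) * fourier X (- n)))"
      unfolding formal_sum_times[OF lfk] by (simp add: fourier_multiplier mult_ac)
    then show "formal_sum (\<lambda>n. f (n, k)) = fourier R (m - k) * fourier (multiplier c (S * X)) k"
      by (simp add: f_def mult_ac)
  qed
  also have "\<dots> = fourier (R * multiplier c (S * X)) m"
    using formal_sum_reindex[OF bij_int_affine(2)[of m],
        of "\<lambda>k. fourier R k * fourier (multiplier c (S * X)) (m - k)"]
    by (simp add: fourier_times)
  finally show "fourier (contract j G (kernel c R S)) m = fourier (R * multiplier c (S * gradient j G)) m"
    by (simp add: X_def)
qed

text \<open>Exchanging z and w turns (w/z)^k into (w/z)^(-k).\<close>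

lemma contract_kernel_flip:
  assumes G: "homogeneous 0 G"
  shows "contract j G (\<lambda>m n. kernel c R S n m) = S * multiplier (\<lambda>k. c (- k)) (R * gradient j G)"
proof -
  have "kernel c R S n m = kernel (\<lambda>k. c (- k)) S R m n" for m n
    unfolding kernel_def
    by (subst formal_sum_reindex[OF bij_uminus, symmetric]) (simp add: mult_ac)
  then show ?thesis using contract_kernel[OF G] by simp
qed

text \<open>Component \<open>i\<close> of the hamiltonian vector field of \<open>G\<close>, that is,
  the bracket of t_i(z) with \<open>G\<close>.\<close>

definition bracket_field :: "nat \<Rightarrow> gen_bracket \<Rightarrow> fser \<Rightarrow> nat \<Rightarrow> qfield" where
  "bracket_field N b G i = (\<Sum>j=1..N. contract j G (b i j))"

lemma vder_fser_sum_fields: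
  "vder_fser N (\<lambda>i. \<Sum>j\<in>J. V i j) F = (\<Sum>i=1..N. \<Sum>j\<in>J. formal_sum (\<lambda>m. fderiv i m F * fourier (V i j) m))"
  unfolding vder_fser_def
  by (simp add: fourier_sum sum_distrib_left formal_sum_sum locally_finite_vder)

text \<open>Summing over the modes of \<open>G\<close> first leaves the derivation of
  \<open>F\<close> along the hamiltonian field. The weights of the two derivatives make the double
  sum locally finite.\<close>

lemma pbracket_eq_vder:
  assumes b: "\<And>i j. i \<le> N \<Longrightarrow> j \<le> N \<Longrightarrow> bihomogeneous (b i j)"
    and F: "homogeneous w F" and G: "homogeneous 0 G"
  shows "pbracket N b F G = vder_fser N (bracket_field N b G) F"
proof -
  have "formal_sum (\<lambda>(m, n). fderiv i m F * fderiv j n G * b i j m n)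
      = formal_sum (\<lambda>m. fderiv i m F * fourier (contract j G (b i j)) m)"
    if "i \<le> N" "j \<le> N" for i j
  proof -
    have "locally_finite (\<lambda>p. fderiv i (fst p) F * fderiv j (snd p) G * b i j (fst p) (snd p))"
      by (rule locally_finite_homogeneous2[where w = "\<lambda>p. (w - fst p, 0 - snd p)"])
         (auto simp: inj_def homogeneous_fderiv[OF F] intro: homogeneous_fderiv[OF G, of _ j, simplified])
    then have "formal_sum (\<lambda>p. fderiv i (fst p) F * fderiv j (snd p) G * b i j (fst p) (snd p))
        = formal_sum (\<lambda>m. formal_sum (\<lambda>n. fderiv i m F * (fderiv j n G * b i j m n)))"
      by (subst formal_sum_pairs(1)) (simp_all add: mult.assoc)
    also have "\<dots> = formal_sum (\<lambda>m. fderiv i m F * fourier (contract j G (b i j)) m)"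
      using that by (simp add: formal_sum_times locally_finite_contract[OF G] fourier_contract[OF G b])
    finally show ?thesis by (simp add: case_prod_unfold)
  qed
  then show ?thesis
    unfolding pbracket_def bracket_field_def vder_fser_sum_fields
    by (auto intro!: sum.cong)
qed

lemma field_bracket_eq:
  assumes "\<And>i j. i \<le> N \<Longrightarrow> j \<le> N \<Longrightarrow> bihomogeneous (b i j)" "homogeneous 0 G" "1 \<le> k" "k \<le> N"
  shows "field_bracket N b k G = bracket_field N b G k"
proof -
  have "pbracket N b (coord k m) G = fourier (bracket_field N b G k) m" for m
    by (subst pbracket_eq_vder[OF assms(1) homogeneous_coord assms(2)])
       (use assms(3,4) in \<open>auto simp: vder_fser_coord\<close>)
  then show ?thesis
    by (simp add: field_bracket_def fourier_inverse)
qed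

lemma L_bracket_eq:
  assumes "\<And>i j. i \<le> N \<Longrightarrow> j \<le> N \<Longrightarrow> bihomogeneous (b i j)" "homogeneous 0 G"
    and "\<And>i. 1 \<le> i \<Longrightarrow> i \<le> N \<Longrightarrow> (-1) ^ i * bracket_field N b G i = C (int N - int i)"
    and "\<And>n. n < 0 \<or> n \<ge> int N \<Longrightarrow> C n = 0"
  shows "L_bracket N b G = C"
proof
  fix n
  have "L_bracket N b G n = (\<Sum>k=1..N. if n = int N - int k then C (int N - int k) else 0)"
    unfolding L_bracket_def
    by (rule sum.cong) (use assms in \<open>auto simp: field_bracket_eq of_nat_diff\<close>)
  also have "\<dots> = C n"
  proof (cases "n < 0 \<or> n \<ge> int N")
    case True
    then show ?thesis using assms(4) by (auto intro!: sum.neutral)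
  next
    case False
    then have "(\<Sum>k=1..N. if n = int N - int k then C (int N - int k) else 0)
        = (\<Sum>k\<in>{nat (int N - n)}. if n = int N - int k then C (int N - int k) else 0)"
      by (intro sum.mono_neutral_right) auto
    then show ?thesis using False by simp
  qed
  finally show "L_bracket N b G n = C n" .
qed

section \<open>Explicit contractions of the two brackets\<close>

lemma bihomogeneous_bracket1: "bihomogeneous (bracket1_with q N u i j)"
proof (cases "i \<noteq> N \<and> j \<noteq> N \<and> i + j \<ge> N")
  case False
  then have "bracket1_with q N u i j = (\<lambda>m n. 0)"
    by (auto simp: bracket1_with_def fun_eq_iff)
  then show ?thesis by (simp add: bihomogeneous_0)
next
  case True
  then show ?thesis
    unfolding bracket1_with_def[abs_def] by (simp add: bihomogeneous_diff bihomogeneous_kernel)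
qed

lemma bihomogeneous_bracket2_le: "bihomogeneous (bracket2_le q N i j)"
  unfolding bracket2_le_def
  by (intro bihomogeneous_diff bihomogeneous_add bihomogeneous_sum bihomogeneous_kernel)

lemma bihomogeneous_bracket2: "bihomogeneous (bracket2 q N i j)"
  unfolding bracket2_def
  by (cases "i \<le> j")
     (simp_all add: bihomogeneous_bracket2_le bihomogeneous_uminus bihomogeneous_flip)

text \<open>The coefficient of (w/z)^k in delta(q^r w/z) is q^(rk), whereas D^j multiplies mode k by
  q^(-jk): hence the opposite signs.\<close>

lemma multiplier_delta: "multiplier (delta_coef (q ^ r)) = qshift q (- int r)"
  "multiplier (delta_coef (1 / q ^ r)) = qshift q (int r)"
  "multiplier (\<lambda>k. delta_coef (q ^ r) (- k)) = qshift q (int r)"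
  "multiplier (\<lambda>k. delta_coef (1 / q ^ r) (- k)) = qshift q (- int r)"
proof -
  have 1: "delta_coef (q ^ r) k = q powi (int r * k)" for k
    using power_int_mult[of q "int r" k] by (simp add: delta_coef_def)
  have 2: "delta_coef (1 / q ^ r) k = q powi (- (int r * k))" for k
    using power_int_mult[of q "- int r" k]
    by (simp add: delta_coef_def power_int_minus divide_inverse power_int_inverse)
  show "multiplier (delta_coef (q ^ r)) = qshift q (- int r)"
    "multiplier (delta_coef (1 / q ^ r)) = qshift q (int r)"
    "multiplier (\<lambda>k. delta_coef (q ^ r) (- k)) = qshift q (int r)"
    "multiplier (\<lambda>k. delta_coef (1 / q ^ r) (- k)) = qshift q (- int r)"
    unfolding qshift_eq_multiplier by (rule arg_cong[where f = multiplier]; simp add: fun_eq_iff 1 2)+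
qed

lemma contract_bracket1:
  assumes "homogeneous 0 G"
  shows "contract j G (bracket1_with q N u i j) =
    (if i \<noteq> N \<and> j \<noteq> N \<and> i + j \<ge> N
     then u * qshift q (- int (N - j)) (tgen (i + j - N) * gradient j G)
        - tgen (i + j - N) * qshift q (int (N - i)) (u * gradient j G)
     else 0)"
proof (cases "i \<noteq> N \<and> j \<noteq> N \<and> i + j \<ge> N")
  case True
  then show ?thesis
    unfolding bracket1_with_def
    by (simp add: contract_diff[OF assms] bihomogeneous_kernel contract_kernel[OF assms] multiplier_delta)
next
  case False
  then have "bracket1_with q N u i j = (\<lambda>m n. 0)"
    by (auto simp: bracket1_with_def fun_eq_iff)
  then have "contract j G (bracket1_with q N u i j) = 0"
    by (simp add: contract_0[OF assms])
  with False show ?thesis by (simp only: if_False)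
qed

definition kappa :: "complex \<Rightarrow> nat \<Rightarrow> nat \<Rightarrow> nat \<Rightarrow> int \<Rightarrow> complex" where
  "kappa q N i j k = (if k = 0 then 0
     else (1 - q powi (int i * k)) * (1 - q powi (k * int (N - j))) / (1 - q powi (k * int N)))"

lemma contract_bracket2_le:
  assumes "homogeneous 0 G" "i \<le> j"
  shows "contract j G (bracket2 q N i j) =
      tgen i * multiplier (kappa q N i j) (tgen j * gradient j G)
    + (\<Sum>r=1..min i (N - j). tgen (j + r) * qshift q (- int r) (tgen (i - r) * gradient j G))
    - (\<Sum>r=1..min i (N - j). tgen (i - r) * qshift q (int (j - i + r)) (tgen (j + r) * gradient j G))"
proof -
  have "bracket2 q N i j = (\<lambda>m n. kernel (kappa q N i j) (tgen i) (tgen j) m n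
     + (\<Sum>r=1..min i (N - j). kernel (delta_coef (q ^ r)) (tgen (j + r)) (tgen (i - r)) m n)
     - (\<Sum>r=1..min i (N - j). kernel (delta_coef (1 / q ^ (j - i + r))) (tgen (i - r)) (tgen (j + r)) m n))"
    using assms(2) by (simp add: fun_eq_iff bracket2_def bracket2_le_def kappa_def[abs_def])
  then show ?thesis
    by (simp only: contract_diff[OF assms(1)] contract_add[OF assms(1)] contract_sum[OF assms(1)]
        bihomogeneous_add bihomogeneous_sum bihomogeneous_kernel contract_kernel[OF assms(1)]
        multiplier_delta)
qed

lemma contract_bracket2_gt:
  assumes "homogeneous 0 G" "j < i"
  shows "contract j G (bracket2 q N i j) =
    - (tgen i * multiplier (\<lambda>k. kappa q N j i (- k)) (tgen j * gradient j G)
      + (\<Sum>r=1..min j (N - i). tgen (j - r) * qshift q (int r) (tgen (i + r) * gradient j G))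
      - (\<Sum>r=1..min j (N - i). tgen (i + r) * qshift q (- int (i - j + r)) (tgen (j - r) * gradient j G)))"
proof -
  have flip: "bihomogeneous (\<lambda>m n. kernel c R S n m)" for c R S
    by (rule bihomogeneous_flip) (rule bihomogeneous_kernel)
  have "bracket2 q N i j = (\<lambda>m n. - (kernel (kappa q N j i) (tgen j) (tgen i) n m
     + (\<Sum>r=1..min j (N - i). kernel (delta_coef (q ^ r)) (tgen (i + r)) (tgen (j - r)) n m)
     - (\<Sum>r=1..min j (N - i). kernel (delta_coef (1 / q ^ (i - j + r))) (tgen (j - r)) (tgen (i + r)) n m)))"
    using assms(2) by (simp add: fun_eq_iff bracket2_def bracket2_le_def kappa_def[abs_def])
  then show ?thesis
    by (simp only: contract_uminus[OF assms(1)] contract_diff[OF assms(1)] contract_add[OF assms(1)] contract_sum[OF assms(1)]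
        bihomogeneous_add bihomogeneous_diff bihomogeneous_sum flip contract_kernel_flip[OF assms(1)]
        multiplier_delta)
qed


section \<open>The commutator $[L, A_+]$\<close>

context q_shift
begin

text \<open>Lets the order be parametrised by the index of a coefficient of \<open>L\<close> or of a
  component of the other factor.\<close>

lemma op_mult_reindex:
  assumes "finite S" "inj_on h S" "\<And>a. a \<notin> h ` S \<Longrightarrow> A a = 0 \<or> B (n - a) = 0"
  shows "(A \<star> B) n = (\<Sum>c\<in>S. A (h c) * D (h c) (B (n - h c)))"
proof -
  have "(A \<star> B) n = (\<Sum>a\<in>h ` S. A a * D a (B (n - a)))"
    unfolding op_mult_def
    by (rule Sum_any.expand_superset) (use assms in force)+
  then show ?thesis by (simp add: sum.reindex[OF assms(2)])
qed

lemma op_mult_nonneg: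
  assumes "\<And>n. n < 0 \<Longrightarrow> A n = 0" "\<And>n. n < 0 \<Longrightarrow> B n = 0" "n < 0"
  shows "(A \<star> B) n = 0"
proof -
  have "(A \<star> B) n = (\<Sum>c\<in>{}. A c * D c (B (n - c)))"
    by (rule op_mult_reindex[where h = "\<lambda>c. c"]) (use assms in auto, smt (verit))
  then show ?thesis by simp
qed

end

context lax
begin

text \<open>Integer indices, with value 0 outside 0 to \<open>N\<close>, spare case distinctions
  when indices are shifted.\<close>

definition s :: "int \<Rightarrow> qfield" where
  "s x = L (int N - x)"

lemma s_nat: "i \<le> N \<Longrightarrow> s (int i) = (-1) ^ i * tgen i"
  by (simp add: s_def lax_L_at)

lemma s_outside: "x < 0 \<or> x > int N \<Longrightarrow> s x = 0"
  by (auto simp: s_def lax_L_outside)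

lemma s_0 [simp]: "s 0 = 1"
  by (simp add: s_def lax_L_top)

lemma L_eq_s: "L n = s (int N - n)"
  by (simp add: s_def)

text \<open>\<open>W\<close> $= \sum_j D^{j-N}\,$\<open>left_coeff W j\<close>.\<close>

definition left_coeff :: "qop \<Rightarrow> int \<Rightarrow> qfield" where
  "left_coeff W j = D (int N - j) (W (j - int N))"

text \<open>\<open>L \<star> ?p\<close> has no negative powers, so A_+ is L W_+ + (L W_-)_+, and
  likewise W_+ L + (W_- L)_+. Using the second form in L A_+ and the first in A_+ L, the terms L W_+
  L cancel.\<close>

lemma op_comm_plus_part:
  assumes "W \<in> qops" "A = L \<star> W" "A = W \<star> L"
  shows "op_comm q L (op_plus_part A) n
    = (L \<star> op_plus_part (op_minus_part W \<star> L)) n - (op_plus_part (L \<star> op_minus_part W) \<star> L) n"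
proof -
  let ?p = "op_plus_part W" and ?m = "op_minus_part W"
  note [simp] = assms(1)
  have "A = (\<lambda>n. (L \<star> ?p) n + (L \<star> ?m) n)"
    by (simp add: assms(2) op_mult_add_right[symmetric] op_plus_minus_part)
  then have 1: "op_plus_part A = (\<lambda>n. (L \<star> ?p) n + op_plus_part (L \<star> ?m) n)"
    by (auto simp: op_plus_part_def op_mult_nonneg lax_L_outside)
  have "A = (\<lambda>n. (?p \<star> L) n + (?m \<star> L) n)"
    by (simp add: assms(3) op_mult_add_left[symmetric] op_plus_minus_part)
  then have 2: "op_plus_part A = (\<lambda>n. (?p \<star> L) n + op_plus_part (?m \<star> L) n)"
    by (auto simp: op_plus_part_def op_mult_nonneg lax_L_outside)
  have "L \<star> op_plus_part A = (\<lambda>n. (L \<star> (?p \<star> L)) n + (L \<star> op_plus_part (?m \<star> L)) n)"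
    unfolding 2 by (rule op_mult_add_right) simp_all
  moreover have "op_plus_part A \<star> L = (\<lambda>n. (L \<star> ?p \<star> L) n + (op_plus_part (L \<star> ?m) \<star> L) n)"
    unfolding 1 by (rule op_mult_add_left) simp_all
  ultimately show ?thesis
    by (simp add: op_comm_def op_mult_assoc)
qed

lemma op_comm_plus_minus:
  assumes "W \<in> qops" "L \<star> W = W \<star> L"
  shows "op_comm q L (op_plus_part W) n = - op_comm q L (op_minus_part W) n"
proof -
  let ?p = "op_plus_part W" and ?m = "op_minus_part W"
  have "L \<star> W = (\<lambda>n. (L \<star> ?p) n + (L \<star> ?m) n)" "W \<star> L = (\<lambda>n. (?p \<star> L) n + (?m \<star> L) n)"
    using assms(1)
    by (simp_all add: op_mult_add_right[symmetric] op_mult_add_left[symmetric] op_plus_minus_part)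
  then have "(L \<star> ?p) n + (L \<star> ?m) n = (?p \<star> L) n + (?m \<star> L) n"
    using assms(2) by metis
  then show ?thesis by (simp add: op_comm_def algebra_simps)
qed

definition Phi :: "int \<Rightarrow> int \<Rightarrow> qfield \<Rightarrow> int \<Rightarrow> qfield" where
  "Phi k j y c = s (k + c) * D (j - c - k) (s (j - c) * y)"

text \<open>The contribution of component \<open>j\<close> of \<open>W\<close> to order
  \<open>N - k\<close> of the commutator: the terms at \<open>c\<close> come from L (W_- L)_+, those
  at \<open>j - k - c\<close> from (L W_-)_+ L.\<close>

definition GD :: "int \<Rightarrow> int \<Rightarrow> qfield \<Rightarrow> qfield" where
  "GD k j y = (\<Sum>c\<in>{0..int N}. Phi k j y c - Phi k j y (j - k - c))"

lemma op_comm_eq_GD: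
  assumes W: "W \<in> qops" "A = L \<star> W" "A = W \<star> L" and k: "1 \<le> k" "k \<le> int N"
  shows "op_comm q L (op_plus_part A) (int N - k) = (\<Sum>j\<in>{0..<int N}. GD k j (left_coeff W j))"
proof -
  let ?Y = "left_coeff W" and ?U = "op_plus_part (op_minus_part W \<star> L)"
    and ?V = "op_plus_part (L \<star> op_minus_part W)"
  \<comment> \<open>Terms of W_- of order below -N keep negative order after multiplication by
    \<open>L\<close>, so only the components 0 to N - 1 enter.\<close>
  have U: "?U c = (\<Sum>j\<in>{0..<int N}. D (j - int N) (?Y j) * D (j - int N) (s (j - c)))" if "c \<ge> 0" for c
  proof -
    have "(op_minus_part W \<star> L) c
        = (\<Sum>j\<in>{0..<int N}. op_minus_part W (j - int N) * D (j - int N) (L (c - (j - int N))))"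
    proof (rule op_mult_reindex)
      fix a assume a: "a \<notin> (\<lambda>j. j - int N) ` {0..<int N}"
      have "a + int N \<notin> {0..<int N}"
        using a imageI[of "a + int N" "{0..<int N}" "\<lambda>j. j - int N"] by auto
      then have "a \<ge> 0 \<or> a < - int N" by auto
      then show "op_minus_part W a = 0 \<or> L (c - a) = 0"
        using that by (auto simp: op_minus_part_def lax_L_outside)
    qed (auto simp: inj_on_def)
    also have "\<dots> = (\<Sum>j\<in>{0..<int N}. D (j - int N) (?Y j) * D (j - int N) (s (j - c)))"
      by (rule sum.cong) (auto simp: op_minus_part_def left_coeff_def L_eq_s algebra_simps)
    finally show ?thesis using that by (simp add: op_plus_part_def)
  qed
  have V: "?V c = (\<Sum>j\<in>{0..<int N}. s (j - c) * D c (?Y j))" if "c \<ge> 0" for c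
  proof -
    have "(L \<star> op_minus_part W) c
        = (\<Sum>j\<in>{0..<int N}. L (c + int N - j) * D (c + int N - j) (op_minus_part W (c - (c + int N - j))))"
    proof (rule op_mult_reindex)
      fix a assume a: "a \<notin> (\<lambda>j. c + int N - j) ` {0..<int N}"
      have "c + int N - a \<notin> {0..<int N}"
        using a imageI[of "c + int N - a" "{0..<int N}" "\<lambda>j. c + int N - j"] by auto
      then have "c + int N - a < 0 \<or> c - a \<ge> 0" by auto
      then show "L a = 0 \<or> op_minus_part W (c - a) = 0"
        using that by (auto simp: op_minus_part_def lax_L_outside)
    qed (auto simp: inj_on_def)
    also have "\<dots> = (\<Sum>j\<in>{0..<int N}. s (j - c) * D c (?Y j))"
      by (rule sum.cong) (auto simp: op_minus_part_def left_coeff_def L_eq_s algebra_simps)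
    finally show ?thesis using that by (simp add: op_plus_part_def)
  qed
  have V0: "?V c = 0" if "c \<notin> {0..int N}" for c
    using order_le_op_mult[OF order_le_lax_L[of N] order_le_op_minus_part[of W]] that
    by (auto simp: order_le_def op_plus_part_def)
  have "(L \<star> ?U) (int N - k)
      = (\<Sum>c\<in>{0..int N}. L (int N - k - c) * D (int N - k - c) (?U (int N - k - (int N - k - c))))"
  proof (rule op_mult_reindex)
    fix a assume a: "a \<notin> (\<lambda>c. int N - k - c) ` {0..int N}"
    have "int N - k - a \<notin> {0..int N}"
      using a imageI[of "int N - k - a" "{0..int N}" "\<lambda>c. int N - k - c"] by auto
    then have "int N - k - a < 0 \<or> a < 0" using k by auto
    then show "L a = 0 \<or> ?U (int N - k - a) = 0"
      by (auto simp: op_plus_part_def lax_L_outside)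
  qed (auto simp: inj_on_def)
  also have "\<dots> = (\<Sum>c\<in>{0..int N}. \<Sum>j\<in>{0..<int N}. Phi k j (?Y j) c)"
    by (rule sum.cong)
       (auto simp: U Phi_def L_eq_s qshift_sum D_times sum_distrib_left algebra_simps intro!: sum.cong)
  finally have 1: "(L \<star> ?U) (int N - k) = (\<Sum>c\<in>{0..int N}. \<Sum>j\<in>{0..<int N}. Phi k j (?Y j) c)" .
  have "(?V \<star> L) (int N - k) = (\<Sum>c\<in>{0..int N}. ?V c * D c (L (int N - k - c)))"
    by (rule op_mult_reindex[where h = "\<lambda>c. c"]) (simp_all only: image_ident V0 simp_thms, simp_all)
  also have "\<dots> = (\<Sum>c\<in>{0..int N}. \<Sum>j\<in>{0..<int N}. Phi k j (?Y j) (j - k - c))"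
    by (rule sum.cong)
       (auto simp: V Phi_def L_eq_s D_times sum_distrib_left algebra_simps intro!: sum.cong)
  finally have 2: "(?V \<star> L) (int N - k) = (\<Sum>c\<in>{0..int N}. \<Sum>j\<in>{0..<int N}. Phi k j (?Y j) (j - k - c))" .
  show ?thesis
    unfolding op_comm_plus_part[OF W] 1 2 GD_def
    by (subst (1 2) sum.swap) (simp add: sum_subtractf)
qed

text \<open>Negative orders are absent from [L, W_+], and orders from \<open>N\<close> on are absent
  from -[L, W_-], which is the same operator.\<close>

lemma op_comm_plus_part_outside:
  assumes W: "W \<in> qops" "L \<star> W = W \<star> L" and n: "n < 0 \<or> n \<ge> int N"
  shows "op_comm q L (op_plus_part W) n = 0"
proof (cases "n < 0")
  case True
  then show ?thesis
    by (simp add: op_comm_def op_mult_nonneg lax_L_outside op_plus_part_def)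
next
  case False
  have "op_comm q L (op_plus_part W) n = - op_comm q L (op_minus_part W) n"
    by (rule op_comm_plus_minus[OF W])
  moreover have "(L \<star> op_minus_part W) n = 0" "(op_minus_part W \<star> L) n = 0"
    using order_le_op_mult[OF order_le_lax_L[of N] order_le_op_minus_part[of W]]
      order_le_op_mult[OF order_le_op_minus_part[of W] order_le_lax_L[of N]] n False
    by (auto simp: order_le_def)
  ultimately show ?thesis by (simp add: op_comm_def)
qed

lemma op_comm_plus_part_0: "op_comm q L (op_plus_part W) 0 = 0"
proof -
  have "(L \<star> op_plus_part W) 0 = (\<Sum>c\<in>{0}. L c * D c (op_plus_part W (0 - c)))"
    by (rule op_mult_reindex[where h = "\<lambda>c. c"]) (auto simp: op_plus_part_def lax_L_outside)
  moreover have "(op_plus_part W \<star> L) 0 = (\<Sum>c\<in>{0}. op_plus_part W c * D c (L (0 - c)))"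
    by (rule op_mult_reindex[where h = "\<lambda>c. c"]) (auto simp: op_plus_part_def lax_L_outside)
  ultimately show ?thesis by (simp add: op_comm_def mult.commute)
qed

text \<open>In the form -[L, W_-], only the components 0 to N - 1 of \<open>W\<close> reach these
  orders, each paired with a single coefficient of \<open>L\<close>; this is why the result is
  linear in \<open>s\<close>.\<close>

lemma op_comm_eq_linear:
  assumes W: "W \<in> qops" "L \<star> W = W \<star> L" and k: "1 \<le> k" "k \<le> int N"
  shows "op_comm q L (op_plus_part W) (int N - k)
    = (\<Sum>j\<in>{0..<int N}. D (j - int N) (s (k + j - int N) * left_coeff W j)
        - s (k + j - int N) * D (int N - k) (left_coeff W j))"
proof -
  let ?Y = "left_coeff W" and ?m = "op_minus_part W"
  have "(?m \<star> L) (int N - k)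
      = (\<Sum>j\<in>{0..<int N}. ?m (j - int N) * D (j - int N) (L (int N - k - (j - int N))))"
  proof (rule op_mult_reindex)
    fix a assume a: "a \<notin> (\<lambda>j. j - int N) ` {0..<int N}"
    have "a + int N \<notin> {0..<int N}"
      using a imageI[of "a + int N" "{0..<int N}" "\<lambda>j. j - int N"] by auto
    then have "a \<ge> 0 \<or> a < - int N" by auto
    then show "?m a = 0 \<or> L (int N - k - a) = 0"
      using k by (auto simp: op_minus_part_def lax_L_outside)
  qed (auto simp: inj_on_def)
  also have "\<dots> = (\<Sum>j\<in>{0..<int N}. D (j - int N) (s (k + j - int N) * ?Y j))"
    by (rule sum.cong) (auto simp: op_minus_part_def left_coeff_def L_eq_s D_times algebra_simps)
  finally have 1: "(?m \<star> L) (int N - k) = (\<Sum>j\<in>{0..<int N}. D (j - int N) (s (k + j - int N) * ?Y j))" .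
  have "(L \<star> ?m) (int N - k) = (\<Sum>j\<in>{0..<int N}. L (2 * int N - k - j)
      * D (2 * int N - k - j) (?m (int N - k - (2 * int N - k - j))))"
  proof (rule op_mult_reindex)
    fix a assume a: "a \<notin> (\<lambda>j. 2 * int N - k - j) ` {0..<int N}"
    have "2 * int N - k - a \<notin> {0..<int N}"
      using a imageI[of "2 * int N - k - a" "{0..<int N}" "\<lambda>j. 2 * int N - k - j"] by auto
    then have "2 * int N - k - a < 0 \<or> int N - k - a \<ge> 0" by auto
    then show "L a = 0 \<or> ?m (int N - k - a) = 0"
      using k by (auto simp: op_minus_part_def lax_L_outside)
  qed (auto simp: inj_on_def)
  also have "\<dots> = (\<Sum>j\<in>{0..<int N}. s (k + j - int N) * D (int N - k) (?Y j))"
    by (rule sum.cong) (auto simp: op_minus_part_def left_coeff_def L_eq_s algebra_simps)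
  finally have 2: "(L \<star> ?m) (int N - k) = (\<Sum>j\<in>{0..<int N}. s (k + j - int N) * D (int N - k) (?Y j))" .
  show ?thesis
    unfolding op_comm_plus_minus[OF W] by (simp add: op_comm_def 1 2 sum_subtractf)
qed

section \<open>Truncating the quadratic sums to the ranges of the delta terms\<close>

lemma Phi_outside: "k + c < 0 \<or> k + c > int N \<or> j - c < 0 \<or> j - c > int N \<Longrightarrow> Phi k j y c = 0"
  by (auto simp: Phi_def s_outside)

text \<open>For \<open>0 \<le> c \<le> j - k\<close> the reflection from \<open>c\<close> to
  \<open>j - k - c\<close> cancels the two families. What remains is \<open>c = j - k + r\<close>
  with coefficients of indices \<open>j + r\<close> and \<open>k - r\<close>, both within 0 to
  \<open>N\<close> exactly when \<open>r \<le> min k (N - j)\<close>: the range of the delta terms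
  in the bracket.\<close>

lemma GD_le:
  assumes "k \<le> j" "j \<le> N"
  shows "GD (int k) (int j) y = (\<Sum>r=1..min k (N - j).
    Phi (int k) (int j) y (int j - int k + int r) - Phi (int k) (int j) y (- int r))"
proof -
  let ?F = "Phi (int k) (int j) y"
  have "(\<Sum>c\<in>{0..int j - int k}. ?F (int j - int k - c)) = (\<Sum>c\<in>{0..int j - int k}. ?F c)"
    by (rule sum.reindex_bij_witness[where i = "\<lambda>c. int j - int k - c" and j = "\<lambda>c. int j - int k - c"]) auto
  then have 1: "(\<Sum>c\<in>{0..int j - int k}. ?F c - ?F (int j - int k - c)) = 0"
    by (simp add: sum_subtractf)
  have "{0..int N} = {0..int j - int k} \<union> {int j - int k + 1..int N}"
    using assms by auto
  then have "GD (int k) (int j) y = (\<Sum>c\<in>{0..int j - int k} \<union> {int j - int k + 1..int N}.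
      ?F c - ?F (int j - int k - c))"
    by (simp only: GD_def)
  also have "\<dots> = (\<Sum>c\<in>{int j - int k + 1..int N}. ?F c - ?F (int j - int k - c))"
    by (subst sum.union_disjoint) (simp_all only: 1, auto)
  finally have "GD (int k) (int j) y
      = (\<Sum>c\<in>{int j - int k + 1..int N}. ?F c - ?F (int j - int k - c))" .
  also have "\<dots> = (\<Sum>c\<in>(\<lambda>r. int j - int k + int r) ` {1..min k (N - j)}. ?F c - ?F (int j - int k - c))"
  proof (rule sum.mono_neutral_right)
    show "\<forall>c\<in>{int j - int k + 1..int N} - (\<lambda>r. int j - int k + int r) ` {1..min k (N - j)}.
        ?F c - ?F (int j - int k - c) = 0"
    proof
      fix c assume c: "c \<in> {int j - int k + 1..int N} - (\<lambda>r. int j - int k + int r) ` {1..min k (N - j)}"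
      then have "nat (c - int j + int k) \<notin> {1..min k (N - j)}"
        using imageI[of "nat (c - int j + int k)" "{1..min k (N - j)}" "\<lambda>r. int j - int k + int r"]
        by auto
      with c have "c - int j > 0 \<or> c + int k > int N"
        using assms by auto
      then show "?F c - ?F (int j - int k - c) = 0"
        by (auto simp: Phi_outside)
    qed
  qed (use assms in auto)
  also have "\<dots> = (\<Sum>r=1..min k (N - j). ?F (int j - int k + int r) - ?F (- int r))"
    by (subst sum.reindex) (auto simp: inj_on_def)
  finally show ?thesis .
qed

text \<open>There is no cancelling range here, and \<open>c = 0\<close> is left over besides the
  delta terms. For \<open>j \<ge> 1\<close> its two terms will come from \<open>kappa_flip\<close>;
  for \<open>j = 0\<close> they are all there is.\<close>

lemma GD_gt:
  assumes "j < k" "k \<le> N"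
  shows "GD (int k) (int j) y = Phi (int k) (int j) y 0 - Phi (int k) (int j) y (int j - int k)
    + (\<Sum>r=1..min j (N - k). Phi (int k) (int j) y (int r) - Phi (int k) (int j) y (int j - int k - int r))"
proof -
  let ?F = "Phi (int k) (int j) y"
  have "GD (int k) (int j) y = (\<Sum>c\<in>insert 0 (int ` {1..min j (N - k)}). ?F c - ?F (int j - int k - c))"
    unfolding GD_def
  proof (rule sum.mono_neutral_right)
    show "\<forall>c\<in>{0..int N} - insert 0 (int ` {1..min j (N - k)}). ?F c - ?F (int j - int k - c) = 0"
    proof
      fix c assume c: "c \<in> {0..int N} - insert 0 (int ` {1..min j (N - k)})"
      then have "nat c \<notin> {1..min j (N - k)}" "c > 0"
        using imageI[of "nat c" "{1..min j (N - k)}" int] by auto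
      then have "c > int j \<or> c + int k > int N"
        using assms by auto
      then show "?F c - ?F (int j - int k - c) = 0"
        by (auto simp: Phi_outside)
    qed
  qed (use assms in auto)
  also have "\<dots> = ?F 0 - ?F (int j - int k) + (\<Sum>c\<in>int ` {1..min j (N - k)}. ?F c - ?F (int j - int k - c))"
    by (subst sum.insert) auto
  finally show ?thesis
    by (simp add: sum.reindex inj_on_def)
qed

end


section \<open>Brackets with the Hamiltonians\<close>

lemma multiplier_neg_one_power_times: "multiplier c ((-1) ^ k * R) = (-1) ^ k * multiplier c R"
  by (rule cf_eqI) simp

text \<open>The signs from passing between t and s in the output and in the variational derivative
  are handed to the two coefficients of \<open>L\<close>; only the sum of the exponents
  matters.\<close>

lemma sign_transfer:
  assumes "a + b = k + j"
  shows "(-1) ^ k * (R * multiplier c (S * ((-1) ^ j * y)))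
    = ((-1) ^ a * R) * multiplier c (((-1) ^ b * S) * y)"
proof -
  let ?T = "R * multiplier c (S * y)"
  have "(-1) ^ k * (R * multiplier c (S * ((-1) ^ j * y)))
      = (-1) ^ k * (R * ((-1) ^ j * multiplier c (S * y)))"
    unfolding mult.left_commute[of S] multiplier_neg_one_power_times ..
  also have "\<dots> = ((-1) ^ k * (-1) ^ j) * ?T"
    by (simp only: mult_ac)
  also have "(-1::qfield) ^ k * (-1) ^ j = (-1) ^ a * (-1) ^ b"
    using assms by (simp flip: power_add)
  also have "((-1) ^ a * (-1) ^ b) * ?T = ((-1) ^ a * R) * ((-1) ^ b * multiplier c (S * y))"
    by (simp only: mult_ac)
  finally show ?thesis
    unfolding mult.assoc[of "(-1) ^ b"] multiplier_neg_one_power_times .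
qed

lemma sum_int_lessThan: "(\<Sum>j\<in>{0..<int N}. f j) = (\<Sum>j<N. f (int j))"
  by (rule sum.reindex_bij_witness[where i = int and j = nat]) auto

context lax
begin

lemma sign_transfer_D:
  assumes "a + b = k + j"
  shows "(-1) ^ k * (R * D e (S * ((-1) ^ j * y))) = ((-1) ^ a * R) * D e (((-1) ^ b * S) * y)"
  unfolding qshift_eq_multiplier using assms by (rule sign_transfer)

text \<open>That is, $dG = \int \operatorname{Res}(W\, dL)$.\<close>

definition represents :: "qop \<Rightarrow> fser \<Rightarrow> bool" where
  "represents W G \<longleftrightarrow> W \<in> qops \<and> homogeneous 0 G
    \<and> (\<forall>j. 1 \<le> j \<longrightarrow> j \<le> N \<longrightarrow> gradient j G = (-1) ^ j * left_coeff W (int j))"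

lemma represents_hamiltonian: "n \<ge> 1 \<Longrightarrow> represents (Z n) (hamiltonian q N n)"
  by (simp add: represents_def homogeneous_hamiltonian gradient_hamiltonian left_coeff_def)

section \<open>The linear bracket as a commutator\<close>

definition bracket1_term :: "fser \<Rightarrow> qfield \<Rightarrow> nat \<Rightarrow> nat \<Rightarrow> qfield" where
  "bracket1_term G u i j = (if i \<noteq> N \<and> j \<noteq> N \<and> i + j \<ge> N
     then u * D (int j - int N) (tgen (i + j - N) * gradient j G)
        - tgen (i + j - N) * D (int N - int i) (u * gradient j G) else 0)"

lemma bracket_field_bracket1:
  assumes "homogeneous 0 G" "i \<le> N"
  shows "bracket_field N (bracket1_with q N u) G i = (\<Sum>j=1..N. bracket1_term G u i j)"
  unfolding bracket_field_def bracket1_term_def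
  by (rule sum.cong) (use assms in \<open>auto simp: contract_bracket1 of_nat_diff\<close>)

lemma bracket1_term_corr:
  "bracket1_term G ((-1) ^ N) i j = (-1) ^ N * bracket1_term G 1 i j"
  by (simp add: bracket1_term_def qshift_neg_one_power_times right_diff_distrib mult.left_commute)

text \<open>Term by term this is the linear formula for -[L, W_-]. For \<open>i < N\<close> the
  extra commutator term \<open>j = 0\<close> has coefficient \<open>s (i - N)\<close>, which is 0,
  and the bracket has no term with \<open>j = N\<close>. For \<open>i = N\<close> both sides
  vanish.\<close>

lemma bracket_field_bracket1_corr:
  assumes G: "represents W G" and W: "L \<star> W = W \<star> L" and i: "1 \<le> i" "i \<le> N"
  shows "(-1) ^ i * bracket_field N (bracket1_corr q N) G i = op_comm q L (op_plus_part W) (int N - int i)"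
proof (cases "i = N")
  case True
  then show ?thesis
    using G by (simp add: bracket1_corr_def bracket_field_bracket1 represents_def bracket1_term_def
        op_comm_plus_part_0)
next
  case False
  let ?Y = "left_coeff W"
  let ?f = "\<lambda>j. D (int j - int N) (s (int i + int j - int N) * ?Y (int j))
    - s (int i + int j - int N) * D (int N - int i) (?Y (int j))"
  have summand: "(-1) ^ i * bracket1_term G ((-1) ^ N) i j = ?f j" if "1 \<le> j" "j < N" for j
  proof (cases "i + j \<ge> N")
    case True
    define b where "b = i + j - N"
    \<comment> \<open>The prefactor (-1)^N turns the total sign into (-1)^(i+j+N), which is the sign
      of \<open>s b\<close>. The exponent \<open>2 * N\<close> gives the remaining factor 1 a
      trivial sign.\<close>
    have b: "b \<le> N" "int i + int j - int N = int b" "2 * N + b = i + N + j" "b + 2 * N = i + N + j"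
      using True i that by (auto simp: b_def)
    have "(-1) ^ i * bracket1_term G ((-1) ^ N) i j
        = (-1) ^ (i + N) * (1 * D (int j - int N) (tgen b * ((-1) ^ j * ?Y (int j))))
          - (-1) ^ (i + N) * (tgen b * D (int N - int i) (1 * ((-1) ^ j * ?Y (int j))))"
      using G True False that unfolding bracket1_term_corr
      by (simp add: bracket1_term_def represents_def power_add b_def algebra_simps)
    also have "\<dots> = ?f j"
      unfolding sign_transfer_D[OF b(3), where R = 1] sign_transfer_D[OF b(4), where S = 1] b(2)
      using b(1) by (simp add: s_nat)
    finally show ?thesis .
  next
    case False
    then show ?thesis by (simp add: bracket1_term_def s_outside)
  qed
  have "(-1) ^ i * bracket_field N (bracket1_corr q N) G i
      = (\<Sum>j=1..N. (-1) ^ i * bracket1_term G ((-1) ^ N) i j)"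
    using G i by (simp add: bracket1_corr_def bracket_field_bracket1 represents_def sum_distrib_left)
  also have "\<dots> = (\<Sum>j<N. ?f j)"
  proof (rule sum.mono_neutral_cong)
    show "?f j = 0" if "j \<in> {..<N} - {1..N}" for j
      using that False i by (auto simp: s_outside)
    show "(-1) ^ i * bracket1_term G ((-1) ^ N) i j = 0" if "j \<in> {1..N} - {..<N}" for j
      using that by (auto simp: bracket1_term_def)
  qed (use summand in auto)
  also have "\<dots> = op_comm q L (op_plus_part W) (int N - int i)"
    using G W i by (subst op_comm_eq_linear) (auto simp: represents_def sum_int_lessThan)
  finally show ?thesis .
qed

text \<open>For \<open>j < i\<close> skew symmetry prescribes the symbol on the left, but the
  commutator calls for \<open>kappa q N i j\<close>. The discrepancy is the symbol of D^(j-i) -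
  1.\<close>

lemma kappa_flip:
  assumes "j < i" "i \<le> N"
  shows "- kappa q N j i (- w) = kappa q N i j w + q powi (- ((int j - int i) * w)) - 1"
proof (cases "w = 0")
  case False
  define x where "x = q powi w"
  \<comment> \<open>In these variables the claim is B (1 - A) (1 - C) = (1 - A B) (1 - B C) + (B -
    1) (1 - A B C), over the common denominator 1 - x^N.\<close>
  define A B C where "A = x ^ j" and "B = x ^ (i - j)" and "C = x ^ (N - i)"
  have nz: "A \<noteq> 0" "B \<noteq> 0" "C \<noteq> 0"
    using q_nonzero by (auto simp: A_def B_def C_def x_def)
  have pw: "q powi (int k * w) = x ^ k" "q powi (w * int k) = x ^ k" for k
    using power_int_mult[of q w "int k"] by (simp_all add: x_def mult.commute)
  have pw': "q powi (- (int k * w)) = 1 / x ^ k" "q powi (- (w * int k)) = 1 / x ^ k" for k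
    by (simp_all add: power_int_minus pw divide_inverse)
  have e: "x ^ i = A * B" "x ^ (N - j) = B * C" "x ^ N = A * B * C"
    using assms by (simp_all add: A_def B_def C_def flip: power_add)
  have "x ^ N \<noteq> 1"
    using powi_ne_1[of "w * int N"] False N_ge by (simp add: pw)
  then have ne: "A * B * C \<noteq> 1" by (simp add: e)
  have "- ((int j - int i) * w) = int (i - j) * w"
    using assms by (simp add: of_nat_diff algebra_simps)
  then have 1: "q powi (- ((int j - int i) * w)) = B"
    by (simp only: pw B_def)
  have 2: "kappa q N i j w = (1 - A * B) * (1 - B * C) / (1 - A * B * C)"
    by (simp only: kappa_def if_not_P[OF False] pw e)
  have 3: "kappa q N j i (- w) = (1 - 1 / A) * (1 - 1 / C) / (1 - 1 / (A * B * C))"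
    using False by (simp only: kappa_def neg_equal_0_iff_equal if_False mult_minus_left mult_minus_right
        pw' e A_def[symmetric] C_def[symmetric])
  have 4: "1 - 1 / A = (A - 1) / A" "1 - 1 / C = (C - 1) / C"
    "1 - 1 / (A * B * C) = (A * B * C - 1) / (A * B * C)"
    using nz by (simp_all add: diff_divide_distrib)
  have "(A - 1) / A * ((C - 1) / C) * (A * B * C) = B * (1 - A) * (1 - C)"
    using nz by (simp add: field_simps)
  then have "kappa q N j i (- w) = B * (1 - A) * (1 - C) / (A * B * C - 1)"
    unfolding 3 4 by (metis divide_divide_eq_right)
  then have "- kappa q N j i (- w) = B * (1 - A) * (1 - C) / (1 - A * B * C)"
    using minus_divide_right[of "B * (1 - A) * (1 - C)" "A * B * C - 1"] by simp
  also have "B * (1 - A) * (1 - C) = (1 - A * B) * (1 - B * C) + (B - 1) * (1 - A * B * C)"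
    by (simp add: algebra_simps)
  also have "\<dots> / (1 - A * B * C) = (1 - A * B) * (1 - B * C) / (1 - A * B * C) + B - 1"
    using ne by (simp add: add_divide_distrib)
  finally show ?thesis by (simp add: 1 2)
qed (simp add: kappa_def)

text \<open>One formula for both orders of \<open>i\<close> and \<open>j\<close>. The delta terms
  match the truncated \<open>GD\<close>; for \<open>j < i\<close> the change of symbol yields the
  terms of \<open>GD\<close> at \<open>c = 0\<close>, which the delta terms lack.\<close>

lemma contract_bracket2:
  assumes G: "represents W G" and i: "1 \<le> i" "i \<le> N" and j: "1 \<le> j" "j \<le> N"
  defines "y \<equiv> left_coeff W (int j)"
  shows "(-1) ^ i * contract j G (bracket2 q N i j)
    = s (int i) * multiplier (kappa q N i j) (s (int j) * y) + GD (int i) (int j) y"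
proof -
  have G0: "homogeneous 0 G" and X: "gradient j G = (-1) ^ j * y"
    using G j by (auto simp: represents_def y_def)
  let ?F = "Phi (int i) (int j) y"
  \<comment> \<open>Any delta term whose coefficient indices sum to \<open>i + j\<close> is a
    \<open>Phi\<close>: its first index forces \<open>c\<close>, and the shift exponent has to agree
    with that \<open>c\<close>.\<close>
  have F: "(-1) ^ i * (tgen a * D e (tgen b * gradient j G)) = ?F c"
    if "a + b = i + j" "a \<le> N" "b \<le> N" "int i + c = int a" "e = int j - c - int i" for a b c e
  proof -
    have c: "int j - c = int b" using that by linarith
    have "?F c = (s (int a)) * D e (s (int b) * y)"
      unfolding Phi_def that(4) c that(5) ..
    then show ?thesis
      unfolding X sign_transfer_D[OF that(1)] using that(2,3) by (simp only: s_nat)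
  qed
  have K: "(-1) ^ i * (tgen i * multiplier c (tgen j * gradient j G))
      = s (int i) * multiplier c (s (int j) * y)" for c
    unfolding X sign_transfer[OF refl] using i j by (simp add: s_nat)
  show ?thesis
  proof (cases "i \<le> j")
    case True
    let ?M = "{1..min i (N - j)}"
    have "(-1) ^ i * (\<Sum>r\<in>?M. tgen (j + r) * D (- int r) (tgen (i - r) * gradient j G))
        = (\<Sum>r\<in>?M. ?F (int j - int i + int r))"
      unfolding sum_distrib_left by (intro sum.cong F) (use i j True in auto)
    moreover have "(-1) ^ i * (\<Sum>r\<in>?M. tgen (i - r) * D (int (j - i + r)) (tgen (j + r) * gradient j G))
        = (\<Sum>r\<in>?M. ?F (- int r))"
      unfolding sum_distrib_left by (intro sum.cong F) (use i j True in auto)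
    ultimately show ?thesis
      by (simp only: contract_bracket2_le[OF G0 True] GD_le[OF True j(2)] K sum_subtractf
          right_diff_distrib distrib_left) simp
  next
    case False
    then have less: "j < i" by simp
    let ?M = "{1..min j (N - i)}"
    have 1: "(-1) ^ i * (\<Sum>r\<in>?M. tgen (j - r) * D (int r) (tgen (i + r) * gradient j G))
        = (\<Sum>r\<in>?M. ?F (int j - int i - int r))"
      unfolding sum_distrib_left by (intro sum.cong F) (use i j less in auto)
    have 2: "(-1) ^ i * (\<Sum>r\<in>?M. tgen (i + r) * D (- int (i - j + r)) (tgen (j - r) * gradient j G))
        = (\<Sum>r\<in>?M. ?F (int r))"
      unfolding sum_distrib_left by (intro sum.cong F) (use i j less in auto)
    let ?R = "s (int j) * y"
    have "- multiplier (\<lambda>k. kappa q N j i (- k)) ?R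
        = multiplier (kappa q N i j) ?R + D (int j - int i) ?R - ?R"
    proof (rule cf_eqI)
      fix \<mu>
      have "- kappa q N j i (- wt \<mu>) * cf ?R \<mu>
          = (kappa q N i j (wt \<mu>) + q powi (- ((int j - int i) * wt \<mu>)) - 1) * cf ?R \<mu>"
        by (simp only: kappa_flip[OF less i(2)])
      then show "cf (- multiplier (\<lambda>k. kappa q N j i (- k)) ?R) \<mu>
          = cf (multiplier (kappa q N i j) ?R + D (int j - int i) ?R - ?R) \<mu>"
        by (simp add: algebra_simps)
    qed
    then have "- (s (int i) * multiplier (\<lambda>k. kappa q N j i (- k)) ?R)
        = s (int i) * (multiplier (kappa q N i j) ?R + D (int j - int i) ?R - ?R)"
      by (metis mult_minus_right)
    also have "\<dots> = s (int i) * multiplier (kappa q N i j) ?R + (?F 0 - ?F (int j - int i))"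
      by (simp add: Phi_def algebra_simps)
    finally have 3: "- (s (int i) * multiplier (\<lambda>k. kappa q N j i (- k)) ?R)
        = s (int i) * multiplier (kappa q N i j) ?R + (?F 0 - ?F (int j - int i))" .
    have "(-1) ^ i * contract j G (bracket2 q N i j)
        = - (s (int i) * multiplier (\<lambda>k. kappa q N j i (- k)) ?R)
          - (\<Sum>r\<in>?M. ?F (int j - int i - int r)) + (\<Sum>r\<in>?M. ?F (int r))"
      by (simp only: contract_bracket2_gt[OF G0 less] K 1 2 right_diff_distrib distrib_left
          mult_minus_right) simp
    then show ?thesis
      unfolding 3 GD_gt[OF less i(2)] sum_subtractf by simp
  qed
qed

text \<open>The coefficients of D^0 in \<open>L \<star> W\<close> and \<open>W \<star> L\<close>.
  They agree before integration, because the two operators are equal.\<close>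

lemma residue_identity:
  assumes W: "W \<in> qops" "L \<star> W = W \<star> L"
  shows "(\<Sum>j\<le>N. s (int j) * left_coeff W (int j))
    = (\<Sum>j\<le>N. D (int j - int N) (s (int j) * left_coeff W (int j)))"
proof -
  have inj: "inj_on (\<lambda>j. int N - int j) {..N}" "inj_on (\<lambda>j. int j - int N) {..N}"
    by (auto simp: inj_on_def)
  have "(L \<star> W) 0 = (\<Sum>j\<le>N. L (int N - int j) * D (int N - int j) (W (0 - (int N - int j))))"
  proof (rule op_mult_reindex[OF _ inj(1)])
    fix a assume a: "a \<notin> (\<lambda>j. int N - int j) ` {..N}"
    have "a < 0 \<or> a > int N"
    proof (rule ccontr)
      assume "\<not> ?thesis"
      then have "a = int N - int (nat (int N - a))" "nat (int N - a) \<in> {..N}" by auto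
      with a show False by blast
    qed
    then show "L a = 0 \<or> W (0 - a) = 0" by (auto simp: lax_L_outside)
  qed simp
  moreover have "(W \<star> L) 0 = (\<Sum>j\<le>N. W (int j - int N) * D (int j - int N) (L (0 - (int j - int N))))"
  proof (rule op_mult_reindex[OF _ inj(2)])
    fix a assume a: "a \<notin> (\<lambda>j. int j - int N) ` {..N}"
    have "0 - a < 0 \<or> 0 - a > int N"
    proof (rule ccontr)
      assume "\<not> ?thesis"
      then have "a = int (nat (a + int N)) - int N" "nat (a + int N) \<in> {..N}" by auto
      with a show False by blast
    qed
    then show "W a = 0 \<or> L (0 - a) = 0" by (auto simp: lax_L_outside)
  qed simp
  ultimately show ?thesis
    using W(2) by (simp add: left_coeff_def L_eq_s D_times mult.commute)
qed

text \<open>At each nonzero weight the residue identity is one linear relation that includes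
  \<open>j = 0\<close>. Solving it for that term, where \<open>s 0 = 1\<close>, evaluates the sum
  over \<open>j \<ge> 1\<close>; the remaining factor q^(iw) - 1 is the symbol of D^(-i) - 1. At
  weight 0 both sides vanish.\<close>

lemma correction_sum:
  assumes W: "W \<in> qops" "L \<star> W = W \<star> L"
  shows "(\<Sum>j=1..N. multiplier (kappa q N i j) (s (int j) * left_coeff W (int j)))
    = D (- int i) (left_coeff W 0) - left_coeff W 0"
proof (rule cf_eqI)
  fix \<mu>
  define w where "w = wt \<mu>"
  define g where "g = (\<lambda>j. cf (s (int j) * left_coeff W (int j)) \<mu>)"
  have g0: "g 0 = cf (left_coeff W 0) \<mu>" by (simp add: g_def)
  show "cf (\<Sum>j=1..N. multiplier (kappa q N i j) (s (int j) * left_coeff W (int j))) \<mu>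
      = cf (D (- int i) (left_coeff W 0) - left_coeff W 0) \<mu>"
  proof (cases "w = 0")
    case False
    have ne: "1 - q powi (w * int N) \<noteq> 0"
      using powi_ne_1[of "w * int N"] False N_ge by simp
    have "(\<Sum>j\<le>N. g j) = (\<Sum>j\<le>N. q powi (- ((int j - int N) * w)) * g j)"
      using arg_cong[OF residue_identity[OF W], of "\<lambda>R. cf R \<mu>"] by (simp add: g_def w_def)
    also have "\<dots> = (\<Sum>j\<le>N. q powi (w * int (N - j)) * g j)"
      by (rule sum.cong) (auto simp: of_nat_diff algebra_simps)
    finally have "(\<Sum>j\<le>N. (1 - q powi (w * int (N - j))) * g j) = 0"
      by (simp add: left_diff_distrib sum_subtractf)
    moreover have "{..N} = insert 0 {1..N}" by auto
    ultimately have "(1 - q powi (w * int N)) * g 0 + (\<Sum>j=1..N. (1 - q powi (w * int (N - j))) * g j) = 0"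
      by simp
    then have sum: "(\<Sum>j=1..N. (1 - q powi (w * int (N - j))) * g j) = - ((1 - q powi (w * int N)) * g 0)"
      by (simp only: add_eq_0_iff)
    have "(\<Sum>j=1..N. kappa q N i j w * g j)
        = (1 - q powi (int i * w)) / (1 - q powi (w * int N)) * (\<Sum>j=1..N. (1 - q powi (w * int (N - j))) * g j)"
      unfolding sum_distrib_left using False by (intro sum.cong) (auto simp: kappa_def)
    also have "\<dots> = (q powi (int i * w) - 1) * g 0"
      unfolding sum using ne by (simp add: field_simps)
    finally show ?thesis
      by (simp add: g_def w_def algebra_simps)
  qed (simp add: kappa_def w_def)
qed

text \<open>The symbol terms add up to \<open>GD i 0\<close>, and \<open>GD i N\<close> is an empty
  sum. So the range 1 to N of the bracket becomes the range 0 to N - 1 of the commutator.\<close>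

lemma bracket_field_bracket2:
  assumes G: "represents W G" and W: "A = L \<star> W" "A = W \<star> L" and i: "1 \<le> i" "i \<le> N"
  shows "(-1) ^ i * bracket_field N (bracket2 q N) G i = op_comm q L (op_plus_part A) (int N - int i)"
proof -
  let ?Y = "\<lambda>j. left_coeff W (int j)"
  have Wq: "W \<in> qops" "L \<star> W = W \<star> L"
    using G W by (auto simp: represents_def)
  have "(-1) ^ i * bracket_field N (bracket2 q N) G i
      = s (int i) * (\<Sum>j=1..N. multiplier (kappa q N i j) (s (int j) * ?Y j)) + (\<Sum>j=1..N. GD (int i) (int j) (?Y j))"
    unfolding bracket_field_def sum_distrib_left sum.distrib[symmetric]
    by (rule sum.cong) (use contract_bracket2[OF G i] in auto)
  also have "s (int i) * (\<Sum>j=1..N. multiplier (kappa q N i j) (s (int j) * ?Y j)) = GD (int i) 0 (?Y 0)"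
    unfolding correction_sum[OF Wq] using GD_gt[of 0 i "?Y 0"] i
    by (simp add: Phi_def right_diff_distrib)
  also have "(\<Sum>j=1..N. GD (int i) (int j) (?Y j)) = (\<Sum>j=1..<N. GD (int i) (int j) (?Y j))"
    using GD_le[of i N] i by (intro sum.mono_neutral_right) auto
  also have "GD (int i) 0 (?Y 0) + (\<Sum>j=1..<N. GD (int i) (int j) (?Y j)) = (\<Sum>j<N. GD (int i) (int j) (?Y j))"
  proof -
    have "{..<N} = insert 0 {1..<N}" using N_ge by auto
    then show ?thesis by simp
  qed
  also have "\<dots> = op_comm q L (op_plus_part A) (int N - int i)"
    using i by (subst op_comm_eq_GD[OF Wq(1) W]) (auto simp: sum_int_lessThan)
  finally show ?thesis .
qed

section \<open>The flows, their hamiltonian form and involution\<close>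

lemma flow_L_eq: "flow_L q N n = op_comm q L (op_plus_part (P \<up> n))"
proof
  fix k
  let ?C = "op_comm q L (op_plus_part (P \<up> n))"
  have outside: "?C k = 0" if "k < 0 \<or> k \<ge> int N" for k
    using that by (intro op_comm_plus_part_outside) (simp_all add: P_power_L_commute)
  have flow: "flow_L q N n k = vder N (flow_t q N n) (L k)" for k
    by (simp add: flow_L_def flow_eq_vder)
  show "flow_L q N n k = ?C k"
  proof (cases rule: lax_L_cases[of N k])
    case (1 i)
    then show ?thesis
      using outside[of "int N"]
      by (cases "i = 0") (simp_all add: flow vder_L_at lax_L_top flow_t_def lax_frac_power_def flip: mult.assoc power_add)
  next
    case 2
    then show ?thesis using outside[of k] by (auto simp: flow)
  qed
qed

text \<open>One argument for both brackets: it asks only that the hamiltonian field of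
  \<open>G\<close> be [L, A_+] with \<open>A\<close> commuting with \<open>L\<close>. It is applied
  with \<open>A\<close> equal to \<open>Z m\<close> in the linear and \<open>P \<up> m\<close> in
  the quadratic case.\<close>

lemma bracket_hamiltonians_commute:
  assumes b: "\<And>i j. i \<le> N \<Longrightarrow> j \<le> N \<Longrightarrow> bihomogeneous (b i j)"
    and A: "A \<in> qops" "L \<star> A = A \<star> L"
    and "\<And>i. 1 \<le> i \<Longrightarrow> i \<le> N
      \<Longrightarrow> (-1) ^ i * bracket_field N b G i = op_comm q L (op_plus_part A) (int N - int i)"
    and G: "homogeneous 0 G" and n: "n \<ge> 1"
  shows "pbracket N b (hamiltonian q N n) G = 0"
proof -
  let ?B = "op_plus_part A" and ?v = "bracket_field N b G"
  let ?C = "op_comm q L ?B"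
  note [simp] = A(1)
  have dL: "(\<lambda>k. vder N ?v (L k)) = ?C"
  proof
    fix k
    have outside: "?C k = 0" if "k < 0 \<or> k \<ge> int N" for k
      using that A by (intro op_comm_plus_part_outside) simp_all
    show "vder N ?v (L k) = ?C k"
    proof (cases rule: lax_L_cases[of N k])
      case (1 i)
      then show ?thesis
        using outside[of "int N"] assms(4)[of i] by (cases "i = 0") (simp_all add: vder_L_at lax_L_top)
    qed (use outside[of k] in auto)
  qed
  have Cq: "?C \<in> qops" unfolding dL[symmetric] by simp
  have "(\<lambda>k. ?C k + (?B \<star> L) k) = L \<star> ?B"
    by (simp add: op_comm_def)
  then have "op_trace (Z n \<star> (L \<star> ?B)) = op_trace (Z n \<star> ?C) + op_trace (Z n \<star> (?B \<star> L))"
    using op_mult_add_right[OF Z_qops Cq, of "?B \<star> L" n] by (simp flip: op_trace_add)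
  moreover have "op_trace (Z n \<star> (?B \<star> L)) = op_trace (Z n \<star> (L \<star> ?B))"
  proof -
    have "op_trace (Z n \<star> (?B \<star> L)) = op_trace (Z n \<star> ?B \<star> L)"
      by (simp add: op_mult_assoc)
    also have "\<dots> = op_trace (L \<star> (Z n \<star> ?B))"
      by (rule op_trace_mult_commute) simp_all
    also have "L \<star> (Z n \<star> ?B) = Z n \<star> (L \<star> ?B)"
      by (simp add: L_Z Z_L flip: op_mult_assoc)
    finally show ?thesis .
  qed
  ultimately show ?thesis
    by (simp add: pbracket_eq_vder[OF b homogeneous_hamiltonian G] vder_hamiltonian[OF n] dL)
qed

lemma bihomogeneous_bracket1_corr: "bihomogeneous (bracket1_corr q N i j)"
  by (simp add: bracket1_corr_def bihomogeneous_bracket1)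

lemma L_Z_commute: "L \<star> Z n = Z n \<star> L"
  by (simp add: L_Z Z_L)

lemma L_bracket_bracket1_corr:
  "n \<ge> 1 \<Longrightarrow> L_bracket N (bracket1_corr q N) (hamiltonian q N n) = op_comm q L (op_plus_part (Z n))"
  by (rule L_bracket_eq[OF bihomogeneous_bracket1_corr homogeneous_hamiltonian])
     (auto intro!: bracket_field_bracket1_corr represents_hamiltonian op_comm_plus_part_outside L_Z_commute)

lemma L_bracket_bracket2:
  "n \<ge> 1 \<Longrightarrow> L_bracket N (bracket2 q N) (hamiltonian q N n) = op_comm q L (op_plus_part (P \<up> n))"
  by (rule L_bracket_eq[OF bihomogeneous_bracket2 homogeneous_hamiltonian])
     (auto intro!: bracket_field_bracket2 represents_hamiltonian op_comm_plus_part_outside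
       simp: L_Z Z_L P_power_L_commute)

lemma pbracket_bracket1_corr:
  "n \<ge> 1 \<Longrightarrow> m \<ge> 1 \<Longrightarrow> pbracket N (bracket1_corr q N) (hamiltonian q N n) (hamiltonian q N m) = 0"
  by (rule bracket_hamiltonians_commute[where A = "Z m"])
     (auto intro!: bracket_field_bracket1_corr represents_hamiltonian L_Z_commute
       bihomogeneous_bracket1_corr homogeneous_hamiltonian)

lemma pbracket_bracket2:
  "n \<ge> 1 \<Longrightarrow> m \<ge> 1 \<Longrightarrow> pbracket N (bracket2 q N) (hamiltonian q N n) (hamiltonian q N m) = 0"
  by (rule bracket_hamiltonians_commute[where A = "P \<up> m"])
     (auto intro!: bracket_field_bracket2 represents_hamiltonian
       bihomogeneous_bracket2 homogeneous_hamiltonian simp: L_Z Z_L P_power_L_commute)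

end


section \<open>Restriction to $t_N(z) = a$\<close>

text \<open>\<open>restrict_tN\<close> sums over all powers of $t_N[0]$ and is meaningful only on series of bounded
  degree, where that sum is finite.\<close>

definition restrict_field :: "nat \<Rightarrow> complex \<Rightarrow> qfield \<Rightarrow> qfield" where
  "restrict_field N a R = Qfield (\<lambda>m. restrict_tN N a (fourier R m))"

lemma coeff_restrict_tN: "coeff (restrict_tN N a f) \<mu> = (if \<exists>m. (N, m) \<in># \<mu> then 0
    else Sum_any (\<lambda>k. a ^ k * coeff f (\<mu> + replicate_mset k (N, 0))))"
  by (simp add: restrict_tN_def)

lemma wt_replicate [simp]: "wt (replicate_mset k (N, 0)) = 0"
  and deg_replicate [simp]: "deg (replicate_mset k (N, m)) = k * N"
  by (induction k) (simp_all add: wt_def)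

lemma homogeneous_restrict_tN:
  assumes "homogeneous m f"
  shows "homogeneous m (restrict_tN N a f)"
  unfolding homogeneous_def
proof (intro allI impI)
  fix \<mu> assume ne: "coeff (restrict_tN N a f) \<mu> \<noteq> 0"
  show "wt \<mu> = m"
  proof (rule ccontr)
    assume "wt \<mu> \<noteq> m"
    then have "coeff f (\<mu> + replicate_mset k (N, 0)) = 0" for k
      using assms by (auto simp: homogeneous_def)
    with ne show False by (simp add: coeff_restrict_tN split: if_splits)
  qed
qed

lemma fourier_restrict_field: "fourier (restrict_field N a R) m = restrict_tN N a (fourier R m)"
  unfolding restrict_field_def
  by (rule fourier_Qfield) (rule homogeneous_restrict_tN[OF homogeneous_fourier])

text \<open>A monomial with \<open>k\<close> copies of t_N[0] has degree at least
  \<open>k * N\<close>, so a degree bound cuts the sum off at every \<open>K \<ge> d\<close>. The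
  freedom in \<open>K\<close> gives several fields a common cutoff.\<close>

lemma cf_restrict_field:
  assumes "deg_le d R" "d \<le> int K" "N \<ge> 1"
  shows "cf (restrict_field N a R) \<mu> = (if \<exists>m. (N, m) \<in># \<mu> then 0
    else (\<Sum>k\<le>K. a ^ k * cf R (\<mu> + replicate_mset k (N, 0))))"
proof -
  have "cf R (\<mu> + replicate_mset k (N, 0)) = 0" if "k > K" for k
  proof (rule ccontr)
    assume "cf R (\<mu> + replicate_mset k (N, 0)) \<noteq> 0"
    then have "int (deg \<mu> + k * N) \<le> d"
      using assms(1) by (force simp: deg_le_def)
    moreover have "k * N \<ge> k" using assms(3) by simp
    ultimately show False using assms(2) that by linarith
  qed
  then have "k \<le> K" if "cf R (\<mu> + replicate_mset k (N, 0)) \<noteq> 0" for k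
    using that not_le by blast
  then have "Sum_any (\<lambda>k. a ^ k * cf R (\<mu> + replicate_mset k (N, 0)))
      = (\<Sum>k\<le>K. a ^ k * cf R (\<mu> + replicate_mset k (N, 0)))"
    by (intro Sum_any.expand_superset) auto
  moreover have "cf (restrict_field N a R) \<mu> = coeff (fourier (restrict_field N a R) (wt \<mu>)) \<mu>"
    by (simp add: coeff_fourier)
  ultimately show ?thesis
    by (simp add: fourier_restrict_field coeff_restrict_tN coeff_fourier)
qed

section \<open>On series of bounded degree the substitution is a ring homomorphism\<close>

lemma deg_le_mono: "deg_le d R \<Longrightarrow> d \<le> e \<Longrightarrow> deg_le e R"
  by (auto simp: deg_le_def)

lemma restrict_field_0 [simp]: "restrict_field N a 0 = 0"
  by (rule fourier_eqI, rule fser_eqI) (simp add: fourier_restrict_field coeff_restrict_tN)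

definition bounded_deg :: "qfield \<Rightarrow> bool" where
  "bounded_deg R \<longleftrightarrow> (\<exists>d. deg_le d R)"

lemma bounded_deg_simps [simp]:
  "bounded_deg 0" "bounded_deg (tgen i)" "bounded_deg R \<Longrightarrow> bounded_deg (qshift q j R)"
  "bounded_deg R \<Longrightarrow> bounded_deg S \<Longrightarrow> bounded_deg (R * S)"
  "bounded_deg R \<Longrightarrow> bounded_deg ((-1) ^ k * R)"
  by (auto simp: bounded_deg_def intro: deg_le_0 deg_le_tgen deg_le_qshift deg_le_times
      deg_le_neg_one_power_times)

lemma bounded_deg_common:
  assumes "bounded_deg R" "bounded_deg S"
  obtains K where "deg_le (int K) R" "deg_le (int K) S"
proof -
  obtain d e where "deg_le d R" "deg_le e S"
    using assms by (auto simp: bounded_deg_def)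
  then have "deg_le (int (nat (max d e))) R" "deg_le (int (nat (max d e))) S"
    by (auto intro: deg_le_mono)
  then show ?thesis by (rule that)
qed

lemma bounded_deg_diff [simp]: "bounded_deg R \<Longrightarrow> bounded_deg S \<Longrightarrow> bounded_deg (R - S)"
  by (metis bounded_deg_common bounded_deg_def deg_le_diff)

lemma bounded_deg_add [simp]: "bounded_deg R \<Longrightarrow> bounded_deg S \<Longrightarrow> bounded_deg (R + S)"
  using bounded_deg_diff[of R "0 - S"] bounded_deg_diff[of 0 S] by simp

lemma bounded_deg_sum [simp]: "(\<And>i. i \<in> I \<Longrightarrow> bounded_deg (f i)) \<Longrightarrow> bounded_deg (sum f I)"
  by (induction I rule: infinite_finite_induct) auto

context
  fixes N :: nat and a :: complex
  assumes N_pos: "N \<ge> 1"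
begin

lemma restrict_field_diff:
  assumes "bounded_deg R" "bounded_deg S"
  shows "restrict_field N a (R - S) = restrict_field N a R - restrict_field N a S"
proof -
  obtain K where K: "deg_le (int K) R" "deg_le (int K) S"
    using bounded_deg_common[OF assms] .
  show ?thesis
    by (rule cf_eqI) (simp add: cf_restrict_field[where K = K and d = "int K", OF _ order_refl N_pos] K deg_le_diff
        right_diff_distrib sum_subtractf)
qed

lemma restrict_field_add:
  assumes "bounded_deg R" "bounded_deg S"
  shows "restrict_field N a (R + S) = restrict_field N a R + restrict_field N a S"
  using restrict_field_diff[of "R + S" S] assms by simp

lemma restrict_field_sum:
  "(\<And>i. i \<in> I \<Longrightarrow> bounded_deg (f i)) \<Longrightarrow> restrict_field N a (sum f I) = (\<Sum>i\<in>I. restrict_field N a (f i))"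
  by (induction I rule: infinite_finite_induct) (auto simp: restrict_field_add)

lemma restrict_field_neg_one_power_times:
  assumes "bounded_deg R"
  shows "restrict_field N a ((-1) ^ k * R) = (-1) ^ k * restrict_field N a R"
  using restrict_field_diff[of 0 R] assms by (cases "even k") auto

lemma restrict_field_qshift:
  assumes "bounded_deg R"
  shows "restrict_field N a (qshift q j R) = qshift q j (restrict_field N a R)"
proof -
  obtain K where K: "deg_le (int K) R"
    using bounded_deg_common[OF assms assms] .
  show ?thesis
    by (rule cf_eqI) (simp add: cf_restrict_field[where K = K and d = "int K", OF _ order_refl N_pos] K deg_le_qshift
        sum_distrib_left mult_ac)
qed

lemma restrict_field_tgen: "restrict_field N a (tgen N) = const_field a"
proof (rule cf_eqI)
  fix \<mu>
  have "(\<Sum>k\<le>N. a ^ k * cf (tgen N) (\<mu> + replicate_mset k (N, 0))) = (if \<mu> = {#} then a else 0)"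
    if no: "\<nexists>m. (N, m) \<in># \<mu>"
  proof (cases "\<mu> = {#}")
    case True
    have "cf (tgen N) (replicate_mset k (N, 0 :: int)) = (if k = 1 then 1 else 0)" for k
    proof -
      have "replicate_mset k (N, 0 :: int) = {#(N, 0)#} \<longleftrightarrow> k = 1"
        by (cases k) auto
      then show ?thesis by (simp add: cf_tgen[OF N_pos])
    qed
    then have "(\<Sum>k\<le>N. a ^ k * cf (tgen N) (\<mu> + replicate_mset k (N, 0)))
        = (\<Sum>k\<le>N. if k = 1 then a ^ k else 0)"
      using True by (intro sum.cong) auto
    then show ?thesis using N_pos True by simp
  next
    case False
    have "\<mu> + replicate_mset k (N, 0) \<noteq> {#(N, w)#}" for k w
    proof
      assume eq: "\<mu> + replicate_mset k (N, 0) = {#(N, w)#}"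
      obtain x where x: "x \<in># \<mu>"
        using False by (auto elim: multiset_nonemptyE)
      then have "x \<in># {#(N, w)#}"
        unfolding eq[symmetric] by simp
      with x no show False by auto
    qed
    then show ?thesis using False by (simp add: cf_tgen[OF N_pos])
  qed
  then show "cf (restrict_field N a (tgen N)) \<mu> = cf (const_field a) \<mu>"
    by (auto simp: cf_restrict_field[OF deg_le_tgen order_refl N_pos] cf_const_field)
qed

text \<open>When \<open>\<mu>\<close> is free of t_N, splitting \<open>\<mu>\<close> together with
  \<open>k\<close> copies of t_N[0] means splitting \<open>\<mu>\<close> and choosing how many
  copies go to the first part. The double sum is then a Cauchy product.\<close>

lemma restrict_field_times:
  assumes "bounded_deg R" "bounded_deg S"
  shows "restrict_field N a (R * S) = restrict_field N a R * restrict_field N a S"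
proof (rule cf_eqI)
  fix \<mu>
  obtain K where K: "deg_le (int K) R" "deg_le (int K) S"
    using bounded_deg_common[OF assms] .
  have K2: "deg_le (int (2 * K)) (R * S)" "deg_le (int (2 * K)) R" "deg_le (int (2 * K)) S"
    using deg_le_times[OF K] K by (auto intro: deg_le_mono)
  define p where "p = (N, 0 :: int)"
  note cf_res = K2[THEN cf_restrict_field[where K = "2 * K" and d = "int (2 * K)"], OF order_refl N_pos, folded p_def]
  show "cf (restrict_field N a (R * S)) \<mu> = cf (restrict_field N a R * restrict_field N a S) \<mu>"
  proof (cases "\<exists>m. (N, m) \<in># \<mu>")
    case True
    have "cf (restrict_field N a R) \<alpha> * cf (restrict_field N a S) \<beta> = 0" if "\<alpha> + \<beta> = \<mu>" for \<alpha> \<beta>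
      using True that by (auto simp: cf_res)
    then have "cf (restrict_field N a R * restrict_field N a S) \<mu> = 0"
      unfolding cf_times by (intro sum.neutral) auto
    then show ?thesis
      using True by (simp add: cf_res)
  next
    case False
    let ?r = "\<lambda>k. replicate_mset k p"
    let ?g = "\<lambda>\<alpha> \<beta> i j. (a ^ i * cf R (\<alpha> + ?r i)) * (a ^ j * cf S (\<beta> + ?r j))"
    have split: "cf (R * S) (\<mu> + ?r k) = (\<Sum>((\<alpha>, \<beta>), i)\<in>splits \<mu> \<times> {..k}. cf R (\<alpha> + ?r i) * cf S (\<beta> + ?r (k - i)))"
      for k
    proof -
      have p: "count \<mu> p = 0"
        using False by (auto simp: p_def count_eq_zero_iff)
      \<comment> \<open>\<open>I\<close> distributes the copies of t_N[0], \<open>J\<close> counts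
        and removes them. They are mutually inverse because no part of a splitting of
        \<open>\<mu>\<close> contains t_N[0].\<close>
      define I where "I = (\<lambda>((\<alpha>, \<beta>), i). (\<alpha> + ?r i, \<beta> + ?r (k - i)))"
      define J where "J = (\<lambda>(\<alpha>, \<beta>). ((\<alpha> - ?r (count \<alpha> p), \<beta> - ?r (count \<beta> p)), count \<alpha> p))"
      have IJ: "I (J x) = x \<and> J x \<in> splits \<mu> \<times> {..k}" if x_in: "x \<in> splits (\<mu> + ?r k)" for x
      proof -
        obtain \<alpha> \<beta> where x: "x = (\<alpha>, \<beta>)" "\<alpha> + \<beta> = \<mu> + ?r k"
          using x_in by (cases x) auto
        have c: "count \<alpha> p + count \<beta> p = k"
          using arg_cong[OF x(2), of "\<lambda>M. count M p"] p by simp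
        then have c': "k - count \<alpha> p = count \<beta> p" "count \<alpha> p \<le> k"
          by simp_all
        have "\<alpha> - ?r (count \<alpha> p) + ?r (count \<alpha> p) = \<alpha>" "\<beta> - ?r (count \<beta> p) + ?r (count \<beta> p) = \<beta>"
          by (rule multiset_eqI; simp)+
        moreover have "(\<alpha> - ?r (count \<alpha> p)) + (\<beta> - ?r (count \<beta> p)) = \<mu>"
        proof (rule multiset_eqI)
          fix y
          show "count ((\<alpha> - ?r (count \<alpha> p)) + (\<beta> - ?r (count \<beta> p))) y = count \<mu> y"
            using arg_cong[OF x(2), of "\<lambda>M. count M y"] p by (cases "y = p") simp_all
        qed
        ultimately show ?thesis
          by (simp add: I_def J_def x(1) c')
      qed
      have JI: "J (I y) = y \<and> I y \<in> splits (\<mu> + ?r k)" if y_in: "y \<in> splits \<mu> \<times> {..k}" for y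
      proof -
        obtain \<alpha> \<beta> i where y: "y = ((\<alpha>, \<beta>), i)" "\<alpha> + \<beta> = \<mu>" "i \<le> k"
          using y_in by (cases y) auto
        have "count \<alpha> p = 0" "count \<beta> p = 0"
          using arg_cong[OF y(2), of "\<lambda>M. count M p"] p by auto
        moreover have "\<alpha> + ?r i + (\<beta> + ?r (k - i)) = \<mu> + ?r k"
          using y(3) by (intro multiset_eqI) (simp add: y(2)[symmetric])
        ultimately show ?thesis
          by (simp add: I_def J_def y(1))
      qed
      have "bij_betw I (splits \<mu> \<times> {..k}) (splits (\<mu> + ?r k))"
        by (intro bij_betw_byWitness[where f' = J] ballI image_subsetI conjunct1[OF JI]
            conjunct1[OF IJ] conjunct2[OF JI] conjunct2[OF IJ])
      from sum.reindex_bij_betw[OF this, of "\<lambda>(\<alpha>, \<beta>). cf R \<alpha> * cf S \<beta>"] show ?thesis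
        unfolding cf_times by (simp add: I_def case_prod_unfold)
    qed
    have vanish: "cf T (\<nu> + ?r i) = 0" if T: "deg_le (int K) T" and i: "i > K" for T \<nu> i
    proof (rule ccontr)
      assume "cf T (\<nu> + ?r i) \<noteq> 0"
      then have "deg (\<nu> + ?r i) \<le> K"
        using T unfolding deg_le_def by (metis of_nat_le_iff)
      moreover have "i * N \<ge> i" using N_pos by simp
      ultimately show False using i by (simp add: p_def)
    qed
    \<comment> \<open>Beyond the triangle one of the exponents exceeds \<open>K\<close> and its
      coefficient vanishes, so the triangle may be completed to the square.\<close>
    have zero: "?g \<alpha> \<beta> i j = 0" if "i + j > 2 * K" for \<alpha> \<beta> i j
    proof -
      from that consider "i > K" | "j > K" by linarith
      then show ?thesis by cases (simp_all add: vanish K)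
    qed
    have "cf (restrict_field N a (R * S)) \<mu> = (\<Sum>k\<le>2 * K. a ^ k * cf (R * S) (\<mu> + ?r k))"
      using False by (simp add: cf_res)
    also have "\<dots> = (\<Sum>k\<le>2 * K. \<Sum>(\<alpha>, \<beta>)\<in>splits \<mu>. \<Sum>i\<le>k. ?g \<alpha> \<beta> i (k - i))"
    proof (rule sum.cong[OF refl])
      fix k
      have "a ^ k * (x * y) = (a ^ i * x) * (a ^ (k - i) * y)" if "i \<le> k" for i x y
        using that by (simp add: mult_ac) (metis le_add_diff_inverse mult.left_commute power_add)
      then show "a ^ k * cf (R * S) (\<mu> + ?r k) = (\<Sum>(\<alpha>, \<beta>)\<in>splits \<mu>. \<Sum>i\<le>k. ?g \<alpha> \<beta> i (k - i))"
        unfolding split sum_distrib_left sum.cartesian_product'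
        by (intro sum.cong) (auto intro!: sum.cong)
    qed
    also have "\<dots> = (\<Sum>(\<alpha>, \<beta>)\<in>splits \<mu>. \<Sum>k\<le>2 * K. \<Sum>i\<le>k. ?g \<alpha> \<beta> i (k - i))"
      by (subst sum.swap) (simp add: case_prod_unfold)
    also have "\<dots> = (\<Sum>(\<alpha>, \<beta>)\<in>splits \<mu>. (\<Sum>i\<le>2 * K. a ^ i * cf R (\<alpha> + ?r i)) * (\<Sum>j\<le>2 * K. a ^ j * cf S (\<beta> + ?r j)))"
    proof (rule sum.cong[OF refl], clarify)
      fix \<alpha> \<beta>
      have "(\<Sum>k\<le>2 * K. \<Sum>i\<le>k. ?g \<alpha> \<beta> i (k - i)) = (\<Sum>(i, j)\<in>{(i, j). i + j \<le> 2 * K}. ?g \<alpha> \<beta> i j)"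
        by (rule sum.triangle_reindex_eq[symmetric])
      also have "\<dots> = (\<Sum>(i, j)\<in>{..2 * K} \<times> {..2 * K}. ?g \<alpha> \<beta> i j)"
      proof (rule sum.mono_neutral_left)
        show "\<forall>x\<in>{..2 * K} \<times> {..2 * K} - {(i, j). i + j \<le> 2 * K}. (case x of (i, j) \<Rightarrow> ?g \<alpha> \<beta> i j) = 0"
        proof
          fix x assume x: "x \<in> {..2 * K} \<times> {..2 * K} - {(i, j). i + j \<le> 2 * K}"
          obtain i j where ij: "x = (i, j)" by (cases x)
          then have "?g \<alpha> \<beta> i j = 0" using x by (intro zero) simp
          then show "(case x of (i, j) \<Rightarrow> ?g \<alpha> \<beta> i j) = 0" by (simp only: ij prod.case)
        qed
      qed auto
      also have "\<dots> = (\<Sum>i\<le>2 * K. a ^ i * cf R (\<alpha> + ?r i)) * (\<Sum>j\<le>2 * K. a ^ j * cf S (\<beta> + ?r j))"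
        by (simp add: sum_product sum.cartesian_product)
      finally show "(\<Sum>k\<le>2 * K. \<Sum>i\<le>k. ?g \<alpha> \<beta> i (k - i)) = \<dots>" .
    qed
    also have "\<dots> = cf (restrict_field N a R * restrict_field N a S) \<mu>"
      unfolding cf_times
    proof (rule sum.cong[OF refl], clarify)
      fix \<alpha> \<beta> assume "(\<alpha>, \<beta>) \<in> splits \<mu>"
      then have "\<nexists>m. (N, m) \<in># \<alpha>" "\<nexists>m. (N, m) \<in># \<beta>"
        using False by auto
      then show "(\<Sum>i\<le>2 * K. a ^ i * cf R (\<alpha> + ?r i)) * (\<Sum>j\<le>2 * K. a ^ j * cf S (\<beta> + ?r j))
          = cf (restrict_field N a R) \<alpha> * cf (restrict_field N a S) \<beta>"
        by (simp only: cf_res if_False)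
    qed
    finally show ?thesis .
  qed
qed

end

section \<open>Restricted brackets of the Hamiltonians\<close>

lemma restrict_tN_integral0: "restrict_tN N a (integral0 R) = integral0 (restrict_field N a R)"
  by (simp add: integral0_def fourier_restrict_field)

lemma fourier_const_field_times: "fourier (const_field c * R) m = fconst c * fourier R m"
  by (rule fser_eqI) (simp add: coeff_fourier)

lemma qshift_const_field_times: "qshift q j (const_field c * R) = const_field c * qshift q j R"
  by (rule cf_eqI) simp

context lax
begin


text \<open>Removing a variable from a monomial does not raise its degree, and the residue of
  \<open>P \<up> n\<close> has degree at most \<open>n\<close>.\<close>

lemma bounded_deg_gradient: "bounded_deg (gradient j (hamiltonian q N n))"
proof -
  let ?H = "hamiltonian q N n"
  have R: "deg_le (int n) ((P \<up> n) 0)"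
    using op_deg_le_power[OF P_qops lax_root(4), of n] unfolding op_deg_le_def by (metis diff_zero)
  have "deg_le (int n) (gradient j ?H)"
    unfolding deg_le_def
  proof (intro allI impI)
    fix \<mu> assume ne: "cf (gradient j ?H) \<mu> \<noteq> 0"
    have "cf (gradient j ?H) \<mu> = coeff (fourier (gradient j ?H) (wt \<mu>)) \<mu>"
      by (simp add: coeff_fourier)
    also have "\<dots> = of_nat (count \<mu> (j, - wt \<mu>) + 1) * coeff ?H (add_mset (j, - wt \<mu>) \<mu>)"
      unfolding fourier_gradient[OF homogeneous_hamiltonian] coeff_fderiv ..
    finally have "coeff ?H (add_mset (j, - wt \<mu>) \<mu>) \<noteq> 0"
      using ne by auto
    then have "cf ((P \<up> n) 0) (add_mset (j, - wt \<mu>) \<mu>) \<noteq> 0"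
      by (auto simp: hamiltonian_eq op_trace_def integral0_def coeff_fourier split: if_splits)
    then show "int (deg \<mu>) \<le> int n"
      using R by (force simp: deg_le_def)
  qed
  then show ?thesis by (auto simp: bounded_deg_def)
qed

context
  fixes a :: complex and m :: nat
begin

abbreviation restr :: "qfield \<Rightarrow> qfield" where
  "restr \<equiv> restrict_field N a"

abbreviation H :: "nat \<Rightarrow> fser" where
  "H \<equiv> hamiltonian q N"

lemma bounded_deg_bracket1_term:
  "bounded_deg (bracket1_term (H m) (tgen N) i j)" "bounded_deg (bracket1_term (H m) 1 i j)"
  using bounded_deg_simps(2)[of 0] by (simp_all add: bracket1_term_def bounded_deg_gradient)

lemma bounded_deg_bracket_field:
  assumes "i \<le> N"
  shows "bounded_deg (bracket_field N (bracket1 q N) (H m) i)"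
    "bounded_deg (bracket_field N (bracket1_corr q N) (H m) i)"
  using assms by (simp_all add: bracket1_def bracket1_corr_def bracket_field_bracket1
      homogeneous_hamiltonian bounded_deg_bracket1_term bracket1_term_corr)

text \<open>Gradients are formed before restricting and may depend on t_N. Restriction then acts
  factor by factor and turns the prefactor t_N into \<open>a\<close>, whereas (-1)^N stays; the
  constant is the ratio of the two prefactors.\<close>

lemma restrict_bracket_field:
  assumes "i \<le> N"
  shows "restr (bracket_field N (bracket1 q N) (H m) i)
    = const_field ((-1) ^ N * a) * restr (bracket_field N (bracket1_corr q N) (H m) i)"
proof -
  have N: "N \<ge> 1" using N_ge by simp
  note [simp] = bounded_deg_gradient bounded_deg_bracket1_term
  have "restr (bracket1_term (H m) (tgen N) i j)
      = const_field ((-1) ^ N * a) * restr (bracket1_term (H m) ((-1) ^ N) i j)" for j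
  proof -
    have 1: "restr (bracket1_term (H m) (tgen N) i j) = const_field a * restr (bracket1_term (H m) 1 i j)"
      by (simp add: bracket1_term_def restrict_field_diff[OF N] restrict_field_times[OF N]
          restrict_field_qshift[OF N] restrict_field_tgen[OF N] qshift_const_field_times
          right_diff_distrib mult.left_commute)
    have "const_field ((-1) ^ N * a) * ((-1) ^ N * R) = const_field a * R" for R
      by (cases "even N") (auto intro!: cf_eqI)
    then show ?thesis
      unfolding 1 bracket1_term_corr by (simp add: restrict_field_neg_one_power_times[OF N])
  qed
  with assms show ?thesis
    by (simp add: bracket1_def bracket1_corr_def bracket_field_bracket1 homogeneous_hamiltonian
        restrict_field_sum[OF N] bracket1_term_corr sum_distrib_left)
qed

text \<open>Written as the integral of gradients times hamiltonian fields, the bracket is restricted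
  factor by factor.\<close>

lemma restrict_pbracket:
  "restrict_tN N a (pbracket N (bracket1 q N) (H n) (H m))
    = fconst ((-1) ^ N * a) * restrict_tN N a (pbracket N (bracket1_corr q N) (H n) (H m))"
proof -
  have N: "N \<ge> 1" using N_ge by simp
  have b: "bihomogeneous (bracket1 q N i j)" for i j
    by (simp add: bracket1_def bihomogeneous_bracket1)
  have "restr (\<Sum>i=1..N. gradient i (H n) * bracket_field N (bracket1 q N) (H m) i)
     = const_field ((-1) ^ N * a)
       * restr (\<Sum>i=1..N. gradient i (H n) * bracket_field N (bracket1_corr q N) (H m) i)"
  proof (subst (1 2) restrict_field_sum[OF N])
    show "(\<Sum>i=1..N. restr (gradient i (H n) * bracket_field N (bracket1 q N) (H m) i))
      = const_field ((-1) ^ N * a)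
        * (\<Sum>i=1..N. restr (gradient i (H n) * bracket_field N (bracket1_corr q N) (H m) i))"
      unfolding sum_distrib_left
      by (rule sum.cong) (simp_all add: restrict_field_times[OF N] bounded_deg_gradient
          bounded_deg_bracket_field restrict_bracket_field mult.left_commute)
  qed (simp_all add: bounded_deg_gradient bounded_deg_bracket_field)
  then show ?thesis
    by (simp only: pbracket_eq_vder[OF b homogeneous_hamiltonian homogeneous_hamiltonian]
        pbracket_eq_vder[OF bihomogeneous_bracket1_corr homogeneous_hamiltonian homogeneous_hamiltonian]
        vder_fser_gradient[OF homogeneous_hamiltonian] restrict_tN_integral0)
      (simp only: integral0_def fourier_const_field_times)
qed

lemma restrict_L_bracket:
  "restr (L_bracket N (bracket1 q N) (H m) k)
    = const_field ((-1) ^ N * a) * restr (L_bracket N (bracket1_corr q N) (H m) k)"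
proof -
  have N: "N \<ge> 1" using N_ge by simp
  \<comment> \<open>\<open>C\<close> gives each order by a single component, to which the result for
    hamiltonian fields applies.\<close>
  define C where "C = (\<lambda>b n. if 0 \<le> n \<and> n < int N
    then (-1) ^ nat (int N - n) * bracket_field N b (H m) (nat (int N - n)) else 0)"
  have b: "bihomogeneous (bracket1 q N i j)" for i j
    by (simp add: bracket1_def bihomogeneous_bracket1)
  have "L_bracket N (bracket1 q N) (H m) = C (bracket1 q N)"
    by (rule L_bracket_eq[OF b homogeneous_hamiltonian]) (auto simp: C_def)
  moreover have "L_bracket N (bracket1_corr q N) (H m) = C (bracket1_corr q N)"
    by (rule L_bracket_eq[OF bihomogeneous_bracket1_corr homogeneous_hamiltonian]) (auto simp: C_def)
  moreover have "restr (C (bracket1 q N) k) = const_field ((-1) ^ N * a) * restr (C (bracket1_corr q N) k)"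
  proof (cases "0 \<le> k \<and> k < int N")
    case True
    define i where "i = nat (int N - k)"
    have i: "i \<le> N" using True by (simp add: i_def nat_le_iff)
    have "C b k = (-1) ^ i * bracket_field N b (H m) i" for b
      using True by (simp add: C_def i_def)
    then show ?thesis
      by (simp only: restrict_field_neg_one_power_times[OF N] bounded_deg_bracket_field[OF i]
          restrict_bracket_field[OF i] mult.left_commute)
  next
    case False
    then show ?thesis by (auto simp: C_def)
  qed
  ultimately show ?thesis by simp
qed

end

end

theorem theorem1:
  fixes q :: complex and N :: nat
  assumes "q \<noteq> 0" and "\<forall>k\<ge>1. q ^ k \<noteq> 1" and "N \<ge> 2"
  shows
    "(\<forall>n\<ge>1.
        flow_L q N n = op_comm q (lax_L N) (op_plus_part (lax_frac_power q N n))
      \<and> flow_L q N n = L_bracket N (bracket1_corr q N) (hamiltonian q N (n + N))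
      \<and> flow_L q N n = L_bracket N (bracket2 q N) (hamiltonian q N n))
   \<and> (\<forall>n\<ge>1. \<forall>m\<ge>1.
        pbracket N (bracket1_corr q N) (hamiltonian q N n) (hamiltonian q N m) = 0
      \<and> pbracket N (bracket2 q N) (hamiltonian q N n) (hamiltonian q N m) = 0)
   \<and> (\<forall>a. \<forall>n\<ge>1.
        (\<forall>k m. restrict_tN N a
             (fourier (L_bracket N (bracket1 q N) (hamiltonian q N (n + N)) k) m)
           = fconst ((-1) ^ N * a) * restrict_tN N a (fourier (flow_L q N n k) m))
      \<and> (\<forall>m\<ge>1. restrict_tN N a
             (pbracket N (bracket1 q N) (hamiltonian q N n) (hamiltonian q N m)) = 0))"
proof -
  interpret lax q N
    using assms by unfold_locales auto
  have bracket1: "L_bracket N (bracket1_corr q N) (hamiltonian q N (n + N)) = flow_L q N n" if "n \<ge> 1" for n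
    using that by (simp add: L_bracket_bracket1_corr flow_L_eq Z_add_N)
  have bracket2: "L_bracket N (bracket2 q N) (hamiltonian q N n) = flow_L q N n" if "n \<ge> 1" for n
    using that by (simp add: L_bracket_bracket2 flow_L_eq)
  have comm: "flow_L q N n = op_comm q (lax_L N) (op_plus_part (lax_frac_power q N n))" for n
    by (simp add: flow_L_eq lax_frac_power_def)
  \<comment> \<open>The flow is rewritten as the corrected linear bracket, so the claim becomes a
    comparison of two brackets under restriction.\<close>
  have "restrict_tN N a (fourier (L_bracket N (bracket1 q N) (hamiltonian q N (n + N)) k) m)
      = fconst ((-1) ^ N * a) * restrict_tN N a (fourier (flow_L q N n k) m)" if "n \<ge> 1" for a n k m
    unfolding bracket1[OF that, symmetric] fourier_restrict_field[symmetric] restrict_L_bracket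
      fourier_const_field_times ..
  moreover have "restrict_tN N a (pbracket N (bracket1 q N) (hamiltonian q N n) (hamiltonian q N m)) = 0"
    if "n \<ge> 1" "m \<ge> 1" for a n m
  proof -
    have "restrict_tN N a 0 = 0"
      by (rule fser_eqI) (simp add: coeff_restrict_tN)
    then show ?thesis
      using that by (simp add: restrict_pbracket pbracket_bracket1_corr)
  qed
  ultimately show ?thesis
    by (simp add: bracket1 bracket2 pbracket_bracket1_corr pbracket_bracket2 comm[symmetric])
qed

end
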